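(* Let $\{\theta_{ij}\}_{(i,j)\in\mathbb{Z}^2}$ be real numbers such that only finitely many $\theta_{ij}$ are nonzero, $\theta_{ij}=\theta_{-i,-j}$ for all $(i,j)$, $\theta_{00}>0$, and $$f(\omega_1,\omega_2)=\frac{1}{4\pi^2}\,\frac{1}{\sum_{(i,j)\in\mathbb{Z}^2}\theta_{ij}\exp(-\iota(i\omega_1+j\omega_2))}$$ is well defined and satisfies $f(\omega_1,\omega_2)>0$ for all $(\omega_1,\omega_2)\in(-\pi,\pi]^2$ (where $\iota=\sqrt{-1}$). Let $\{X_{ij}\}$ be the zero-mean stationary Gauss-Markov random field on $\mathbb{Z}^2$ given by the conditional autoregression with coefficients $\{\theta_{ij}\}$, so that $f$ is its spectral density. Let $\{W_{ij}\}$ be i.i.d. $\mathcal{N}(0,\sigma^2)$ with $\sigma^2>0$ known, independent of $\{X_{ij}\}$. Consider Neyman-Pearson detection at level $\alpha\in(0,1)$ between $$\mathcal{H}_0:\ Y_{ij}=W_{ij},\ (i,j)\in\mathcal{I}\qquad\text{vs.}\qquad \mathcal{H}_1:\ Y_{ij}=X_{ij}+W_{ij},\ (i,j)\in\mathcal{I},$$ where $\mathcal{I}=\{-m,\dots,m\}^2$ has $n=(2m+1)^2$ sites. Let $P_M=P_M(n,\alpha)$ be the miss probability of the Neyman-Pearson detector with false-alarm probability at most $\alpha$. Then the error exponent $$\mathcal{K}=\lim_{n\to\infty}-\frac1n\log P_M$$ exists, is independent of $\alpha$, and is given by $$\mathcal{K}=\frac{1}{4\pi^2}\int_{-\pi}^{\pi}\int_{-\pi}^{\pi}\left(\frac12\log\frac{\sigma^2+4\pi^2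 f(\omega_1,\omega_2)}{\sigma^2}+\frac12\,\frac{\sigma^2}{\sigma^2+4\pi^2 f(\omega_1,\omega_2)}-\frac12\right)d\omega_1\,d\omega_2$$ $$=\frac{1}{4\pi^2}\int_{-\pi}^{\pi}\int_{-\pi}^{\pi}D\big(\mathcal{N}(0,S_0^y(\omega_1,\omega_2))\,\big\|\,\mathcal{N}(0,S_1^y(\omega_1,\omega_2))\big)\,d\omega_1\,d\omega_2,$$ where $S_0^y=\frac{\sigma^2}{4\pi^2}$, $S_1^y=\frac{\sigma^2}{4\pi^2}+f$, and $D(\cdot\|\cdot)$ is the Kullback-Leibler divergence.
   Context: Conditional autoregression (CAR): a Gaussian field on $\mathbb{Z}^2$ specified by its full conditional normal distributions with conditional mean $\mathbb{E}\{X_{ij}\mid X_{-ij}\}=-\frac{1}{\theta_{00}}\sum_{(i',j')\neq(0,0)}\theta_{i'j'}X_{i+i',j+j'}$ and conditional precision (inverse variance) $\mathrm{Prec}\{X_{ij}\mid X_{-ij}\}=\theta_{00}>0$, where $X_{-ij}$ denotes all variables except $X_{ij}$. Under the stated conditions on $\{\theta_{ij}\}$ it is known that this is a zero-mean stationary Gaussian process on $\mathbb{Z}^2$ with spectral density $f$, and this may be taken as its definition. Spectral density convention: for a zero-mean stationary field with covariance $\gamma_{ij}=\mathbb{E}\{X_{00}X_{ij}\}$, $f(\omega_1,\omega_2)=\frac{1}{4\pi^2}\sum_{(i,j)\in\mathbb{Z}^2}\gamma_{ij}\exp(-\iota(i\omega_1+j\omega_2))$; equivalently $\gamma_{ij}=\int_{-\pi}^{\pi}\int_{-\pi}^{\pi}f(\omega_1,\omega_2)e^{\iota(i\omega_1+j\omega_2)}\,d\omega_1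 d\omega_2$. The Neyman-Pearson detector at level $\alpha$ minimizes the miss probability $P_M$ (probability of deciding $\mathcal{H}_0$ when $\mathcal{H}_1$ is true) among all (possibly randomized) tests based on $\{Y_{ij}\}_{(i,j)\in\mathcal{I}}$ whose false-alarm probability $P_F$ (probability of deciding $\mathcal{H}_1$ when $\mathcal{H}_0$ is true) is at most $\alpha$. $\mathcal{N}(0,s)$ is the normal law with mean $0$ and variance $s$; $\log$ is the natural logarithm. *)

theory Defs
  imports "HOL-Probability.Probability"
begin

type_synonym site = "int \<times> int"

text \<open>The second parameter is the variance, whereas \<^const>\<open>normal_density\<close> takes the standard
  deviation.  The degenerate law (variance zero) is needed for linear combinations of a
  Gaussian field whose coefficients may vanish.\<close>

definition normal_law :: "real \<Rightarrow> real \<Rightarrow> real measure" where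
  "normal_law \<mu> s =
     (if s = 0 then return borel \<mu> else density lborel (normal_density \<mu> (sqrt s)))"

definition gaussian_field :: "'a measure \<Rightarrow> (site \<Rightarrow> 'a \<Rightarrow> real) \<Rightarrow> bool" where
  "gaussian_field M X \<longleftrightarrow>
     (\<forall>p. X p \<in> borel_measurable M) \<and>
     (\<forall>S (a :: site \<Rightarrow> real). finite S \<longrightarrow>
        (\<exists>\<mu> s. 0 \<le> s \<and> distr M borel (\<lambda>\<omega>. \<Sum>p\<in>S. a p * X p \<omega>) = normal_law \<mu> s))"

definition zero_mean :: "'a measure \<Rightarrow> (site \<Rightarrow> 'a \<Rightarrow> real) \<Rightarrow> bool" where
  "zero_mean M X \<longleftrightarrow> (\<forall>p. integrable M (X p) \<and> (\<integral>\<omega>. X p \<omega> \<partial>M) = 0)"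

text \<open>Covariance stationarity of a zero-mean field; for Gaussian fields this is the same as
  shift invariance of all finite-dimensional laws.\<close>

definition stationary :: "'a measure \<Rightarrow> (site \<Rightarrow> 'a \<Rightarrow> real) \<Rightarrow> bool" where
  "stationary M X \<longleftrightarrow>
     (\<forall>p q. integrable M (\<lambda>\<omega>. X p \<omega> * X q \<omega>)) \<and>
     (\<forall>p h. (\<integral>\<omega>. X p \<omega> * X (p + h) \<omega> \<partial>M) = (\<integral>\<omega>. X 0 \<omega> * X h \<omega> \<partial>M))"

definition autocov :: "'a measure \<Rightarrow> (site \<Rightarrow> 'a \<Rightarrow> real) \<Rightarrow> site \<Rightarrow> real" where
  "autocov M X h = (\<integral>\<omega>. X 0 \<omega> * X h \<omega> \<partial>M)"

definition freq_pairing :: "site \<Rightarrow> real \<times> real \<Rightarrow> real" where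
  "freq_pairing h w = of_int (fst h) * fst w + of_int (snd h) * snd w"

abbreviation freq_square :: "(real \<times> real) set" where
  "freq_square \<equiv> {-pi..pi} \<times> {-pi..pi}"

definition has_spectral_density ::
    "'a measure \<Rightarrow> (site \<Rightarrow> 'a \<Rightarrow> real) \<Rightarrow> (real \<times> real \<Rightarrow> real) \<Rightarrow> bool" where
  "has_spectral_density M X f \<longleftrightarrow>
     set_integrable lborel freq_square f \<and>
     (\<forall>h. complex_of_real (autocov M X h) =
        (LINT w:freq_square|lborel.
           complex_of_real (f w) * exp (\<i> * complex_of_real (freq_pairing h w))))"

definition car_symbol :: "(site \<Rightarrow> real) \<Rightarrow> real \<times> real \<Rightarrow> complex" where
  "car_symbol \<theta> w =
     (\<Sum>p | \<theta> p \<noteq> 0. complex_of_real (\<theta> p) * exp (- \<i> * complex_of_real (freq_pairing p w)))"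

text \<open>If \<open>\<theta> p = \<theta> (- p)\<close> for all \<open>p\<close>, then the symbol is real, so taking the real part only
  changes the type.\<close>

definition car_spectral_density :: "(site \<Rightarrow> real) \<Rightarrow> real \<times> real \<Rightarrow> real" where
  "car_spectral_density \<theta> w = Re (1 / complex_of_real (4 * pi\<^sup>2) * (1 / car_symbol \<theta> w))"

text \<open>The conditional autoregression has conditional precision \<open>\<theta> 0\<close> and conditional mean
  \<open>- (1 / \<theta> 0) * (\<Sum>h | h \<noteq> 0. \<theta> h * X (p + h))\<close> at \<open>p\<close>.  It is defined here as the zero-mean
  stationary Gaussian field with the corresponding spectral density.\<close>

definition car_field :: "'a measure \<Rightarrow> (site \<Rightarrow> real) \<Rightarrow> (site \<Rightarrow> 'a \<Rightarrow> real) \<Rightarrow> bool" where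
  "car_field M \<theta> X \<longleftrightarrow>
     gaussian_field M X \<and> zero_mean M X \<and> stationary M X \<and>
     has_spectral_density M X (car_spectral_density \<theta>)"

definition site_square :: "nat \<Rightarrow> site set" where
  "site_square m = {- int m..int m} \<times> {- int m..int m}"

definition observe :: "site set \<Rightarrow> (site \<Rightarrow> 'a \<Rightarrow> real) \<Rightarrow> 'a \<Rightarrow> site \<Rightarrow> real" where
  "observe I Y \<omega> = (\<lambda>p\<in>I. Y p \<omega>)"

text \<open>A randomized test; \<open>\<phi> y\<close> is the probability of deciding for the alternative after
  observing \<open>y\<close>.\<close>

definition randomized_test :: "site set \<Rightarrow> ((site \<Rightarrow> real) \<Rightarrow> real) \<Rightarrow> bool" where
  "randomized_test I \<phi> \<longleftrightarrow>
     \<phi> \<in> borel_measurable (PiM I (\<lambda>_. borel)) \<and>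
     (\<forall>y \<in> space (PiM I (\<lambda>_. borel :: real measure)). 0 \<le> \<phi> y \<and> \<phi> y \<le> 1)"

definition false_alarm_prob ::
    "'a measure \<Rightarrow> site set \<Rightarrow> (site \<Rightarrow> 'a \<Rightarrow> real) \<Rightarrow> ((site \<Rightarrow> real) \<Rightarrow> real) \<Rightarrow> real" where
  "false_alarm_prob M I Y0 \<phi> = (\<integral>\<omega>. \<phi> (observe I Y0 \<omega>) \<partial>M)"

definition miss_prob ::
    "'a measure \<Rightarrow> site set \<Rightarrow> (site \<Rightarrow> 'a \<Rightarrow> real) \<Rightarrow> ((site \<Rightarrow> real) \<Rightarrow> real) \<Rightarrow> real" where
  "miss_prob M I Y1 \<phi> = (\<integral>\<omega>. 1 - \<phi> (observe I Y1 \<omega>) \<partial>M)"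

text \<open>\<open>Y0\<close> and \<open>Y1\<close> are the observed fields under the null hypothesis and the alternative.\<close>

definition neyman_pearson_detector ::
    "'a measure \<Rightarrow> site set \<Rightarrow> (site \<Rightarrow> 'a \<Rightarrow> real) \<Rightarrow> (site \<Rightarrow> 'a \<Rightarrow> real) \<Rightarrow> real \<Rightarrow>
       ((site \<Rightarrow> real) \<Rightarrow> real) \<Rightarrow> bool" where
  "neyman_pearson_detector M I Y0 Y1 \<alpha> \<phi> \<longleftrightarrow>
     randomized_test I \<phi> \<and> false_alarm_prob M I Y0 \<phi> \<le> \<alpha> \<and>
     (\<forall>\<psi>. randomized_test I \<psi> \<and> false_alarm_prob M I Y0 \<psi> \<le> \<alpha> \<longrightarrow>
          miss_prob M I Y1 \<phi> \<le> miss_prob M I Y1 \<psi>)"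

text \<open>The divergence \<open>D(P \<parallel> Q)\<close> in nats.  The library's \<^const>\<open>KL_divergence\<close> takes the
  reference measure \<open>Q\<close> first.\<close>

definition kl_div :: "real measure \<Rightarrow> real measure \<Rightarrow> real" where
  "kl_div P Q = KL_divergence (exp 1) Q P"

end

theory Submission
  imports Defs "HOL-Real_Asymp.Real_Asymp"
begin

text \<open>By Stein's lemma the exponent is the limit in probability, under the null hypothesis, of the
  normalised log-likelihood ratio.  In an eigenbasis of the covariance matrix of the signal on
  \<open>site_square m\<close>, with eigenvalues \<open>l k\<close>, this ratio is a sum of independent terms with
  variance at most \<open>1/2\<close> and mean \<open>D(N(0,\<sigma>\<^sup>2) \<parallel> N(0,\<sigma>\<^sup>2 + l k))\<close>, so by Chebyshev it remains to
  average these divergences over the spectrum.  The divergence is a difference of two convex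
  Lipschitz functions of \<open>l k\<close>.  For such functions a Szego limit theorem follows from tangent lines:
  each eigenvalue is the mean of the symbol \<open>4 * pi\<^sup>2 * f\<close> with respect to the density given by its
  eigenvector, and averaging the eigenvalues against these densities at a fixed frequency yields the
  Fejer mean of the symbol, which converges uniformly because the symbol is the reciprocal of a
  nonvanishing trigonometric polynomial.\<close>

subsection \<open>Spectral theorem for symmetric kernels\<close>

text \<open>The covariance of the noise is a multiple of the identity, so a rotation into an
  eigenbasis of the signal covariance keeps the null law i.i.d. and makes the alternative a product;
  determinants and inverses of covariance matrices never appear. A Gaussian field is given only
  through the laws of its finite linear combinations, so the rotated laws are recognised by
  characteristic functions, which calls for a multidimensional uniqueness theorem. The divergence
  is, up to a constant, the concave \<open>1/2 * ln ((s + l) / s)\<close> plus the convex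
  \<open>1/2 * (s / (s + l))\<close>; hence the split. The modulus of continuity of the symbol is
  stated as \<epsilon> plus a multiple of 2 - cos - cos in the frequency difference, because the
  Fejer kernel of a finite set integrates a trigonometric polynomial exactly. The second part then
  becomes a count of boundary sites, of order \<open>m\<close> against
  \<open>(2 * m + 1)\<^sup>2\<close>. The level \<alpha> enters the final bounds only through a
  constant factor, which the normalised logarithm forgets, and through how soon they hold.\<close>

definition ip :: "'i set \<Rightarrow> ('i \<Rightarrow> real) \<Rightarrow> ('i \<Rightarrow> real) \<Rightarrow> real" where
  "ip I u v = (\<Sum>p\<in>I. u p * v p)"

definition kernel_op :: "'i set \<Rightarrow> ('i \<Rightarrow> 'i \<Rightarrow> real) \<Rightarrow> ('i \<Rightarrow> real) \<Rightarrow> 'i \<Rightarrow> real" where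
  "kernel_op I C v p = (\<Sum>q\<in>I. C p q * v q)"

lemma ip_commute: "ip I u v = ip I v u"
  by (simp add: ip_def mult.commute)

lemma ip_lincomb_left: "ip I (\<lambda>p. a * u p + b * v p) w = a * ip I u w + b * ip I v w"
  by (simp add: ip_def sum.distrib sum_distrib_left algebra_simps)

lemma ip_lincomb_right: "ip I w (\<lambda>p. a * u p + b * v p) = a * ip I w u + b * ip I w v"
  by (simp add: ip_def sum.distrib sum_distrib_left algebra_simps)

lemma ip_cong: "(\<And>p. p \<in> I \<Longrightarrow> u p = u' p) \<Longrightarrow> (\<And>p. p \<in> I \<Longrightarrow> v p = v' p) \<Longrightarrow> ip I u v = ip I u' v'"
  by (simp add: ip_def)

lemma ip_self_nonneg: "0 \<le> ip I u u"
  by (simp add: ip_def sum_nonneg)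

lemma ip_self_eq_0_iff: "finite I \<Longrightarrow> ip I u u = 0 \<longleftrightarrow> (\<forall>p\<in>I. u p = 0)"
  by (simp add: ip_def sum_nonneg_eq_0_iff)

lemma kernel_op_lincomb:
  "kernel_op I C (\<lambda>p. a * u p + b * v p) = (\<lambda>p. a * kernel_op I C u p + b * kernel_op I C v p)"
  by (simp add: kernel_op_def sum.distrib sum_distrib_left algebra_simps fun_eq_iff)

lemma kernel_op_self_adjoint:
  assumes "\<And>p q. p \<in> I \<Longrightarrow> q \<in> I \<Longrightarrow> C p q = C q p"
  shows "ip I (kernel_op I C u) v = ip I u (kernel_op I C v)"
proof -
  have "ip I (kernel_op I C u) v = (\<Sum>p\<in>I. \<Sum>q\<in>I. C p q * u q * v p)"
    by (simp add: ip_def kernel_op_def sum_distrib_right)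
  also have "\<dots> = (\<Sum>q\<in>I. \<Sum>p\<in>I. C p q * u q * v p)" by (rule sum.swap)
  also have "\<dots> = (\<Sum>q\<in>I. \<Sum>p\<in>I. u q * (C q p * v p))"
    by (intro sum.cong refl) (simp add: assms)
  finally show ?thesis by (simp add: ip_def kernel_op_def sum_distrib_left)
qed

text \<open>First-order condition: for small \<open>t\<close> of sign opposite to \<open>B\<close>
  the linear term outweighs the quadratic one. This turns maximality of a quadratic form into the
  eigenvalue equation.\<close>

lemma linear_term_eq_0:
  fixes B c :: real
  assumes "\<And>t. 0 \<le> 2 * t * B + t\<^sup>2 * c"
  shows "B = 0"
proof (rule ccontr)
  assume B: "B \<noteq> 0"
  define s where "s = 1 / (\<bar>c\<bar> + 1)"
  have s: "s > 0" "s * c < 2" by (auto simp: s_def divide_simps)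
  have "0 \<le> 2 * (- s * B) * B + (- s * B)\<^sup>2 * c" by (rule assms)
  also have "\<dots> = (s * B\<^sup>2) * (s * c - 2)" by (simp add: power2_eq_square algebra_simps)
  finally have "0 \<le> (s * B\<^sup>2) * (s * c - 2)" .
  moreover have "(s * B\<^sup>2) * (s * c - 2) < 0" using s B by (intro mult_pos_neg) auto
  ultimately show False by simp
qed

text \<open>The squared lengths of the projections of the coordinate unit vectors onto the span of
  the \<open>e j\<close> add up to \<open>card J\<close>. As this is less than
  \<open>card I\<close>, some unit vector lies outside the span, and \<open>x\<close> is its
  residual.\<close>

lemma orthogonal_vector_exists:
  assumes fin: "finite I" and "finite J" and less: "card J < card I"
    and on: "\<And>j k. j \<in> J \<Longrightarrow> k \<in> J \<Longrightarrow> ip I (e j) (e k) = (if j = k then 1 else 0)"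
  obtains x where "ip I x x > 0" "\<And>j. j \<in> J \<Longrightarrow> ip I (e j) x = 0"
proof -
  have "(\<Sum>p\<in>I. \<Sum>j\<in>J. e j p * e j p) = (\<Sum>j\<in>J. ip I (e j) (e j))"
    unfolding ip_def by (rule sum.swap)
  also have "\<dots> = card J" using on by simp
  also have "\<dots> < (\<Sum>p\<in>I. 1)" using less by simp
  finally have "\<exists>p\<in>I. (\<Sum>j\<in>J. e j p * e j p) < 1"
    by (meson linorder_not_less sum_mono)
  then obtain p where p: "p \<in> I" "(\<Sum>j\<in>J. e j p * e j p) < 1" by blast
  define x where "x q = (if q = p then 1 else 0) - (\<Sum>j\<in>J. e j p * e j q)" for q
  have *: "ip I (e k) x = 0" if "k \<in> J" for k
  proof -
    have "ip I (e k) x = (\<Sum>q\<in>I. e k q * (if q = p then 1 else 0)) - (\<Sum>q\<in>I. \<Sum>j\<in>J. e j p * (e k q * e j q))"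
      by (simp add: ip_def x_def right_diff_distrib sum_subtractf sum_distrib_left algebra_simps)
    also have "(\<Sum>q\<in>I. e k q * (if q = p then 1 else 0)) = e k p"
      using fin p by (simp add: if_distrib[of "\<lambda>c. e k _ * c"] cong: if_cong)
    also have "(\<Sum>q\<in>I. \<Sum>j\<in>J. e j p * (e k q * e j q)) = (\<Sum>j\<in>J. e j p * ip I (e k) (e j))"
      by (subst sum.swap) (simp add: ip_def sum_distrib_left)
    also have "\<dots> = (\<Sum>j\<in>J. if j = k then e j p else 0)" by (intro sum.cong refl) (use that on in auto)
    also have "\<dots> = e k p" using that assms by simp
    finally show ?thesis by simp
  qed
  have "x p \<noteq> 0" using p by (simp add: x_def)
  then have "ip I x x \<noteq> 0" using p fin by (auto simp: ip_self_eq_0_iff)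
  then have "ip I x x > 0" using ip_self_nonneg[of I x] by simp
  with * show ?thesis by (rule that[rotated])
qed

lemma rayleigh_maximizer:
  assumes fin: "finite I" and x: "ip I x x > 0" "\<And>j. j \<in> J \<Longrightarrow> ip I (e j) x = 0"
  obtains v where "ip I v v = 1" "\<And>j. j \<in> J \<Longrightarrow> ip I (e j) v = 0"
    "\<And>y. (\<And>j. j \<in> J \<Longrightarrow> ip I (e j) y = 0) \<Longrightarrow>
       ip I (kernel_op I C y) y \<le> ip I (kernel_op I C v) v * ip I y y"
proof -
  \<comment> \<open>Coordinates outside \<open>I\<close> are pinned to zero, since the index type
    may be infinite: the box is then a product of compact sets, hence compact by Tychonoff.\<close>
  define box :: "('a \<Rightarrow> real) set" where "box = (\<Pi>\<^sub>E i\<in>UNIV. if i \<in> I then {-1..1} else {0})"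
  define S where "S = box \<inter> ({v. ip I v v = 1} \<inter> {v. \<forall>j\<in>J. ip I (e j) v = 0})"
  have coord: "continuous_on A (\<lambda>v::'a \<Rightarrow> real. v p)" for p A
    by (rule continuous_on_subset[OF continuous_on_product_coordinates]) simp
  have "compactin (product_topology (\<lambda>i. euclidean) UNIV) box"
    unfolding box_def by (subst compactin_PiE) (auto split: if_splits)
  then have "compact box" by (simp add: euclidean_product_topology)
  moreover have "closed ({v::'a \<Rightarrow> real. ip I v v = 1} \<inter> {v. \<forall>j\<in>J. ip I (e j) v = 0})"
    unfolding ip_def Collect_ball_eq
    by (intro closed_Int closed_Collect_eq closed_INT ballI continuous_intros coord)
  ultimately have "compact S" unfolding S_def by blast
  \<comment> \<open>Besides scaling, \<open>nrm\<close> clears the coordinates outside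
    \<open>I\<close>, which neither \<open>ip\<close> nor \<open>kernel_op\<close> reads.\<close>
  define nrm where "nrm y p = (if p \<in> I then y p / sqrt (ip I y y) else 0)" for y p
  have nrm: "nrm y \<in> S" if y: "ip I y y > 0" "\<And>j. j \<in> J \<Longrightarrow> ip I (e j) y = 0" for y
  proof -
    have "(y p)\<^sup>2 \<le> ip I y y" if "p \<in> I" for p
      unfolding ip_def using fin that by (intro member_le_sum[of p I "\<lambda>p. y p * y p", folded power2_eq_square, THEN order_trans])
         (auto simp: power2_eq_square)
    then have "\<bar>y p\<bar> \<le> sqrt (ip I y y)" if "p \<in> I" for p
      using that real_le_rsqrt[of "\<bar>y p\<bar>"] by simp
    then have "nrm y \<in> box" using y by (auto simp: box_def nrm_def PiE_iff divide_simps abs_le_iff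
       minus_le_iff)
    moreover have "ip I (nrm y) (nrm y) = ip I y y / (sqrt (ip I y y))\<^sup>2"
      by (simp add: ip_def nrm_def sum_divide_distrib power2_eq_square)
    then have "ip I (nrm y) (nrm y) = 1" using y by simp
    moreover have "ip I (e j) (nrm y) = ip I (e j) y / sqrt (ip I y y)" for j
      by (simp add: ip_def nrm_def sum_divide_distrib)
    ultimately show ?thesis using y by (simp add: S_def)
  qed
  have "continuous_on S (\<lambda>v. ip I (kernel_op I C v) v)"
    unfolding ip_def kernel_op_def by (intro continuous_intros coord)
  then obtain v where v: "v \<in> S" "\<And>y. y \<in> S \<Longrightarrow> ip I (kernel_op I C y) y \<le> ip I (kernel_op I C v) v"
    using continuous_attains_sup[OF \<open>compact S\<close>, of "\<lambda>v. ip I (kernel_op I C v) v"] nrm[OF x] by blast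
  show ?thesis
  proof
    show "ip I v v = 1" "\<And>j. j \<in> J \<Longrightarrow> ip I (e j) v = 0" using v by (auto simp: S_def)
    fix y assume y: "\<And>j. j \<in> J \<Longrightarrow> ip I (e j) y = 0"
    show "ip I (kernel_op I C y) y \<le> ip I (kernel_op I C v) v * ip I y y"
    proof (cases "ip I y y = 0")
      case True
      then have "\<forall>p\<in>I. y p = 0" using fin by (simp add: ip_self_eq_0_iff)
      then show ?thesis by (simp add: ip_def)
    next
      case False
      then have pos: "ip I y y > 0" using ip_self_nonneg[of I y] by simp
      let ?r = "sqrt (ip I y y)"
      have "kernel_op I C (nrm y) p = kernel_op I C y p / ?r" for p
        by (simp add: kernel_op_def nrm_def sum_divide_distrib)
      then have "ip I (kernel_op I C (nrm y)) (nrm y) = ip I (kernel_op I C y) y / ?r\<^sup>2"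
        by (simp add: ip_def nrm_def sum_divide_distrib power2_eq_square)
      also have "?r\<^sup>2 = ip I y y" using pos by simp
      finally show ?thesis
        using mult_right_mono[OF v(2)[OF nrm[OF pos y]], of "ip I y y"] pos by simp
    qed
  qed
qed

text \<open>The residual \<open>w\<close> of the eigenvalue equation at a constrained maximizer is
  itself an admissible direction, because self-adjointness keeps the complement of the known
  eigenvectors invariant. The first variation along \<open>w\<close> is \<open>ip I w w\<close>,
  which must vanish.\<close>

lemma eigenvector_exists:
  assumes fin: "finite I" "finite J" and less: "card J < card I"
    and sym: "\<And>p q. p \<in> I \<Longrightarrow> q \<in> I \<Longrightarrow> C p q = C q p"
    and on: "\<And>j k. j \<in> J \<Longrightarrow> k \<in> J \<Longrightarrow> ip I (e j) (e k) = (if j = k then 1 else 0)"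
    and ev: "\<And>j p. j \<in> J \<Longrightarrow> p \<in> I \<Longrightarrow> kernel_op I C (e j) p = l j * e j p"
  obtains v la where "ip I v v = 1" "\<And>j. j \<in> J \<Longrightarrow> ip I (e j) v = 0"
    "\<And>p. p \<in> I \<Longrightarrow> kernel_op I C v p = la * v p"
proof -
  obtain x where x: "ip I x x > 0" "\<And>j. j \<in> J \<Longrightarrow> ip I (e j) x = 0"
    using fin less on by (rule orthogonal_vector_exists) blast+
  obtain v where v: "ip I v v = 1" "\<And>j. j \<in> J \<Longrightarrow> ip I (e j) v = 0"
    "\<And>y. (\<And>j. j \<in> J \<Longrightarrow> ip I (e j) y = 0) \<Longrightarrow>
       ip I (kernel_op I C y) y \<le> ip I (kernel_op I C v) v * ip I y y"
    using fin(1) x by (rule rayleigh_maximizer[where C = C]) blast+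
  define la where "la = ip I (kernel_op I C v) v"
  define w where "w p = la * v p + (-1) * kernel_op I C v p" for p
  have w: "ip I (e j) w = 0" if "j \<in> J" for j
  proof -
    have "ip I (e j) (kernel_op I C v) = ip I (kernel_op I C (e j)) v"
      by (rule kernel_op_self_adjoint[OF sym, symmetric])
    also have "\<dots> = ip I (\<lambda>p. l j * e j p + 0 * e j p) v" by (rule ip_cong) (use ev that in auto)
    also have "\<dots> = 0" using v that by (simp only: ip_lincomb_left)
    finally show ?thesis unfolding w_def ip_lincomb_right using v that by simp
  qed
  have "ip I v w * la - ip I (kernel_op I C v) w = 0"
  proof (rule linear_term_eq_0)
    fix t :: real
    let ?y = "\<lambda>p. 1 * v p + t * w p"
    have "ip I (kernel_op I C ?y) ?y \<le> la * ip I ?y ?y"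
      unfolding la_def using v w by (intro v(3)) (simp only: ip_lincomb_right)
    moreover have "ip I (kernel_op I C w) v = ip I (kernel_op I C v) w"
      using kernel_op_self_adjoint[where C=C, OF sym] ip_commute by metis
    ultimately show "0 \<le> 2 * t * (ip I v w * la - ip I (kernel_op I C v) w) + t\<^sup>2 *
        (la * ip I w w - ip I (kernel_op I C w) w)"
      unfolding kernel_op_lincomb ip_lincomb_left ip_lincomb_right
      using v(1) by (simp add: la_def[symmetric] ip_commute[of I w v] power2_eq_square algebra_simps)
  qed
  moreover have "ip I w w = la * ip I v w + (-1) * ip I (kernel_op I C v) w"
    using ip_lincomb_left[of I la v "-1" "kernel_op I C v" w] by (simp add: w_def[abs_def])
  ultimately have "ip I w w = 0" by (simp add: mult.commute)
  then have "\<forall>p\<in>I. kernel_op I C v p = la * v p" using fin by (simp add: ip_self_eq_0_iff w_def)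
  with v show ?thesis by (intro that[of v la]) auto
qed

text \<open>Completeness follows from orthonormality by a trace count; indexing the eigenvectors by
  \<open>I\<close> itself makes their number right by construction.\<close>

theorem symmetric_kernel_eigenbasis:
  assumes fin: "finite I" and sym: "\<And>p q. p \<in> I \<Longrightarrow> q \<in> I \<Longrightarrow> C p q = C q p"
  obtains e l where
    "\<And>j k. j \<in> I \<Longrightarrow> k \<in> I \<Longrightarrow> ip I (e j) (e k) = (if j = k then 1 else 0)"
    "\<And>p q. p \<in> I \<Longrightarrow> q \<in> I \<Longrightarrow> (\<Sum>k\<in>I. e k p * e k q) = (if p = q then 1 else 0)"
    "\<And>k p. k \<in> I \<Longrightarrow> p \<in> I \<Longrightarrow> kernel_op I C (e k) p = l k * e k p"
proof -
  have ex: "\<exists>e l. (\<forall>j\<in>J. \<forall>k\<in>J. ip I (e j) (e k) = (if j = k then 1 else 0)) \<and>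
      (\<forall>k\<in>J. \<forall>p\<in>I. kernel_op I C (e k) p = l k * e k p)" if "J \<subseteq> I" for J
    using finite_subset[OF that fin] that
  proof (induction J rule: finite_induct)
    case empty
    then show ?case by simp
  next
    case (insert i J)
    then have "\<exists>e l. (\<forall>j\<in>J. \<forall>k\<in>J. ip I (e j) (e k) = (if j = k then 1 else 0)) \<and>
      (\<forall>k\<in>J. \<forall>p\<in>I. kernel_op I C (e k) p = l k * e k p)" by simp
    then obtain e l where on: "\<And>j k. j \<in> J \<Longrightarrow> k \<in> J \<Longrightarrow> ip I (e j) (e k) = (if j = k then 1 else 0)"
      and ev: "\<And>k p. k \<in> J \<Longrightarrow> p \<in> I \<Longrightarrow> kernel_op I C (e k) p = l k * e k p" by metis
    have less: "card J < card I"
      using insert.hyps insert.prems fin by (intro psubset_card_mono) auto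
    obtain v la where v: "ip I v v = 1" "\<And>j. j \<in> J \<Longrightarrow> ip I (e j) v = 0"
      "\<And>p. p \<in> I \<Longrightarrow> kernel_op I C v p = la * v p"
      using fin insert(1) less sym on ev by (rule eigenvector_exists) blast+
    define e' l' where "e' = e(i := v)" and "l' = l(i := la)"
    have [simp]: "e' i = v" "l' i = la" "j \<in> J \<Longrightarrow> e' j = e j" "j \<in> J \<Longrightarrow> l' j = l j" for j
      using insert(2) by (auto simp: e'_def l'_def)
    have "ip I (e' j) (e' k) = (if j = k then 1 else 0)" if "j \<in> insert i J" "k \<in> insert i J" for j k
    proof (cases "j = i")
      case True
      then show ?thesis using that v(1) v(2)[of k] insert(2) by (auto simp: ip_commute[of I v "e k"])
    next
      case False
      then show ?thesis using that v(2)[of j] on[of j k] insert(2) by (cases "k = i") auto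
    qed
    moreover have "kernel_op I C (e' k) p = l' k * e' k p" if "k \<in> insert i J" "p \<in> I" for k p
      using that v(3)[of p] ev[of k p] by (cases "k = i") auto
    ultimately show ?case by blast
  qed
  obtain e l where el: "\<forall>j\<in>I. \<forall>k\<in>I. ip I (e j) (e k) = (if j = k then 1 else 0)"
      "\<forall>k\<in>I. \<forall>p\<in>I. kernel_op I C (e k) p = l k * e k p"
    using ex[OF order_refl] by (elim exE conjE)
  then have on: "\<And>j k. j \<in> I \<Longrightarrow> k \<in> I \<Longrightarrow> ip I (e j) (e k) = (if j = k then 1 else 0)"
      and ev: "\<And>k p. k \<in> I \<Longrightarrow> p \<in> I \<Longrightarrow> kernel_op I C (e k) p = l k * e k p" by blast+
  \<comment> \<open>\<open>s\<close> is the kernel of the orthogonal projection onto the span. The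
    squared entries of \<open>r\<close>, its difference from the identity, add up to
    \<open>card I\<close> minus the trace of \<open>s\<close>, which is zero.\<close>
  define s where "s p q = (\<Sum>k\<in>I. e k p * e k q)" for p q
  have idem: "(\<Sum>q\<in>I. (s p q)\<^sup>2) = s p p" for p
  proof -
    have "(\<Sum>q\<in>I. (s p q)\<^sup>2) = (\<Sum>q\<in>I. \<Sum>j\<in>I. \<Sum>k\<in>I. e j p * e k p * (e j q * e k q))"
      by (simp add: s_def power2_eq_square sum_product algebra_simps)
    also have "\<dots> = (\<Sum>j\<in>I. \<Sum>q\<in>I. \<Sum>k\<in>I. e j p * e k p * (e j q * e k q))"
      by (rule sum.swap)
    also have "\<dots> = (\<Sum>j\<in>I. \<Sum>k\<in>I. \<Sum>q\<in>I. e j p * e k p * (e j q * e k q))"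
      by (intro sum.cong refl sum.swap)
    also have "\<dots> = (\<Sum>j\<in>I. \<Sum>k\<in>I. e j p * e k p * ip I (e j) (e k))"
      by (simp add: ip_def sum_distrib_left)
    also have "\<dots> = (\<Sum>j\<in>I. \<Sum>k\<in>I. if j = k then e j p * e k p else 0)"
      by (intro sum.cong refl) (simp add: on)
    finally show ?thesis using fin by (simp add: s_def)
  qed
  define r where "r p q = s p q - (if p = q then 1 else 0)" for p q
  have r2: "(\<Sum>q\<in>I. (r p q)\<^sup>2) = 1 - s p p" if "p \<in> I" for p
  proof -
    have "(r p q)\<^sup>2 = (s p q)\<^sup>2 + (if q = p then 1 - 2 * s p p else 0)" for q
      by (simp add: r_def power2_eq_square algebra_simps)
    then show ?thesis using that fin idem[of p] by (simp add: sum.distrib)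
  qed
  have "(\<Sum>p\<in>I. s p p) = (\<Sum>k\<in>I. ip I (e k) (e k))"
    unfolding s_def ip_def by (rule sum.swap)
  also have "\<dots> = card I" using on by simp
  finally have "(\<Sum>p\<in>I. \<Sum>q\<in>I. (r p q)\<^sup>2) = 0" using r2 by (simp add: sum_subtractf)
  then have "\<forall>p\<in>I. \<forall>q\<in>I. r p q = 0"
    using fin by (simp add: sum_nonneg_eq_0_iff sum_nonneg)
  then show ?thesis
    by (intro that[of e l]) (auto simp: on ev r_def s_def)
qed

subsection \<open>Uniqueness of characteristic functions on finite products\<close>

text \<open>Levy uniqueness speaks of probability distributions, so each weighted measure is divided
  by its total mass before it is pushed forward. The hypothesis at \<open>t = 0\<close> shows that
  both masses agree; if they vanish, so do both sides.\<close>

lemma weighted_char_determines: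
  fixes w v :: "'a \<Rightarrow> real"
  assumes P: "prob_space P" and Q: "prob_space Q"
    and [measurable]: "w \<in> borel_measurable P" "X \<in> borel_measurable P"
      "v \<in> borel_measurable Q" "Y \<in> borel_measurable Q"
    and w: "\<And>x. 0 \<le> w x" "\<And>x. w x \<le> c" and v: "\<And>x. 0 \<le> v x" "\<And>x. v x \<le> c"
    and eq: "\<And>t. (\<integral>x. w x * iexp (t * X x) \<partial>P) = (\<integral>x. v x * iexp (t * Y x) \<partial>Q)"
    and [measurable]: "B \<in> sets borel"
  shows "(\<integral>x. w x * indicat_real B (X x) \<partial>P) = (\<integral>x. v x * indicat_real B (Y x) \<partial>Q)"
proof -
  interpret P: prob_space P by fact
  interpret Q: prob_space Q by fact
  have intP: "integrable P w" by (rule P.integrable_const_bound[of _ c]) (auto simp: w)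
  have intQ: "integrable Q v" by (rule Q.integrable_const_bound[of _ c]) (auto simp: v)
  define m where "m = (\<integral>x. w x \<partial>P)"
  have "complex_of_real (\<integral>x. w x \<partial>P) = complex_of_real (\<integral>x. v x \<partial>Q)"
    using eq[of 0] by simp
  then have mQ: "m = (\<integral>x. v x \<partial>Q)" by (simp add: m_def)
  have "m \<ge> 0" unfolding m_def by (rule Bochner_Integration.integral_nonneg) (rule w)
  show ?thesis
  proof (cases "m = 0")
    case True
    have "AE x in P. w x = 0"
      using True intP w by (subst (asm) m_def) (simp add: integral_nonneg_eq_0_iff_AE)
    moreover have "AE x in Q. v x = 0"
      using True intQ v by (subst (asm) mQ) (simp add: integral_nonneg_eq_0_iff_AE)
    ultimately show ?thesis
      by (subst (1 2) integral_cong_AE[where g = "\<lambda>_. 0"]) (auto elim: AE_mp)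
  next
    case False
    with \<open>m \<ge> 0\<close> have m: "m > 0" by simp
    define P' where "P' = distr (density P (\<lambda>x. w x / m)) borel X"
    define Q' where "Q' = distr (density Q (\<lambda>x. v x / m)) borel Y"
    have "prob_space (density P (\<lambda>x. w x / m))"
      by (rule prob_spaceI, subst emeasure_density)
         (use m w intP in \<open>simp_all add: nn_integral_eq_integral m_def[symmetric]\<close>)
    then have P': "real_distribution P'"
      unfolding P'_def by (intro real_distribution.intro prob_space.prob_space_distr
          real_distribution_axioms.intro) auto
    have "prob_space (density Q (\<lambda>x. v x / m))"
      by (rule prob_spaceI, subst emeasure_density)
         (use m v intQ in \<open>simp_all add: nn_integral_eq_integral mQ[symmetric]\<close>)
    then have Q': "real_distribution Q'"
      unfolding Q'_def by (intro real_distribution.intro prob_space.prob_space_distr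
          real_distribution_axioms.intro) auto
    have eP: "(\<integral>x. h x \<partial>P') = (\<integral>x. w x * h (X x) \<partial>P) / m"
      if [measurable]: "h \<in> borel_measurable borel" for h :: "real \<Rightarrow> complex"
      unfolding P'_def using m w by (simp add: integral_distr integral_density scaleR_conv_of_real)
    have eQ: "(\<integral>x. h x \<partial>Q') = (\<integral>x. v x * h (Y x) \<partial>Q) / m"
      if [measurable]: "h \<in> borel_measurable borel" for h :: "real \<Rightarrow> complex"
      unfolding Q'_def using m v by (simp add: integral_distr integral_density scaleR_conv_of_real)
    have "(\<integral>x. iexp (t * x) \<partial>P') = (\<integral>x. iexp (t * x) \<partial>Q')" for t
    proof -
      have "(\<integral>x. iexp (t * x) \<partial>P') = (\<integral>x. w x * iexp (t * X x) \<partial>P) / m" by (rule eP) measurable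
      also have "\<dots> = (\<integral>x. iexp (t * x) \<partial>Q')" unfolding eq by (rule eQ[symmetric]) measurable
      finally show ?thesis .
    qed
    then have "char P' = char Q'" unfolding char_def by blast
    then have "P' = Q'" by (rule Levy_uniqueness[OF P' Q'])
    then have "(\<integral>x. complex_of_real (w x * indicat_real B (X x)) \<partial>P) =
      (\<integral>x. complex_of_real (v x * indicat_real B (Y x)) \<partial>Q)"
      using eP[of "\<lambda>x. complex_of_real (indicat_real B x)"] eQ[of "\<lambda>x. complex_of_real (indicat_real B x)"] m
      by simp
    then show ?thesis unfolding integral_complex_of_real of_real_eq_iff .
  qed
qed

text \<open>Exponentials are replaced by indicator functions one coordinate at a time; the nonnegative weights
  \<open>1 + Re (c * iexp (u \<bullet> x))\<close> reduce each step to the one-dimensional theorem for positive measures.\<close>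

theorem PiM_char_uniqueness:
  fixes P Q :: "('i \<Rightarrow> real) measure"
  assumes fin: "finite I" and P: "prob_space P" and Q: "prob_space Q"
    and sets: "sets P = sets (PiM I (\<lambda>_. borel))" "sets Q = sets (PiM I (\<lambda>_. borel))"
    and eq: "\<And>u. (\<integral>x. iexp (\<Sum>k\<in>I. u k * x k) \<partial>P) = (\<integral>x. iexp (\<Sum>k\<in>I. u k * x k) \<partial>Q)"
  shows "P = Q"
proof -
  interpret P: prob_space P by fact
  interpret Q: prob_space Q by fact
  have mP: "borel_measurable P = borel_measurable (PiM I (\<lambda>_. borel :: real measure))"
    and mQ: "borel_measurable Q = borel_measurable (PiM I (\<lambda>_. borel :: real measure))"
    using sets by (auto intro: measurable_cong_sets)
  define d where "d u x = (\<Sum>k\<in>I. u k * x k)" for u x :: "'i \<Rightarrow> real"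
  have [measurable]: "d u \<in> borel_measurable P" "d u \<in> borel_measurable Q" for u
    unfolding mP mQ d_def by measurable
  define h where "h J B x = (\<Prod>j\<in>J. indicat_real (B j) (x j))" for J B and x :: "'i \<Rightarrow> real"
  have h01: "0 \<le> h J B x" "h J B x \<le> 1" for J B x
    unfolding h_def by (auto intro!: prod_nonneg prod_le_1)
  have h_meas: "h J B \<in> borel_measurable P" "h J B \<in> borel_measurable Q"
    if "J \<subseteq> I" "\<And>j. j \<in> J \<Longrightarrow> B j \<in> sets borel" for J B
  proof -
    have "h J B \<in> borel_measurable (PiM I (\<lambda>_. borel))"
      unfolding h_def
    proof (rule borel_measurable_prod)
      fix j assume "j \<in> J"
      then have [measurable]: "B j \<in> sets borel" "(\<lambda>x. x j) \<in> borel_measurable (PiM I (\<lambda>_. borel))"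
        using that by auto
      show "(\<lambda>x. indicat_real (B j) (x j)) \<in> borel_measurable (PiM I (\<lambda>_. borel))" by measurable
    qed
    then show "h J B \<in> borel_measurable P" "h J B \<in> borel_measurable Q" by (simp_all add: mP mQ)
  qed
  \<comment> \<open>\<open>J\<close> collects the coordinates already tested by sets. The frequency
    \<open>u\<close> stays arbitrary on all of \<open>I\<close>, because the induction step uses the
    hypothesis at several shifted frequencies.\<close>
  have main: "(\<integral>x. h J B x * iexp (d u x) \<partial>P) = (\<integral>x. h J B x * iexp (d u x) \<partial>Q)"
    if "J \<subseteq> I" "\<And>j. j \<in> J \<Longrightarrow> B j \<in> sets borel" for J B u
    using finite_subset[OF that(1) fin] that
  proof (induction J arbitrary: u rule: finite_induct)
    case empty
    then show ?case using eq by (simp add: h_def d_def)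
  next
    case (insert i J)
    then have i: "i \<in> I" and J: "J \<subseteq> I" and B: "\<And>j. j \<in> J \<Longrightarrow> B j \<in> sets borel"
      and [measurable]: "B i \<in> sets borel" by auto
    note [measurable] = h_meas[OF J B]
    have [measurable]: "(\<lambda>x. x i) \<in> borel_measurable P" "(\<lambda>x. x i) \<in> borel_measurable Q"
      unfolding mP mQ using i by auto
    have IH: "(\<integral>x. h J B x * iexp (d u x) \<partial>P) = (\<integral>x. h J B x * iexp (d u x) \<partial>Q)" for u
      by (rule insert.IH[OF J B])
    have iP: "integrable P (\<lambda>x. complex_of_real (h J B x) * iexp (d u x))" for u
      by (rule P.integrable_const_bound[of _ 1]) (auto simp: norm_mult h01)
    have iQ: "integrable Q (\<lambda>x. complex_of_real (h J B x) * iexp (d u x))" for u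
      by (rule Q.integrable_const_bound[of _ 1]) (auto simp: norm_mult h01)
    have d_shift: "d (\<lambda>k. a * u k + (if k = i then t else 0)) x = a * d u x + t * x i" for a u t x
    proof -
      have "d (\<lambda>k. a * u k + (if k = i then t else 0)) x =
          (\<Sum>k\<in>I. a * (u k * x k) + (if k = i then t * x i else 0))"
        unfolding d_def by (intro sum.cong refl) (auto simp: algebra_simps)
      then show ?thesis using i fin by (simp add: sum.distrib d_def sum_distrib_left)
    qed
    \<comment> \<open>\<open>norm c \<le> 1\<close> keeps the second factor of the weight between 0
      and 2. Below, \<open>c = 0\<close>, \<open>c = 1\<close> and \<open>c = - \<i>\<close> give in
      turn the mass, the cosine part and the sine part.\<close>
    have key: "(\<integral>x. h J B x * (1 + Re (c * iexp (d u x))) * indicat_real (B i) (x i) \<partial>P) =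
        (\<integral>x. h J B x * (1 + Re (c * iexp (d u x))) * indicat_real (B i) (x i) \<partial>Q)"
      if c: "norm c \<le> 1" for c :: complex and u
    proof -
      have Re_le: "\<bar>Re (c * iexp (d u x))\<bar> \<le> 1" for x
        by (rule order_trans[OF abs_Re_le_cmod]) (simp add: norm_mult c)
      then have Re_le': "- 1 \<le> Re (c * iexp (d u x))" "Re (c * iexp (d u x)) \<le> 1" for x
        by (meson abs_le_iff minus_le_iff)+
      \<comment> \<open>Writing the real part as half the sum of a number and its conjugate leaves
        three exponentials, with frequencies 0, \<open>u\<close> and \<open>- u\<close> shifted by
        \<open>t\<close> in coordinate \<open>i\<close>; the induction hypothesis covers
        each.\<close>
      have split: "complex_of_real (h J B x * (1 + Re (c * iexp (d u x)))) * iexp (t * x i) =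
          h J B x * iexp (d (\<lambda>k. 0 * u k + (if k = i then t else 0)) x) +
          (c / 2 * (h J B x * iexp (d (\<lambda>k. 1 * u k + (if k = i then t else 0)) x)) +
           cnj c / 2 * (h J B x * iexp (d (\<lambda>k. (-1) * u k + (if k = i then t else 0)) x)))" for x t
      proof -
        have "complex_of_real (Re z) = (z + cnj z) / 2" for z by (simp add: complex_add_cnj)
        then have "complex_of_real (Re (c * iexp (d u x))) = (c * iexp (d u x) + cnj (c * iexp (d u x))) / 2"
          by blast
        also have "cnj (c * iexp (d u x)) = cnj c * iexp (- d u x)" by (simp add: exp_cnj)
        finally have "complex_of_real (Re (c * iexp (d u x))) = c / 2 * iexp (d u x) + cnj c / 2 * iexp (- d u x)"
          by (simp add: add_divide_distrib)
        then have "H * (1 + complex_of_real (Re (c * iexp (d u x)))) * E =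
          H * E + (c / 2 * (H * (iexp (d u x) * E)) + cnj c / 2 * (H * (iexp (- d u x) * E)))" for H E
          by (simp only: algebra_simps mult_1_left mult_1_right)
        note alg = this
        have "iexp (0 * d u x + t * x i) = iexp (t * x i)"
          and "iexp (1 * d u x + t * x i) = iexp (d u x) * iexp (t * x i)"
          and "iexp (-1 * d u x + t * x i) = iexp (- d u x) * iexp (t * x i)"
          by (simp_all add: mult_exp_exp algebra_simps)
        note e = this
        have "complex_of_real (h J B x * (1 + Re (c * iexp (d u x)))) =
            h J B x * (1 + complex_of_real (Re (c * iexp (d u x))))"
          by (simp only: of_real_mult of_real_add of_real_1)
        then show ?thesis unfolding d_shift e by (simp only: alg)
      qed
      show ?thesis
      proof (rule weighted_char_determines[OF P Q, where c = 2])
        fix x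
        show "0 \<le> h J B x * (1 + Re (c * iexp (d u x)))"
          using Re_le'[of x] h01 by (intro mult_nonneg_nonneg) auto
        have "h J B x * (1 + Re (c * iexp (d u x))) \<le> 1 * 2"
          using Re_le'[of x] h01 by (intro mult_mono) auto
        then show "h J B x * (1 + Re (c * iexp (d u x))) \<le> 2" by simp
        then show "h J B x * (1 + Re (c * iexp (d u x))) \<le> 2" .
        show "0 \<le> h J B x * (1 + Re (c * iexp (d u x)))" by fact
      next
        fix t
        show "(\<integral>x. complex_of_real (h J B x * (1 + Re (c * iexp (d u x)))) * iexp (t * x i) \<partial>P) =
          (\<integral>x. complex_of_real (h J B x * (1 + Re (c * iexp (d u x)))) * iexp (t * x i) \<partial>Q)"
          unfolding split using iP iQ IH by simp
      qed (measurable)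
    qed
    have ins: "h (insert i J) B x = h J B x * indicat_real (B i) (x i)" for x
      using insert(1,2) by (simp add: h_def mult.commute)
    have [measurable]: "h (insert i J) B \<in> borel_measurable P" "h (insert i J) B \<in> borel_measurable Q"
      unfolding ins[abs_def] by measurable
    have iP': "integrable P (\<lambda>x. h (insert i J) B x)" "integrable P (\<lambda>x. h (insert i J) B x * cos (d u x))"
        "integrable P (\<lambda>x. h (insert i J) B x * sin (d u x))"
      by (rule P.integrable_const_bound[of _ 1]; auto simp: abs_mult h01 intro!: mult_le_one)+
    have iQ': "integrable Q (\<lambda>x. h (insert i J) B x)" "integrable Q (\<lambda>x. h (insert i J) B x * cos (d u x))"
        "integrable Q (\<lambda>x. h (insert i J) B x * sin (d u x))"
      by (rule Q.integrable_const_bound[of _ 1]; auto simp: abs_mult h01 intro!: mult_le_one)+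
    have Re_iexp: "Re (iexp r) = cos r" "Re (- \<i> * iexp r) = sin r" for r
      by (simp_all add: Re_exp Im_exp)
    have *: "h J B x * (1 + r) * indicat_real (B i) (x i) = h (insert i J) B x + h (insert i J) B x * r" for x r
      by (simp add: ins algebra_simps)
    have 0: "(\<integral>x. h (insert i J) B x \<partial>P) = (\<integral>x. h (insert i J) B x \<partial>Q)"
      using key[of 0 u] by (simp add: ins)
    have cs: "(\<integral>x. h (insert i J) B x * cos (d u x) \<partial>P) = (\<integral>x. h (insert i J) B x * cos (d u x) \<partial>Q)"
      using key[of 1 u] 0 iP' iQ' unfolding * mult_1_left Re_iexp by simp
    have sn: "(\<integral>x. h (insert i J) B x * sin (d u x) \<partial>P) = (\<integral>x. h (insert i J) B x * sin (d u x) \<partial>Q)"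
      using key[of "- \<i>" u] 0 iP' iQ' unfolding * Re_iexp by simp
    have **: "h (insert i J) B x * iexp (d u x) =
        complex_of_real (h (insert i J) B x * cos (d u x)) + \<i> * complex_of_real (h (insert i J) B x * sin (d u x))" for x
      by (simp add: cis_conv_exp[symmetric] cis.ctr complex_eq_iff)
    show ?case unfolding ** using iP' iQ' cs sn
      by (subst (1 2) Bochner_Integration.integral_add) (auto intro: integrable_of_real simp del: of_real_mult)
  qed
  \<comment> \<open>Boxes generate the product sigma-algebra, and \<open>main\<close> with
    \<open>J = I\<close> and \<open>u = 0\<close> compares the measures on them. Finiteness allows
    the whole space as a constant exhausting sequence.\<close>
  show ?thesis
  proof (rule measure_eqI_PiM_finite[OF fin sets, where A = "\<lambda>_::nat. \<Pi>\<^sub>E i\<in>I. UNIV"])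
    fix A :: "'i \<Rightarrow> real set" assume A: "\<And>i. i \<in> I \<Longrightarrow> A i \<in> sets borel"
    then have [measurable]: "PiE I A \<in> sets P" "PiE I A \<in> sets Q"
      unfolding sets using fin by (auto intro: sets_PiM_I_finite)
    have h_eq: "h I A x = indicat_real (PiE I A) x" if "x \<in> space (PiM I (\<lambda>_. borel :: real measure))" for x
      using that fin by (auto simp: h_def space_PiM indicator_def PiE_iff split: if_splits)
    have "(\<integral>x. complex_of_real (h I A x) \<partial>P) = (\<integral>x. complex_of_real (h I A x) \<partial>Q)"
      using main[of I A "\<lambda>_. 0"] A by (simp add: d_def)
    then have "(\<integral>x. h I A x \<partial>P) = (\<integral>x. h I A x \<partial>Q)" by simp
    moreover have sp: "PiE I A \<inter> space (PiM I (\<lambda>_. borel)) = PiE I A"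
      by (auto simp: space_PiM)
    have "(\<integral>x. h I A x \<partial>P) = measure P (PiE I A)"
      using h_eq sets_eq_imp_space_eq[OF sets(1)] by (subst Bochner_Integration.integral_cong[OF refl, where g = "indicat_real (PiE I A)"]) (auto simp: sp)
    moreover have "(\<integral>x. h I A x \<partial>Q) = measure Q (PiE I A)"
      using h_eq sets_eq_imp_space_eq[OF sets(2)] by (subst Bochner_Integration.integral_cong[OF refl, where g = "indicat_real (PiE I A)"]) (auto simp: sp)
    ultimately show "emeasure P (PiE I A) = emeasure Q (PiE I A)"
      by (simp add: P.emeasure_eq_measure Q.emeasure_eq_measure)
  next
    show "range (\<lambda>_::nat. \<Pi>\<^sub>E i\<in>I. UNIV) \<subseteq> prod_algebra I (\<lambda>_. borel)"
      using prod_algebraI_finite[OF fin, of "\<lambda>_. UNIV" "\<lambda>_. borel"] by auto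
    show "emeasure P (\<Pi>\<^sub>E i\<in>I. UNIV) \<noteq> \<infinity>" for i by simp
  qed (auto simp: space_PiM)
qed

subsection \<open>Gaussian laws\<close>

lemma normal_law_pos: "0 < s \<Longrightarrow> normal_law \<mu> s = density lborel (normal_density \<mu> (sqrt s))"
  by (simp add: normal_law_def)

lemma sets_normal_law [simp, measurable_cong]: "sets (normal_law \<mu> s) = sets borel"
  by (simp add: normal_law_def)

lemma space_normal_law [simp]: "space (normal_law \<mu> s) = UNIV"
  by (simp add: normal_law_def)

lemma prob_space_normal_law:
  assumes "0 \<le> s" shows "prob_space (normal_law \<mu> s)"
  using assms by (auto simp: normal_law_def prob_space_return intro!: prob_space_normal_density)

lemma has_bochner_integral_normal_law:
  fixes f :: "real \<Rightarrow> real"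
  assumes "0 < s" "has_bochner_integral lborel (\<lambda>x. normal_density \<mu> (sqrt s) x * f x) I"
    and [measurable]: "f \<in> borel_measurable borel"
  shows "has_bochner_integral (normal_law \<mu> s) f I"
  using assms
  by (simp add: normal_law_pos has_bochner_integral_density normal_density_nonneg)

lemma normal_law_moments:
  assumes "0 \<le> s"
  shows "has_bochner_integral (normal_law \<mu> s) (\<lambda>x. x) \<mu>"
    and "has_bochner_integral (normal_law \<mu> s) (\<lambda>x. x\<^sup>2) (s + \<mu>\<^sup>2)"
proof -
  have "has_bochner_integral (normal_law \<mu> s) (\<lambda>x. x) \<mu> \<and>
    has_bochner_integral (normal_law \<mu> s) (\<lambda>x. x\<^sup>2) (s + \<mu>\<^sup>2)"
  proof (cases "s = 0")
    case True
    have R: "has_bochner_integral (return borel \<mu>) f (f \<mu>)" if [measurable]: "f \<in> borel_measurable borel" for f :: "real \<Rightarrow> real"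
      by (simp add: has_bochner_integral_iff integrable_iff_bounded nn_integral_return integral_return)
    have "normal_law \<mu> s = return borel \<mu>" "s + \<mu>\<^sup>2 = \<mu>\<^sup>2" using True by (simp_all add: normal_law_def)
    then show ?thesis by (simp only:) (intro conjI R; measurable)
  next
    case False
    with assms have s: "0 < s" "0 < sqrt s" by simp_all
    let ?N = "normal_law \<mu> s"
    interpret prob_space ?N using assms by (rule prob_space_normal_law)
    have 1: "has_bochner_integral ?N (\<lambda>x. x - \<mu>) 0"
      using normal_moment_odd[OF s(2), of \<mu> 0] s(1) by (intro has_bochner_integral_normal_law) simp_all
    have 2: "has_bochner_integral ?N (\<lambda>x. (x - \<mu>)\<^sup>2) s"
      using normal_moment_even[OF s(2), of \<mu> 1] s(1) by (intro has_bochner_integral_normal_law) simp_all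
    have c: "has_bochner_integral ?N (\<lambda>x. c) c" for c :: real
      using prob_space by (simp add: has_bochner_integral_iff)
    have "has_bochner_integral ?N (\<lambda>x. (x - \<mu>)\<^sup>2 + (2 * \<mu> * (x - \<mu>) + \<mu>\<^sup>2)) (s + (2 * \<mu> * 0 + \<mu>\<^sup>2))"
      by (intro has_bochner_integral_add 2 has_bochner_integral_mult_right 1 c)
    moreover have "(x - \<mu>)\<^sup>2 + (2 * \<mu> * (x - \<mu>) + \<mu>\<^sup>2) = x\<^sup>2" for x
      by (simp add: power2_eq_square algebra_simps)
    ultimately show ?thesis
      using has_bochner_integral_add[OF 1 c[of \<mu>]] by simp
  qed
  then show "has_bochner_integral (normal_law \<mu> s) (\<lambda>x. x) \<mu>"
    "has_bochner_integral (normal_law \<mu> s) (\<lambda>x. x\<^sup>2) (s + \<mu>\<^sup>2)" by auto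
qed

lemma normal_law_moment_4:
  assumes "0 < s"
  shows "has_bochner_integral (normal_law 0 s) (\<lambda>x. x ^ 4) (3 * s\<^sup>2)"
proof -
  have "fact (2 * 2) / ((2 / (sqrt s)\<^sup>2) ^ 2 * fact 2) = 3 * s\<^sup>2"
    using assms by (simp add: fact_numeral power2_eq_square)
  then show ?thesis
    using normal_moment_even[of "sqrt s" 0 2] assms
    by (intro has_bochner_integral_normal_law) simp_all
qed

lemma char_normal_law:
  assumes "0 \<le> s"
  shows "(\<integral>x. iexp (t * x) \<partial>normal_law 0 s) = complex_of_real (exp (- (s * t\<^sup>2) / 2))"
proof (cases "s = 0")
  case True
  then show ?thesis by (simp add: normal_law_def integral_return)
next
  case False
  with assms have s: "0 < s" "0 < sqrt s" by simp_all
  have "(\<integral>x. iexp (t * x) \<partial>normal_law 0 s) = (\<integral>x. normal_density 0 (sqrt s) x *\<^sub>R iexp (t * x) \<partial>lborel)"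
    using s(1) by (simp add: normal_law_pos integral_density normal_density_nonneg)
  also have "\<dots> = \<bar>sqrt s\<bar> *\<^sub>R (\<integral>x. normal_density 0 (sqrt s) (0 + sqrt s * x) *\<^sub>R iexp (t * (0 + sqrt s * x)) \<partial>lborel)"
    using s(2) by (intro lborel_integral_real_affine) simp
  also have "\<dots> = (\<integral>x. std_normal_density x *\<^sub>R iexp ((t * sqrt s) * x) \<partial>lborel)"
  proof -
    have "sqrt s * normal_density 0 (sqrt s) (sqrt s * x) = std_normal_density x" for x
      using s by (simp add: normal_density_def power_mult_distrib real_sqrt_mult)
    then show ?thesis using s(2)
      by (simp flip: integral_scaleR_right) (simp add: mult_ac)
  qed
  also have "\<dots> = char std_normal_distribution (t * sqrt s)"
    by (simp add: char_def integral_density normal_density_nonneg)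
  also have "\<dots> = complex_of_real (exp (- (s * t\<^sup>2) / 2))"
    using s by (simp add: char_std_normal_distribution power_mult_distrib mult.commute)
  finally show ?thesis .
qed

lemma char_PiM_normal_law:
  assumes fin: "finite I" and s: "\<And>k. k \<in> I \<Longrightarrow> 0 \<le> s k"
  shows "(\<integral>x. iexp (\<Sum>k\<in>I. u k * x k) \<partial>PiM I (\<lambda>k. normal_law 0 (s k))) =
    complex_of_real (exp (- (\<Sum>k\<in>I. s k * (u k)\<^sup>2) / 2))"
proof -
  \<comment> \<open>The product locale asks for a probability measure at every index, so the
    variances are continued by 0, a point mass, outside \<open>I\<close>.\<close>
  define s' where "s' k = (if k \<in> I then s k else 0)" for k
  have s': "0 \<le> s' k" for k by (simp add: s'_def s)
  then have "prob_space (normal_law 0 (s' k))" for k by (rule prob_space_normal_law)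
  then interpret product_prob_space "\<lambda>k. normal_law 0 (s' k)" I
    by (intro product_prob_spaceI)
  have "(\<integral>x. iexp (\<Sum>k\<in>I. u k * x k) \<partial>PiM I (\<lambda>k. normal_law 0 (s k))) =
      (\<integral>x. (\<Prod>k\<in>I. iexp (u k * x k)) \<partial>PiM I (\<lambda>k. normal_law 0 (s' k)))"
    using fin by (intro Bochner_Integration.integral_cong PiM_cong)
      (simp_all add: s'_def sum_distrib_left exp_sum)
  also have "\<dots> = (\<Prod>k\<in>I. \<integral>x. iexp (u k * x) \<partial>normal_law 0 (s' k))"
  proof (rule product_integral_prod[OF fin])
    fix k
    show "integrable (normal_law 0 (s' k)) (\<lambda>x. iexp (u k * x))"
      by (rule finite_measure.integrable_const_bound[OF prob_space.finite_measure[OF prob_space_normal_law[OF s']], of _ 1]) simp_all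
  qed
  also have "\<dots> = (\<Prod>k\<in>I. complex_of_real (exp (- (s k * (u k)\<^sup>2) / 2)))"
    by (intro prod.cong refl) (simp only: char_normal_law[OF s'], simp add: s'_def)
  also have "\<dots> = complex_of_real (exp (- (\<Sum>k\<in>I. s k * (u k)\<^sup>2) / 2))"
    using fin by (simp add: exp_sum[symmetric] sum_negf sum_divide_distrib flip: of_real_prod)
  finally show ?thesis .
qed

text \<open>The way independence is established in the rotated coordinates: a diagonal quadratic
  form in the exponent of the characteristic function forces a product of centred normal
  laws.\<close>

lemma distr_eq_PiM_normal_lawI:
  assumes M: "prob_space M" and fin: "finite I" and s: "\<And>k. k \<in> I \<Longrightarrow> 0 \<le> s k"
    and Z: "\<And>k. k \<in> I \<Longrightarrow> Z k \<in> borel_measurable M"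
    and char: "\<And>u. (\<integral>\<omega>. iexp (\<Sum>k\<in>I. u k * Z k \<omega>) \<partial>M) =
        complex_of_real (exp (- (\<Sum>k\<in>I. s k * (u k)\<^sup>2) / 2))"
  shows "distr M (PiM I (\<lambda>_. borel)) (\<lambda>\<omega>. \<lambda>k\<in>I. Z k \<omega>) = PiM I (\<lambda>k. normal_law 0 (s k))"
proof (rule PiM_char_uniqueness[OF fin])
  have m[measurable]: "(\<lambda>\<omega>. \<lambda>k\<in>I. Z k \<omega>) \<in> measurable M (PiM I (\<lambda>_. borel))"
    using Z by (intro measurable_restrict) auto
  show "prob_space (distr M (PiM I (\<lambda>_. borel)) (\<lambda>\<omega>. \<lambda>k\<in>I. Z k \<omega>))"
    using M m by (rule prob_space.prob_space_distr)
  show "prob_space (PiM I (\<lambda>k. normal_law 0 (s k)))"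
    using s by (intro prob_space_PiM prob_space_normal_law)
  show "sets (PiM I (\<lambda>k. normal_law 0 (s k))) = sets (PiM I (\<lambda>_. borel :: real measure))"
    by (intro sets_PiM_cong) simp_all
  fix u :: "'b \<Rightarrow> real"
  have [measurable]: "(\<lambda>x. iexp (\<Sum>k\<in>I. u k * x k)) \<in> borel_measurable (PiM I (\<lambda>_. borel))"
    by measurable
  have "(\<integral>x. iexp (\<Sum>k\<in>I. u k * x k) \<partial>distr M (PiM I (\<lambda>_. borel)) (\<lambda>\<omega>. \<lambda>k\<in>I. Z k \<omega>)) =
      (\<integral>\<omega>. iexp (\<Sum>k\<in>I. u k * Z k \<omega>) \<partial>M)"
    by (subst integral_distr) simp_all
  also have "\<dots> = (\<integral>x. iexp (\<Sum>k\<in>I. u k * x k) \<partial>PiM I (\<lambda>k. normal_law 0 (s k)))"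
    using char char_PiM_normal_law[OF fin s, where u = u] by simp
  finally show "(\<integral>x. iexp (\<Sum>k\<in>I. u k * x k) \<partial>distr M (PiM I (\<lambda>_. borel)) (\<lambda>\<omega>. \<lambda>k\<in>I. Z k \<omega>)) =
      (\<integral>x. iexp (\<Sum>k\<in>I. u k * x k) \<partial>PiM I (\<lambda>k. normal_law 0 (s k)))" .
qed simp

text \<open>The log-likelihood ratio \<open>ln (dN(0,a) / dN(0,b))\<close>.\<close>

definition normal_llr :: "real \<Rightarrow> real \<Rightarrow> real \<Rightarrow> real" where
  "normal_llr a b x = ln (b / a) / 2 + x\<^sup>2 / 2 * (1 / b - 1 / a)"

text \<open>The divergence between centred normal laws of variances \<open>a\<close> and
  \<open>b\<close>. It depends only on the ratio \<open>b / a\<close>, so a common rescaling of both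
  variances leaves it unchanged.\<close>

definition normal_kl :: "real \<Rightarrow> real \<Rightarrow> real" where
  "normal_kl a b = 1/2 * ln (b / a) + 1/2 * (a / b) - 1/2"

lemma normal_llr_measurable [measurable]: "normal_llr a b \<in> borel_measurable borel"
  unfolding normal_llr_def by measurable

lemma normal_density_ratio:
  assumes "0 < a" "0 < b"
  shows "normal_density 0 (sqrt b) x = normal_density 0 (sqrt a) x * exp (- normal_llr a b x)"
proof -
  have "exp (- (ln (b / a) / 2)) = sqrt (a / b)"
    using assms by (simp add: ln_div exp_diff real_sqrt_divide ln_sqrt[symmetric] exp_minus
        diff_divide_distrib inverse_eq_divide)
  moreover have "- normal_llr a b x = - (ln (b / a) / 2) + (- x\<^sup>2 / (2 * b) - - x\<^sup>2 / (2 * a))"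
    by (simp add: normal_llr_def algebra_simps diff_divide_distrib)
  ultimately have "exp (- normal_llr a b x) = sqrt (a / b) * (exp (- x\<^sup>2 / (2 * b)) / exp (- x\<^sup>2 / (2 * a)))"
    by (simp only: exp_add exp_diff)
  then show ?thesis
    using assms by (simp add: normal_density_def real_sqrt_mult real_sqrt_divide)
qed

lemma normal_law_density:
  assumes "0 < a" "0 < b"
  shows "normal_law 0 b = density (normal_law 0 a) (\<lambda>x. exp (- normal_llr a b x))"
  using assms
  by (simp add: normal_law_pos density_density_eq normal_density_ratio[OF assms] ennreal_mult
      normal_density_nonneg)

lemma normal_llr_mean:
  assumes "0 < a" "0 < b"
  shows "has_bochner_integral (normal_law 0 a) (normal_llr a b) (normal_kl a b)"
proof -
  interpret prob_space "normal_law 0 a" using assms by (intro prob_space_normal_law) simp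
  have c: "has_bochner_integral (normal_law 0 a) (\<lambda>x. c) c" for c :: real
    using prob_space by (simp add: has_bochner_integral_iff)
  have "has_bochner_integral (normal_law 0 a) (\<lambda>x. ln (b / a) / 2 + (1 / b - 1 / a) / 2 * x\<^sup>2)
      (ln (b / a) / 2 + (1 / b - 1 / a) / 2 * (a + 0\<^sup>2))"
    using assms by (intro has_bochner_integral_add c has_bochner_integral_mult_right normal_law_moments) auto
  moreover have "ln (b / a) / 2 + (1 / b - 1 / a) / 2 * (a + 0\<^sup>2) = normal_kl a b"
    using assms by (simp add: normal_kl_def field_simps)
  ultimately show ?thesis
    by (simp add: normal_llr_def[abs_def] mult.commute)
qed

text \<open>The centred ratio is \<open>k * (x\<^sup>2 - a)\<close>, of variance
  \<open>2 * (k * a)\<^sup>2\<close>, and \<open>a \<le> b\<close> confines \<open>k * a\<close> to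
  the interval from -1/2 to 0. The bound is uniform in \<open>b\<close>, hence later in the
  eigenvalues.\<close>

lemma normal_llr_variance:
  assumes "0 < a" "a \<le> b"
  shows "integrable (normal_law 0 a) (\<lambda>x. (normal_llr a b x - normal_kl a b)\<^sup>2)"
    and "(\<integral>x. (normal_llr a b x - normal_kl a b)\<^sup>2 \<partial>normal_law 0 a) \<le> 1 / 2"
proof -
  interpret prob_space "normal_law 0 a" using assms by (intro prob_space_normal_law) simp
  have c: "has_bochner_integral (normal_law 0 a) (\<lambda>x. c) c" for c :: real
    using prob_space by (simp add: has_bochner_integral_iff)
  define k where "k = (1 / b - 1 / a) / 2"
  have "normal_llr a b x - normal_kl a b = k * (x\<^sup>2 - a)" for x
    using assms by (simp add: normal_llr_def normal_kl_def k_def field_simps)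
  then have eq: "(normal_llr a b x - normal_kl a b)\<^sup>2 = k\<^sup>2 * x ^ 4 + (- 2 * k\<^sup>2 * a * x\<^sup>2 + k\<^sup>2 * a\<^sup>2)" for x
    by (simp only:) (simp add: power2_eq_square power4_eq_xxxx algebra_simps)
  have "has_bochner_integral (normal_law 0 a) (\<lambda>x. (normal_llr a b x - normal_kl a b)\<^sup>2)
     (k\<^sup>2 * (3 * a\<^sup>2) + (- 2 * k\<^sup>2 * a * (a + 0\<^sup>2) + k\<^sup>2 * a\<^sup>2))"
    unfolding eq using assms
    by (intro has_bochner_integral_add c has_bochner_integral_mult_right normal_law_moments normal_law_moment_4) auto
  moreover have "k\<^sup>2 * (3 * a\<^sup>2) + (- 2 * k\<^sup>2 * a * (a + 0\<^sup>2) + k\<^sup>2 * a\<^sup>2) = 2 * (k * a)\<^sup>2"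
    by (simp add: power2_eq_square algebra_simps)
  moreover have "2 * (k * a)\<^sup>2 \<le> 1 / 2"
  proof -
    have "\<bar>k * a\<bar> \<le> 1 / 2" using assms by (simp add: k_def field_simps abs_le_iff)
    then have "(k * a)\<^sup>2 \<le> (1 / 2)\<^sup>2" by (intro abs_le_square_iff[THEN iffD1]) simp
    then show ?thesis by (simp add: power2_eq_square)
  qed
  ultimately show "integrable (normal_law 0 a) (\<lambda>x. (normal_llr a b x - normal_kl a b)\<^sup>2)"
    "(\<integral>x. (normal_llr a b x - normal_kl a b)\<^sup>2 \<partial>normal_law 0 a) \<le> 1 / 2"
    by (auto simp: has_bochner_integral_iff)
qed

lemma kl_div_normal_law:
  assumes "0 < a" "0 < b"
  shows "kl_div (normal_law 0 a) (normal_law 0 b) = normal_kl a b"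
proof -
  have "kl_div (normal_law 0 a) (normal_law 0 b) =
     (\<integral>x. normal_density 0 (sqrt a) x * log (exp 1) (normal_density 0 (sqrt a) x / normal_density 0 (sqrt b) x) \<partial>lborel)"
    unfolding kl_div_def normal_law_pos[OF assms(1)] normal_law_pos[OF assms(2)]
  proof (rule lborel.KL_density_density)
    have "0 < normal_density 0 (sqrt b) x" for x
      using assms by (intro normal_density_pos) simp
    then show "AE x in lborel. normal_density 0 (sqrt b) x = 0 \<longrightarrow> normal_density 0 (sqrt a) x = 0"
      by (intro AE_I2) (simp add: less_imp_neq[symmetric])
  qed (simp_all add: normal_density_nonneg)
  also have "\<dots> = (\<integral>x. normal_density 0 (sqrt a) x * normal_llr a b x \<partial>lborel)"
  proof (intro Bochner_Integration.integral_cong refl arg_cong2[where f = "(*)"])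
    fix x
    have "normal_density 0 (sqrt a) x / normal_density 0 (sqrt b) x = exp (normal_llr a b x)"
      using normal_density_pos[of "sqrt a" 0 x] assms
      by (simp add: normal_density_ratio[OF assms] exp_minus field_simps)
    then show "log (exp 1) (normal_density 0 (sqrt a) x / normal_density 0 (sqrt b) x) = normal_llr a b x"
      by (simp add: log_def)
  qed
  also have "\<dots> = (\<integral>x. normal_llr a b x \<partial>normal_law 0 a)"
    using assms by (simp add: normal_law_pos integral_density normal_density_nonneg)
  also have "\<dots> = normal_kl a b" using normal_llr_mean[OF assms] by (rule has_bochner_integral_integral_eq)
  finally show ?thesis .
qed

section \<open>Densities and variances on product measures\<close>

lemma PiM_density:
  assumes fin: "finite I"
    and N: "\<And>k. k \<in> I \<Longrightarrow> prob_space (N k)" "\<And>k. k \<in> I \<Longrightarrow> prob_space (N' k)"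
    and f [measurable]: "\<And>k. k \<in> I \<Longrightarrow> f k \<in> borel_measurable (N k)"
    and N': "\<And>k. k \<in> I \<Longrightarrow> N' k = density (N k) (f k)"
  shows "PiM I N' = density (PiM I N) (\<lambda>x. \<Prod>k\<in>I. f k (x k))"
proof -
  \<comment> \<open>A filler for the indices outside \<open>I\<close>, where the factors are
    arbitrary: the locale wants probability spaces everywhere, while the product over
    \<open>I\<close> sees only its own factors.\<close>
  define E :: "'b measure" where "E = return (count_space UNIV) undefined"
  have E: "prob_space E" unfolding E_def by (intro prob_space_return) simp
  define L L' where "L k = (if k \<in> I then N k else E)" and "L' k = (if k \<in> I then N' k else E)" for k
  have "prob_space (L k)" "prob_space (L' k)" for k using N E by (simp_all add: L_def L'_def)
  then interpret L: product_prob_space L I + L': product_prob_space L' I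
    by (auto intro!: product_prob_spaceI)
  have "PiM I L' = density (PiM I L) (\<lambda>x. \<Prod>k\<in>I. f k (x k))"
  proof (rule L'.PiM_eqI[OF fin, symmetric])
    show "sets (density (PiM I L) (\<lambda>x. \<Prod>k\<in>I. f k (x k))) = sets (PiM I L')"
      by (simp, intro sets_PiM_cong) (simp_all add: L_def L'_def N')
    fix A assume A: "\<And>k. k \<in> I \<Longrightarrow> A k \<in> sets (L' k)"
    then have A': "A k \<in> sets (L k)" if "k \<in> I" for k using that by (auto simp: L_def L'_def N')
    have fL: "f k \<in> borel_measurable (L k)" if "k \<in> I" for k using f that by (simp add: L_def)
    have [measurable]: "(\<lambda>x. \<Prod>k\<in>I. f k (x k)) \<in> borel_measurable (PiM I L)"
      using fL by (intro borel_measurable_prod_ennreal) (auto intro: measurable_PiM_component_rev)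
    have "emeasure (density (PiM I L) (\<lambda>x. \<Prod>k\<in>I. f k (x k))) (PiE I A) =
      (\<integral>\<^sup>+x. (\<Prod>k\<in>I. f k (x k)) * indicator (PiE I A) x \<partial>PiM I L)"
      using A' fin by (intro emeasure_density) (auto intro: sets_PiM_I_finite)
    also have "\<dots> = (\<integral>\<^sup>+x. (\<Prod>k\<in>I. f k (x k) * indicator (A k) (x k)) \<partial>PiM I L)"
      using fin by (intro nn_integral_cong) (auto simp: prod.distrib indicator_def space_PiM PiE_iff)
    also have "\<dots> = (\<Prod>k\<in>I. \<integral>\<^sup>+x. f k x * indicator (A k) x \<partial>L k)"
      using fL A' by (intro L.product_nn_integral_prod fin) auto
    also have "\<dots> = (\<Prod>k\<in>I. emeasure (L' k) (A k))"
      using f A' by (intro prod.cong refl) (simp add: L'_def L_def N' emeasure_density)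
    finally show "emeasure (density (PiM I L) (\<lambda>x. \<Prod>k\<in>I. f k (x k))) (PiE I A) = (\<Prod>k\<in>I. emeasure (L' k) (A k))" .
  qed
  moreover have "PiM I L' = PiM I N'" "PiM I L = PiM I N"
    by (auto intro!: PiM_cong simp: L_def L'_def)
  ultimately show ?thesis by simp
qed

lemma PiM_sum_variance_le:
  fixes g :: "'i \<Rightarrow> 'b \<Rightarrow> real" and c :: real
  assumes fin: "finite I" and N: "\<And>k. prob_space (N k)"
    and g: "\<And>k. k \<in> I \<Longrightarrow> integrable (N k) (g k)" "\<And>k. k \<in> I \<Longrightarrow> (\<integral>x. g k x \<partial>N k) = 0"
    and g2: "\<And>k. k \<in> I \<Longrightarrow> integrable (N k) (\<lambda>x. (g k x)\<^sup>2)" "\<And>k. k \<in> I \<Longrightarrow> (\<integral>x. (g k x)\<^sup>2 \<partial>N k) \<le> c"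
  shows "integrable (PiM I N) (\<lambda>x. (\<Sum>k\<in>I. g k (x k))\<^sup>2)"
    and "(\<integral>x. (\<Sum>k\<in>I. g k (x k))\<^sup>2 \<partial>PiM I N) \<le> card I * c"
proof -
  interpret N: product_prob_space N I using N by (rule product_prob_spaceI)
  \<comment> \<open>\<open>h j k\<close> spells \<open>g j * g k\<close> as a product over all of
    \<open>I\<close>, with factor 1 at the other indices and a square if \<open>j = k\<close>. The
    integral then factorises, and centering kills the cross terms.\<close>
  define h where "h j k i x = (if i = j then g j x else 1) * (if i = k then g k x else 1)" for j k i x
  have h_prod: "(\<Prod>i\<in>I. h j k i (x i)) = g j (x j) * g k (x k)" if "j \<in> I" "k \<in> I" for j k x
  proof -
    have "(\<Prod>i\<in>I. h j k i (x i)) = (\<Prod>i\<in>I. if i = j then g j (x j) else 1) * (\<Prod>i\<in>I. if i = k then g k (x k) else 1)"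
      unfolding h_def prod.distrib by (intro arg_cong2[where f = "(*)"] prod.cong) auto
    then show ?thesis using that fin by simp
  qed
  have h_int: "integrable (N i) (h j k i)" if "i \<in> I" for i j k
  proof -
    interpret Ni: prob_space "N i" by (rule N)
    show ?thesis
    proof (cases "i = j"; cases "i = k")
      assume "i = j" "i = k"
      then show ?thesis using g2(1)[OF that] by (auto simp: h_def[abs_def] power2_eq_square)
    qed (use g(1)[OF that] in \<open>auto simp: h_def[abs_def]\<close>)
  qed
  have sq: "(\<Sum>k\<in>I. g k (x k))\<^sup>2 = (\<Sum>j\<in>I. \<Sum>k\<in>I. (\<Prod>i\<in>I. h j k i (x i)))" for x
    unfolding power2_eq_square sum_product by (intro sum.cong refl) (simp add: h_prod)
  have int: "integrable (PiM I N) (\<lambda>x. \<Prod>i\<in>I. h j k i (x i))" for j k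
    using h_int by (intro N.product_integrable_prod fin)
  show "integrable (PiM I N) (\<lambda>x. (\<Sum>k\<in>I. g k (x k))\<^sup>2)"
    unfolding sq by (intro Bochner_Integration.integrable_sum int)
  have val: "(\<integral>x. (\<Prod>i\<in>I. h j k i (x i)) \<partial>PiM I N) \<le> (if j = k then c else 0)" if "j \<in> I" "k \<in> I" for j k
  proof (cases "j = k")
    case True
    have "(\<integral>x. (\<Prod>i\<in>I. h j k i (x i)) \<partial>PiM I N) = (\<Prod>i\<in>I. integral\<^sup>L (N i) (h j k i))"
      using h_int by (intro N.product_integral_prod fin)
    also have "\<dots> = (\<Prod>i\<in>I. if i = j then (\<integral>x. (g j x)\<^sup>2 \<partial>N j) else 1)"
      using True N by (intro prod.cong refl) (auto simp: h_def[abs_def] power2_eq_square prob_space.prob_space)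
    also have "\<dots> \<le> c" using that fin g2 by simp
    finally show ?thesis using True by simp
  next
    case False
    have "(\<integral>x. (\<Prod>i\<in>I. h j k i (x i)) \<partial>PiM I N) = (\<Prod>i\<in>I. integral\<^sup>L (N i) (h j k i))"
      using h_int by (intro N.product_integral_prod fin)
    also have "integral\<^sup>L (N j) (h j k j) = 0" using False g(2)[OF that(1)] by (simp add: h_def[abs_def])
    then have "(\<Prod>i\<in>I. integral\<^sup>L (N i) (h j k i)) = 0" using that fin by (auto intro: prod_zero)
    finally show ?thesis using False by simp
  qed
  have "(\<integral>x. (\<Sum>k\<in>I. g k (x k))\<^sup>2 \<partial>PiM I N) = (\<Sum>j\<in>I. \<Sum>k\<in>I. (\<integral>x. (\<Prod>i\<in>I. h j k i (x i)) \<partial>PiM I N))"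
    unfolding sq by (subst Bochner_Integration.integral_sum, intro Bochner_Integration.integrable_sum int)
      (simp add: Bochner_Integration.integral_sum int)
  also have "\<dots> \<le> (\<Sum>j\<in>I. \<Sum>k\<in>I. if j = k then c else 0)"
    by (intro sum_mono val)
  also have "\<dots> = card I * c" using fin by simp
  finally show "(\<integral>x. (\<Sum>k\<in>I. g k (x k))\<^sup>2 \<partial>PiM I N) \<le> card I * c" .
qed

subsection \<open>The Neyman-Pearson lemma and Stein's lemma\<close>

definition test_on :: "'b measure \<Rightarrow> ('b \<Rightarrow> real) \<Rightarrow> bool" where
  "test_on Q \<phi> \<longleftrightarrow> \<phi> \<in> borel_measurable Q \<and> (\<forall>x\<in>space Q. 0 \<le> \<phi> x \<and> \<phi> x \<le> 1)"

text \<open>\<open>Q\<close> is the law under the null hypothesis and \<open>L\<close> the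
  likelihood ratio of the alternative against it, so both error probabilities are integrals over
  \<open>Q\<close>.\<close>

definition optimal_test :: "'b measure \<Rightarrow> ('b \<Rightarrow> real) \<Rightarrow> real \<Rightarrow> ('b \<Rightarrow> real) \<Rightarrow> bool" where
  "optimal_test Q L \<alpha> \<phi> \<longleftrightarrow> test_on Q \<phi> \<and> (\<integral>x. \<phi> x \<partial>Q) \<le> \<alpha> \<and>
     (\<forall>\<psi>. test_on Q \<psi> \<and> (\<integral>x. \<psi> x \<partial>Q) \<le> \<alpha> \<longrightarrow>
        (\<integral>x. (1 - \<phi> x) * L x \<partial>Q) \<le> (\<integral>x. (1 - \<psi> x) * L x \<partial>Q))"

lemma test_on_integrable:
  assumes "prob_space Q" "test_on Q \<phi>"
  shows "integrable Q \<phi>"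
proof -
  interpret prob_space Q by fact
  show ?thesis
    using assms(2) by (intro integrable_const_bound[of _ 1]) (auto simp: test_on_def)
qed

lemma test_on_integrable_weight:
  fixes L :: "'b \<Rightarrow> real"
  assumes "integrable Q L" "test_on Q \<phi>"
  shows "integrable Q (\<lambda>x. (1 - \<phi> x) * L x)"
  using assms(1)
proof (rule Bochner_Integration.integrable_bound)
  show "(\<lambda>x. (1 - \<phi> x) * L x) \<in> borel_measurable Q"
    using assms by (auto simp: test_on_def)
  show "AE x in Q. norm ((1 - \<phi> x) * L x) \<le> norm (L x)"
  proof (rule AE_I2)
    fix x assume "x \<in> space Q"
    then have "\<bar>1 - \<phi> x\<bar> \<le> 1" using assms(2) by (auto simp: test_on_def)
    then show "norm ((1 - \<phi> x) * L x) \<le> norm (L x)"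
      by (simp add: abs_mult mult_left_le_one_le)
  qed
qed

text \<open>\<open>t\<close> is the lower quantile of \<open>L\<close> of order
  \<open>1 - \<alpha>\<close>. Right continuity of the distribution function gives the first bound,
  its left limit the second; an atom at \<open>t\<close> is what randomization has to
  resolve.\<close>

lemma quantile_exists:
  fixes L :: "'b \<Rightarrow> real"
  assumes Q: "prob_space Q" and [measurable]: "L \<in> borel_measurable Q" and pos: "\<And>x. x \<in> space Q \<Longrightarrow> 0 < L x"
    and \<alpha>: "0 < \<alpha>" "\<alpha> < 1"
  obtains t where "0 \<le> t" "measure Q {x \<in> space Q. t < L x} \<le> \<alpha>" "\<alpha> \<le> measure Q {x \<in> space Q. t \<le> L x}"
proof -
  interpret Q: prob_space Q by fact
  define D where "D = distr Q borel L"
  interpret D: real_distribution D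
    unfolding D_def by (intro Q.real_distribution_distr) simp
  have cdf: "cdf D t = measure Q {x \<in> space Q. L x \<le> t}" for t
    unfolding cdf_def D_def by (subst measure_distr) (auto intro!: arg_cong[where f = "measure Q"])
  define T where "T = {t. 1 - \<alpha> \<le> cdf D t}"
  have ge0: "0 \<le> t" if "t \<in> T" for t
  proof (rule ccontr)
    assume "\<not> 0 \<le> t"
    then have e: "{x \<in> space Q. L x \<le> t} = {}" using pos by force
    have "cdf D t = 0" unfolding cdf e by simp
    then show False using that \<alpha> by (simp add: T_def)
  qed
  then have bdd: "bdd_below T" by (rule bdd_belowI)
  have "eventually (\<lambda>t. 1 - \<alpha> < cdf D t) at_top"
    using D.cdf_lim_at_top_prob by (rule order_tendstoD) (use \<alpha> in simp)
  then have "T \<noteq> {}" unfolding T_def eventually_at_top_linorder by (auto intro: less_imp_le)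
  define t where "t = Inf T"
  have "0 \<le> t" unfolding t_def using \<open>T \<noteq> {}\<close> ge0 by (intro cInf_greatest)
  have "((cdf D) \<longlongrightarrow> cdf D t) (at_right t)"
    using D.cdf_is_right_cont[of t] by (simp add: continuous_within)
  moreover have "eventually (\<lambda>u. 1 - \<alpha> \<le> cdf D u) (at_right t)"
  proof (rule eventually_at_right_less[THEN eventually_mono])
    fix u assume "t < u"
    then obtain v where "v \<in> T" "v < u" unfolding t_def using \<open>T \<noteq> {}\<close> by (meson cInf_lessD)
    then show "1 - \<alpha> \<le> cdf D u" using D.cdf_nondecreasing[of v u] unfolding T_def by simp
  qed
  ultimately have 1: "1 - \<alpha> \<le> cdf D t" by (rule tendsto_lowerbound) simp
  have "(cdf D \<longlongrightarrow> measure D {..<t}) (at_left t)" by (rule D.cdf_at_left)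
  moreover have "eventually (\<lambda>u. cdf D u \<le> 1 - \<alpha>) (at_left t)"
  proof (rule eventually_mono)
    show "eventually (\<lambda>u. u < t) (at_left t)" by (simp add: eventually_at_filter)
    fix u assume "u < t"
    then have "u \<notin> T" unfolding t_def using bdd cInf_lower by fastforce
    then show "cdf D u \<le> 1 - \<alpha>" unfolding T_def by simp
  qed
  ultimately have "measure D {..<t} \<le> 1 - \<alpha>" by (rule tendsto_upperbound) simp
  also have "measure D {..<t} = measure Q {x \<in> space Q. L x < t}"
    unfolding D_def by (subst measure_distr) (auto intro!: arg_cong[where f = "measure Q"])
  finally have 2: "measure Q {x \<in> space Q. L x < t} \<le> 1 - \<alpha>" .
  have "measure Q {x \<in> space Q. \<not> t < L x} = 1 - measure Q {x \<in> space Q. t < L x}"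
    by (rule Q.prob_neg) simp
  moreover have "measure Q {x \<in> space Q. \<not> t \<le> L x} = 1 - measure Q {x \<in> space Q. t \<le> L x}"
    by (rule Q.prob_neg) simp
  ultimately show ?thesis
    using 1 2 \<open>0 \<le> t\<close> unfolding cdf by (intro that[of t]) (simp_all add: not_less not_le)
qed

text \<open>The test is 1 above the threshold, 0 below it, and randomizes on \<open>L x = t\<close>.
  Hence \<open>(\<phi> x - \<psi> x) * (L x - t)\<close> is nonnegative for every rival
  \<open>\<psi>\<close>; integration gives optimality because \<open>\<phi>\<close> exhausts the
  level and \<open>t\<close> is nonnegative.\<close>

theorem neyman_pearson_lemma:
  fixes L :: "'b \<Rightarrow> real"
  assumes Q: "prob_space Q" and L: "integrable Q L" and pos: "\<And>x. x \<in> space Q \<Longrightarrow> 0 < L x"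
    and \<alpha>: "0 < \<alpha>" "\<alpha> < 1"
  shows "\<exists>\<phi>. optimal_test Q L \<alpha> \<phi>"
proof -
  interpret Q: prob_space Q by fact
  have Lm [measurable]: "L \<in> borel_measurable Q" using L by simp
  obtain t where t: "0 \<le> t" "measure Q {x \<in> space Q. t < L x} \<le> \<alpha>" "\<alpha> \<le> measure Q {x \<in> space Q. t \<le> L x}"
    using quantile_exists[OF Q Lm pos \<alpha>] by blast
  define p q where "p = measure Q {x \<in> space Q. t < L x}" and "q = measure Q {x \<in> space Q. L x = t}"
  have "measure Q {x \<in> space Q. t \<le> L x} = measure Q ({x \<in> space Q. t < L x} \<union> {x \<in> space Q. L x = t})"
    by (rule arg_cong[where f = "measure Q"]) auto
  also have "\<dots> = p + q" unfolding p_def q_def by (rule Q.finite_measure_Union) auto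
  finally have pq: "p \<le> \<alpha>" "\<alpha> \<le> p + q" using t by (simp_all add: p_def)
  \<comment> \<open>If \<open>q = 0\<close> the division yields 0, which is right because then
    \<open>p = \<alpha>\<close>.\<close>
  define \<kappa> where "\<kappa> = (\<alpha> - p) / q"
  have "0 \<le> q" by (simp add: q_def)
  have \<kappa>: "0 \<le> \<kappa>" "\<kappa> \<le> 1" "p + \<kappa> * q = \<alpha>"
    using pq \<open>0 \<le> q\<close> by (cases "q = 0"; auto simp: \<kappa>_def divide_simps)+
  define \<phi> where "\<phi> x = indicat_real {x \<in> space Q. t < L x} x + \<kappa> * indicat_real {x \<in> space Q. L x = t} x" for x
  have \<phi>: "test_on Q \<phi>"
    unfolding test_on_def
  proof
    show "\<phi> \<in> borel_measurable Q" unfolding \<phi>_def[abs_def] by measurable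
    show "\<forall>x\<in>space Q. 0 \<le> \<phi> x \<and> \<phi> x \<le> 1" using \<kappa> by (auto simp: \<phi>_def indicator_def)
  qed
  have "(\<integral>x. \<phi> x \<partial>Q) = p + \<kappa> * q"
    unfolding \<phi>_def p_def q_def by (simp add: Int_absorb2 subset_eq less_top[symmetric])
  then have int\<phi>: "(\<integral>x. \<phi> x \<partial>Q) = \<alpha>" using \<kappa> by simp
  have "(\<integral>x. (1 - \<phi> x) * L x \<partial>Q) \<le> (\<integral>x. (1 - \<psi> x) * L x \<partial>Q)"
    if \<psi>: "test_on Q \<psi>" "(\<integral>x. \<psi> x \<partial>Q) \<le> \<alpha>" for \<psi>
  proof -
    note i = test_on_integrable_weight[OF L \<phi>] test_on_integrable_weight[OF L \<psi>(1)]
      test_on_integrable[OF Q \<phi>] test_on_integrable[OF Q \<psi>(1)]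
    have "0 \<le> t * ((\<integral>x. \<phi> x \<partial>Q) - (\<integral>x. \<psi> x \<partial>Q))" using t \<psi> int\<phi> by simp
    also have "\<dots> = (\<integral>x. t * (\<phi> x - \<psi> x) \<partial>Q)" using i by simp
    also have "\<dots> \<le> (\<integral>x. (1 - \<psi> x) * L x - (1 - \<phi> x) * L x \<partial>Q)"
    proof (rule integral_mono)
      fix x assume x: "x \<in> space Q"
      then have "0 \<le> (\<phi> x - \<psi> x) * (L x - t)"
        using \<psi>(1) by (cases "L x" t rule: linorder_cases)
          (auto simp: \<phi>_def test_on_def mult_nonpos_nonpos mult_nonneg_nonpos)
      then show "t * (\<phi> x - \<psi> x) \<le> (1 - \<psi> x) * L x - (1 - \<phi> x) * L x" by (simp add: algebra_simps)
    qed (use i in auto)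
    also have "\<dots> = (\<integral>x. (1 - \<psi> x) * L x \<partial>Q) - (\<integral>x. (1 - \<phi> x) * L x \<partial>Q)" using i by simp
    finally show ?thesis by simp
  qed
  with \<phi> int\<phi> show ?thesis by (auto simp: optimal_test_def)
qed

text \<open>Comparison with the test that rejects the null where \<open>\<Lambda> x < a\<close>: on
  its acceptance region the likelihood ratio \<open>exp (- \<Lambda> x)\<close> is at most
  \<open>exp (- a)\<close>.\<close>

lemma optimal_test_miss_le:
  assumes Q: "prob_space Q" and [measurable]: "\<Lambda> \<in> borel_measurable Q"
    and L: "integrable Q (\<lambda>x. exp (- \<Lambda> x))"
    and \<phi>: "optimal_test Q (\<lambda>x. exp (- \<Lambda> x)) \<alpha> \<phi>"
    and a: "measure Q {x \<in> space Q. \<Lambda> x < a} \<le> \<alpha>"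
  shows "(\<integral>x. (1 - \<phi> x) * exp (- \<Lambda> x) \<partial>Q) \<le> exp (- a)"
proof -
  interpret prob_space Q by fact
  let ?\<psi> = "indicat_real {x \<in> space Q. \<Lambda> x < a}"
  have t: "test_on Q ?\<psi>" by (auto simp: test_on_def indicator_def)
  then have "(\<integral>x. (1 - \<phi> x) * exp (- \<Lambda> x) \<partial>Q) \<le> (\<integral>x. (1 - ?\<psi> x) * exp (- \<Lambda> x) \<partial>Q)"
    using \<phi> a by (auto simp: optimal_test_def Int_absorb2 subset_eq)
  also have "\<dots> \<le> (\<integral>x. exp (- a) \<partial>Q)"
    using test_on_integrable_weight[OF L t]
    by (intro integral_mono) (auto simp: indicator_def)
  finally show ?thesis by (simp add: prob_space)
qed

text \<open>Any test of this level accepts with null probability at least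
  \<open>1 - \<alpha>\<close>, and off the event \<open>b < \<Lambda> x\<close> the alternative
  keeps at least the fraction \<open>exp (- b)\<close> of the null mass.\<close>

lemma test_miss_ge:
  assumes Q: "prob_space Q" and [measurable]: "\<Lambda> \<in> borel_measurable Q"
    and L: "integrable Q (\<lambda>x. exp (- \<Lambda> x))"
    and \<phi>: "test_on Q \<phi>" "(\<integral>x. \<phi> x \<partial>Q) \<le> \<alpha>"
  shows "exp (- b) * (1 - \<alpha> - measure Q {x \<in> space Q. b < \<Lambda> x}) \<le> (\<integral>x. (1 - \<phi> x) * exp (- \<Lambda> x) \<partial>Q)"
proof -
  interpret prob_space Q by fact
  let ?B = "{x \<in> space Q. b < \<Lambda> x}"
  note i = test_on_integrable[OF Q \<phi>(1)]
  have iB: "integrable Q (indicat_real ?B)" by (simp add: less_top[symmetric])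
  have "1 - \<alpha> - measure Q ?B \<le> (\<integral>x. 1 - \<phi> x - indicat_real ?B x \<partial>Q)"
    using i iB \<phi> by (simp add: prob_space Int_absorb2 subset_eq)
  then have "exp (- b) * (1 - \<alpha> - measure Q ?B) \<le> (\<integral>x. exp (- b) * (1 - \<phi> x - indicat_real ?B x) \<partial>Q)"
    by simp
  also have "\<dots> \<le> (\<integral>x. (1 - \<phi> x) * exp (- \<Lambda> x) \<partial>Q)"
  proof (rule integral_mono)
    fix x assume x: "x \<in> space Q"
    then have \<phi>x: "0 \<le> \<phi> x" "\<phi> x \<le> 1" using \<phi> by (auto simp: test_on_def)
    show "exp (- b) * (1 - \<phi> x - indicat_real ?B x) \<le> (1 - \<phi> x) * exp (- \<Lambda> x)"
    proof (cases "b < \<Lambda> x")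
      case True
      then have "exp (- b) * (1 - \<phi> x - indicat_real ?B x) \<le> 0"
        using x \<phi>x by (intro mult_nonneg_nonpos) auto
      also have "\<dots> \<le> (1 - \<phi> x) * exp (- \<Lambda> x)" using \<phi>x by simp
      finally show ?thesis .
    next
      case False
      then have "(1 - \<phi> x) * exp (- b) \<le> (1 - \<phi> x) * exp (- \<Lambda> x)"
        using \<phi>x by (intro mult_left_mono) auto
      then show ?thesis using False by (simp add: mult.commute)
    qed
  qed (use i iB test_on_integrable_weight[OF L \<phi>(1)] in auto)
  finally show ?thesis .
qed

text \<open>The constant \<open>c\<close> contributes only \<open>ln c / n m\<close>, which tends to
  0. Positivity of \<open>P m\<close>, on which its logarithm depends, comes from the lower
  bound.\<close>

lemma exponent_limitI:
  fixes n P :: "nat \<Rightarrow> real"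
  assumes n: "\<And>m. 0 < n m" "filterlim n at_top sequentially" and c: "0 < c"
    and up: "\<And>\<epsilon>. 0 < \<epsilon> \<Longrightarrow> eventually (\<lambda>m. P m \<le> exp (- (n m * (K - \<epsilon>)))) sequentially"
    and low: "\<And>\<epsilon>. 0 < \<epsilon> \<Longrightarrow> eventually (\<lambda>m. exp (- (n m * (K + \<epsilon>))) * c \<le> P m) sequentially"
  shows "(\<lambda>m. - (1 / n m) * ln (P m)) \<longlonglongrightarrow> K"
proof (rule tendstoI)
  fix e :: real assume e: "0 < e"
  have "(\<lambda>m. ln c / n m) \<longlonglongrightarrow> 0" by (rule real_tendsto_divide_at_top[OF tendsto_const n(2)])
  then have "eventually (\<lambda>m. dist (ln c / n m) 0 < e / 2) sequentially"
    by (rule tendstoD) (use e in simp)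
  moreover have "eventually (\<lambda>m. P m \<le> exp (- (n m * (K - e / 2)))) sequentially"
    by (rule up) (use e in simp)
  moreover have "eventually (\<lambda>m. exp (- (n m * (K + e / 2))) * c \<le> P m) sequentially"
    by (rule low) (use e in simp)
  ultimately show "eventually (\<lambda>m. dist (- (1 / n m) * ln (P m)) K < e) sequentially"
  proof eventually_elim
    case (elim m)
    have P: "0 < P m" using elim(3) c by (meson exp_gt_zero less_le_trans mult_pos_pos)
    have "ln (P m) \<le> ln (exp (- (n m * (K - e / 2))))" using elim(2) P by (subst ln_le_cancel_iff) auto
    then have "ln (P m) \<le> - (n m * (K - e / 2))" by simp
    then have 1: "K - e / 2 \<le> - (1 / n m) * ln (P m)" using n(1)[of m] by (simp add: field_simps)
    have "ln (exp (- (n m * (K + e / 2))) * c) \<le> ln (P m)" using elim(3) P c by simp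
    then have "- (n m * (K + e / 2)) + ln c \<le> ln (P m)" using c by (simp add: ln_mult)
    then have "- (1 / n m) * ln (P m) \<le> K + e / 2 - ln c / n m" using n(1)[of m] by (simp add: field_simps)
    moreover have "\<bar>ln c / n m\<bar> < e / 2"
      using elim(1) unfolding dist_real_def by (simp only: diff_0_right)
    ultimately show ?case using 1 unfolding dist_real_def abs_less_iff by linarith
  qed
qed

text \<open>Chebyshev under the null places \<open>\<Lambda> m\<close> within
  \<open>n m * \<epsilon>\<close> of \<open>n m * K\<close> with probability tending to one. The
  upper bound spends the level on the downward deviations; the lower bound discards the upward
  ones.\<close>

theorem stein_exponent:
  fixes Q :: "nat \<Rightarrow> 'b measure" and \<Lambda> \<phi> :: "nat \<Rightarrow> 'b \<Rightarrow> real" and n \<mu> :: "nat \<Rightarrow> real"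
  assumes Q: "\<And>m. prob_space (Q m)" and meas: "\<And>m. \<Lambda> m \<in> borel_measurable (Q m)"
    and L: "\<And>m. integrable (Q m) (\<lambda>x. exp (- \<Lambda> m x))"
    and n: "\<And>m. 0 < n m" "filterlim n at_top sequentially"
    and \<mu>: "(\<lambda>m. \<mu> m / n m) \<longlonglongrightarrow> K"
    and var: "\<And>m. integrable (Q m) (\<lambda>x. (\<Lambda> m x - \<mu> m)\<^sup>2)"
      "\<And>m. (\<integral>x. (\<Lambda> m x - \<mu> m)\<^sup>2 \<partial>Q m) \<le> c * n m"
    and \<alpha>: "0 < \<alpha>" "\<alpha> < 1"
    and \<phi>: "\<And>m. optimal_test (Q m) (\<lambda>x. exp (- \<Lambda> m x)) \<alpha> (\<phi> m)"
  shows "(\<lambda>m. - (1 / n m) * ln (\<integral>x. (1 - \<phi> m x) * exp (- \<Lambda> m x) \<partial>Q m)) \<longlonglongrightarrow> K"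
proof -
  \<comment> \<open>The margin is split evenly between the bias of \<open>\<mu> m / n m\<close> and
    the fluctuation, whence \<open>\<epsilon> / 2\<close>. A variance of order \<open>n m\<close>
    against the square of \<open>n m\<close> leaves a probability of order
    \<open>1 / n m\<close>.\<close>
  have dev: "eventually (\<lambda>m. measure (Q m) {x \<in> space (Q m). n m * \<epsilon> \<le> \<bar>\<Lambda> m x - n m * K\<bar>} \<le> \<beta>) sequentially"
    if "0 < \<epsilon>" "0 < \<beta>" for \<epsilon> \<beta>
  proof -
    have "(\<lambda>m. c / (\<epsilon> / 2)\<^sup>2 / n m) \<longlonglongrightarrow> 0" by (rule real_tendsto_divide_at_top[OF tendsto_const n(2)])
    then have "eventually (\<lambda>m. c / (\<epsilon> / 2)\<^sup>2 / n m < \<beta>) sequentially"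
      using that by (intro order_tendstoD(2)) auto
    moreover have "eventually (\<lambda>m. dist (\<mu> m / n m) K < \<epsilon> / 2) sequentially"
      using \<mu> by (rule tendstoD) (use that in simp)
    ultimately show ?thesis
    proof eventually_elim
      case (elim m)
      interpret prob_space "Q m" by (rule Q)
      note [measurable] = meas[of m]
      have nm: "0 < n m" by (rule n)
      have "\<bar>\<mu> m - n m * K\<bar> = n m * dist (\<mu> m / n m) K"
        using nm by (simp add: dist_real_def abs_mult[symmetric, of "n m", simplified] field_simps flip: abs_mult_pos)
      also have "\<dots> \<le> n m * (\<epsilon> / 2)" using elim nm by simp
      finally have close: "\<bar>\<mu> m - n m * K\<bar> \<le> n m * (\<epsilon> / 2)" .
      let ?A = "{x \<in> space (Q m). (n m * (\<epsilon> / 2))\<^sup>2 \<le> (\<Lambda> m x - \<mu> m)\<^sup>2}"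
      have "measure (Q m) {x \<in> space (Q m). n m * \<epsilon> \<le> \<bar>\<Lambda> m x - n m * K\<bar>} \<le> measure (Q m) ?A"
      proof (rule finite_measure_mono)
        show "{x \<in> space (Q m). n m * \<epsilon> \<le> \<bar>\<Lambda> m x - n m * K\<bar>} \<subseteq> ?A"
        proof safe
          fix x assume "n m * \<epsilon> \<le> \<bar>\<Lambda> m x - n m * K\<bar>"
          then have "n m * (\<epsilon> / 2) \<le> \<bar>\<Lambda> m x - \<mu> m\<bar>"
            using close abs_triangle_ineq[of "\<Lambda> m x - \<mu> m" "\<mu> m - n m * K"] by simp
          then have "(n m * (\<epsilon> / 2))\<^sup>2 \<le> \<bar>\<Lambda> m x - \<mu> m\<bar>\<^sup>2"
            using nm that by (intro power_mono) auto
          then show "(n m * (\<epsilon> / 2))\<^sup>2 \<le> (\<Lambda> m x - \<mu> m)\<^sup>2" by simp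
        qed
      qed measurable
      also have "\<dots> \<le> (\<integral>x. (\<Lambda> m x - \<mu> m)\<^sup>2 \<partial>Q m) / (n m * (\<epsilon> / 2))\<^sup>2"
        using nm that by (intro integral_Markov_inequality_measure[where A = "{}"] var) auto
      also have "\<dots> \<le> c * n m / (n m * (\<epsilon> / 2))\<^sup>2"
        using var by (intro divide_right_mono) auto
      also have "\<dots> = c / (\<epsilon> / 2)\<^sup>2 / n m" using nm by (simp add: power2_eq_square)
      finally show ?case using elim by simp
    qed
  qed
  show ?thesis
  proof (rule exponent_limitI[OF n])
    show "0 < (1 - \<alpha>) / 2" using \<alpha> by simp
    fix \<epsilon> :: real assume \<epsilon>: "0 < \<epsilon>"
    show "eventually (\<lambda>m. (\<integral>x. (1 - \<phi> m x) * exp (- \<Lambda> m x) \<partial>Q m) \<le> exp (- (n m * (K - \<epsilon>)))) sequentially"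
      using dev[OF \<epsilon> \<alpha>(1)]
    proof eventually_elim
      case (elim m)
      interpret prob_space "Q m" by (rule Q)
      note [measurable] = meas[of m]
      have "measure (Q m) {x \<in> space (Q m). \<Lambda> m x < n m * (K - \<epsilon>)} \<le>
          measure (Q m) {x \<in> space (Q m). n m * \<epsilon> \<le> \<bar>\<Lambda> m x - n m * K\<bar>}"
        by (rule finite_measure_mono) (auto simp: algebra_simps abs_if)
      with elim show ?case
        by (intro optimal_test_miss_le[OF Q meas L \<phi>]) simp
    qed
    \<comment> \<open>Of the acceptance probability \<open>1 - \<alpha>\<close> at most half is lost
      to the deviation event; the other half is the constant factor in the lower bound.\<close>
    have "0 < (1 - \<alpha>) / 2" using \<alpha> by simp
    from dev[OF \<epsilon> this]
    show "eventually (\<lambda>m. exp (- (n m * (K + \<epsilon>))) * ((1 - \<alpha>) / 2) \<le> (\<integral>x. (1 - \<phi> m x) * exp (- \<Lambda> m x) \<partial>Q m)) sequentially"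
    proof eventually_elim
      case (elim m)
      interpret prob_space "Q m" by (rule Q)
      note [measurable] = meas[of m]
      have "measure (Q m) {x \<in> space (Q m). n m * (K + \<epsilon>) < \<Lambda> m x} \<le>
          measure (Q m) {x \<in> space (Q m). n m * \<epsilon> \<le> \<bar>\<Lambda> m x - n m * K\<bar>}"
        by (rule finite_measure_mono) (auto simp: algebra_simps abs_if)
      with elim have "(1 - \<alpha>) / 2 \<le> 1 - \<alpha> - measure (Q m) {x \<in> space (Q m). n m * (K + \<epsilon>) < \<Lambda> m x}"
        by (simp add: field_simps)
      then have "exp (- (n m * (K + \<epsilon>))) * ((1 - \<alpha>) / 2) \<le>
          exp (- (n m * (K + \<epsilon>))) * (1 - \<alpha> - measure (Q m) {x \<in> space (Q m). n m * (K + \<epsilon>) < \<Lambda> m x})"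
        by (intro mult_left_mono) auto
      also have "\<dots> \<le> (\<integral>x. (1 - \<phi> m x) * exp (- \<Lambda> m x) \<partial>Q m)"
        using \<phi>[of m] by (intro test_miss_ge[OF Q meas L]) (auto simp: optimal_test_def)
      finally show ?case .
    qed
  qed
qed

subsection \<open>Trigonometric sums on the torus\<close>

definition circle_law :: "real measure" where
  "circle_law = density lborel (\<lambda>x. ennreal (indicator {-pi..pi} x / (2 * pi)))"

text \<open>Normalised Haar measure of the torus: it absorbs the prefactor
  \<open>1 / (4 * pi\<^sup>2)\<close> of the exponent and makes the waves orthonormal.\<close>

definition torus_law :: "(real \<times> real) measure" where
  "torus_law = circle_law \<Otimes>\<^sub>M circle_law"

lemma sets_circle_law [simp, measurable_cong]: "sets circle_law = sets borel"
  by (simp add: circle_law_def)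

lemma sets_torus_law [simp, measurable_cong]: "sets torus_law = sets borel"
  unfolding torus_law_def borel_prod[symmetric] by (intro sets_pair_measure_cong) simp_all

lemma space_torus_law [simp]: "space torus_law = UNIV"
  using sets_eq_imp_space_eq[OF sets_torus_law] by simp

lemma prob_space_circle_law: "prob_space circle_law"
proof (rule prob_spaceI)
  have "emeasure circle_law (space circle_law) = (\<integral>\<^sup>+x. ennreal (1 / (2 * pi)) * indicator {-pi..pi} x \<partial>lborel)"
    unfolding circle_law_def
    by (simp add: emeasure_density) (intro nn_integral_cong, auto simp: indicator_def)
  also have "\<dots> = ennreal (1 / (2 * pi)) * ennreal (2 * pi)"
    by (simp add: nn_integral_cmult)
  also have "\<dots> = 1" by (simp flip: ennreal_mult)
  finally show "emeasure circle_law (space circle_law) = 1" .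
qed

lemma pair_prob_space_circle_law: "pair_prob_space circle_law circle_law"
  by (intro pair_prob_space.intro pair_sigma_finite.intro prob_space_circle_law
      prob_space_imp_sigma_finite)

lemma prob_space_torus_law: "prob_space torus_law"
proof -
  interpret pair_prob_space circle_law circle_law by (rule pair_prob_space_circle_law)
  show ?thesis unfolding torus_law_def by unfold_locales
qed

lemma torus_law_density:
  "torus_law = density lborel (\<lambda>w. ennreal (indicator freq_square w / (4 * pi\<^sup>2)))"
proof -
  interpret prob_space circle_law by (rule prob_space_circle_law)
  have "torus_law = density (lborel \<Otimes>\<^sub>M lborel)
      (\<lambda>(x, y). ennreal (indicator {-pi..pi} x / (2 * pi)) * ennreal (indicator {-pi..pi} y / (2 * pi)))"
    unfolding torus_law_def circle_law_def
    by (intro pair_measure_density sigma_finite_measure_axioms[unfolded circle_law_def] lborel.sigma_finite_measure_axioms) simp_all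
  also have "\<dots> = density lborel (\<lambda>w. ennreal (indicator freq_square w / (4 * pi\<^sup>2)))"
    unfolding lborel_prod
    by (intro arg_cong[where f = "density lborel"] ext)
      (auto simp: indicator_def power2_eq_square simp flip: ennreal_mult)
  finally show ?thesis .
qed

lemma freq_square_borel [measurable]: "freq_square \<in> sets borel"
  by (intro borel_closed closed_Times) simp_all

lemma integral_torus_law:
  fixes h :: "real \<times> real \<Rightarrow> 'b::{banach, second_countable_topology}"
  assumes [measurable]: "h \<in> borel_measurable borel"
  shows "(\<integral>w. h w \<partial>torus_law) = (1 / (4 * pi\<^sup>2)) *\<^sub>R (LINT w:freq_square|lborel. h w)"
proof -
  have "(\<integral>w. h w \<partial>torus_law) = (\<integral>w. (indicat_real freq_square w / (4 * pi\<^sup>2)) *\<^sub>R h w \<partial>lborel)"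
    unfolding torus_law_density by (subst integral_density) simp_all
  also have "\<dots> = (\<integral>w. (1 / (4 * pi\<^sup>2)) *\<^sub>R indicat_real freq_square w *\<^sub>R h w \<partial>lborel)"
    by simp
  finally show ?thesis unfolding set_lebesgue_integral_def integral_scaleR_right .
qed

lemma integral_circle_law_iexp:
  "(\<integral>x. iexp (of_int k * x) \<partial>circle_law) = (if k = 0 then 1 else 0)"
proof (cases "k = 0")
  case True
  then show ?thesis using prob_space_circle_law by (simp add: prob_space.prob_space)
next
  case False
  let ?F = "\<lambda>x::real. iexp (of_int k * x) / (\<i> * of_int k)"
  have "(\<integral>x. indicat_real {-pi..pi} x *\<^sub>R iexp (of_int k * x) \<partial>lborel) = ?F pi - ?F (-pi)"
  proof (rule integral_FTC_Icc)
    fix x :: real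
    have "((\<lambda>z. exp ((\<i> * of_int k) * z) / (\<i> * of_int k)) has_field_derivative
        exp ((\<i> * of_int k) * complex_of_real x)) (at (complex_of_real x))"
      using False by (auto intro!: derivative_eq_intros)
    from has_vector_derivative_real_field[OF this]
    have "((\<lambda>x. exp ((\<i> * of_int k) * complex_of_real x) / (\<i> * of_int k)) has_vector_derivative
        exp ((\<i> * of_int k) * complex_of_real x)) (at x within {-pi..pi})" .
    then show "(?F has_vector_derivative iexp (of_int k * x)) (at x within {-pi..pi})"
      by (simp add: mult.assoc)
  qed (auto intro!: continuous_intros)
  also have "\<dots> = 0"
  proof -
    have "iexp (of_int k * pi) = iexp (of_int k * - pi)"
      unfolding exp_eq by (rule exI[of _ k]) (simp add: algebra_simps)
    then show ?thesis by simp
  qed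
  finally have "(\<integral>x. indicat_real {-pi..pi} x *\<^sub>R iexp (of_int k * x) \<partial>lborel) = 0" .
  moreover have "(\<integral>x. iexp (of_int k * x) \<partial>circle_law) =
      (1 / (2 * pi)) *\<^sub>R (\<integral>x. indicat_real {-pi..pi} x *\<^sub>R iexp (of_int k * x) \<partial>lborel)"
  proof -
    have "(\<integral>x. iexp (of_int k * x) \<partial>circle_law) =
        (\<integral>x. (indicat_real {-pi..pi} x / (2 * pi)) *\<^sub>R iexp (of_int k * x) \<partial>lborel)"
      unfolding circle_law_def by (subst integral_density) simp_all
    also have "\<dots> = (\<integral>x. (1 / (2 * pi)) *\<^sub>R indicat_real {-pi..pi} x *\<^sub>R iexp (of_int k * x) \<partial>lborel)"
      by (intro Bochner_Integration.integral_cong refl) (simp only: scaleR_scaleR times_divide_eq_left mult_1)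
    finally show ?thesis unfolding integral_scaleR_right .
  qed
  ultimately show ?thesis using False by (simp only: scaleR_zero_right if_False)
qed

section \<open>Characters of the torus and their orthogonality\<close>

definition wave :: "site \<Rightarrow> real \<times> real \<Rightarrow> complex" where
  "wave p w = iexp (freq_pairing p w)"

lemma freq_pairing_diff_right: "freq_pairing p (v - w) = freq_pairing p v - freq_pairing p w"
  by (simp add: freq_pairing_def algebra_simps)

lemma freq_pairing_add_left: "freq_pairing (p + q) w = freq_pairing p w + freq_pairing q w"
  by (simp add: freq_pairing_def algebra_simps)

lemma continuous_freq_pairing [continuous_intros]:
  "continuous_on A (freq_pairing p)"
  unfolding freq_pairing_def[abs_def] by (intro continuous_intros)

lemma continuous_wave [continuous_intros]: "continuous_on A (wave p)"
  unfolding wave_def[abs_def] by (intro continuous_intros)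

lemma wave_measurable [measurable]: "wave p \<in> borel_measurable borel"
  by (intro borel_measurable_continuous_onI continuous_wave)

lemma cmod_wave [simp]: "cmod (wave p w) = 1"
  by (simp add: wave_def)

lemma cnj_wave: "cnj (wave p w) = wave (- p) w"
  by (simp add: wave_def exp_cnj freq_pairing_def algebra_simps)

lemma wave_add: "wave (p + q) w = wave p w * wave q w"
  by (simp add: wave_def freq_pairing_add_left exp_add distrib_left)

lemma wave_diff: "wave (p - q) w = wave p w * cnj (wave q w)"
  using wave_add[of p "- q" w] by (simp add: cnj_wave)

lemma wave_diff_right: "wave p (v - w) = wave p v * cnj (wave p w)"
  by (simp add: wave_def exp_cnj freq_pairing_diff_right exp_diff exp_minus right_diff_distrib divide_inverse)

lemma wave_0 [simp]: "wave 0 w = 1"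
  by (simp add: wave_def freq_pairing_def)

lemma integrable_torus_law:
  fixes h :: "real \<times> real \<Rightarrow> 'b::{banach, second_countable_topology}"
  assumes "h \<in> borel_measurable borel" "\<And>w. norm (h w) \<le> B"
  shows "integrable torus_law h"
proof -
  interpret prob_space torus_law by (rule prob_space_torus_law)
  show ?thesis using assms by (intro integrable_const_bound[of _ B]) auto
qed

lemma integrable_wave [simp]: "integrable torus_law (wave p)"
  by (rule integrable_torus_law[where B = 1]) simp_all

lemma integral_wave: "(\<integral>w. wave p w \<partial>torus_law) = (if p = 0 then 1 else 0)"
proof -
  interpret pair_prob_space circle_law circle_law by (rule pair_prob_space_circle_law)
  have eq: "wave p w = iexp (of_int (fst p) * fst w) * iexp (of_int (snd p) * snd w)" for w
    by (simp add: wave_def freq_pairing_def exp_add distrib_left)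
  have "(\<integral>w. wave p w \<partial>torus_law) =
      (\<integral>x. \<integral>y. wave p (x, y) \<partial>circle_law \<partial>circle_law)"
    unfolding torus_law_def
    by (rule integral_fst'[symmetric]) (use integrable_wave[of p] in \<open>simp add: torus_law_def\<close>)
  also have "\<dots> = (\<integral>x. iexp (of_int (fst p) * x) \<partial>circle_law) * (\<integral>y. iexp (of_int (snd p) * y) \<partial>circle_law)"
    unfolding eq fst_conv snd_conv by simp
  also have "\<dots> = (if p = 0 then 1 else 0)"
    unfolding integral_circle_law_iexp by (cases p) (auto simp: zero_prod_def)
  finally show ?thesis .
qed

definition trig_sum :: "site set \<Rightarrow> (site \<Rightarrow> real) \<Rightarrow> real \<times> real \<Rightarrow> complex" where
  "trig_sum I c w = (\<Sum>p\<in>I. c p * wave p w)"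

text \<open>For a unit vector \<open>c\<close> this is a probability density with respect to
  \<open>torus_law\<close>, by Parseval; for \<open>c\<close> constantly 1 it is the Fejer kernel of
  \<open>I\<close>, not normalised, of total mass \<open>card I\<close>.\<close>

definition trig_power :: "site set \<Rightarrow> (site \<Rightarrow> real) \<Rightarrow> real \<times> real \<Rightarrow> real" where
  "trig_power I c w = (cmod (trig_sum I c w))\<^sup>2"

lemma trig_power_nonneg: "0 \<le> trig_power I c w"
  by (simp add: trig_power_def)

lemma of_real_trig_power:
  "complex_of_real (trig_power I c w) = (\<Sum>p\<in>I. \<Sum>q\<in>I. c p * c q * wave (q - p) w)"
proof -
  have "complex_of_real (trig_power I c w) = cnj (trig_sum I c w) * trig_sum I c w"
    by (simp add: trig_power_def complex_norm_square mult.commute del: of_real_power)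
  also have "\<dots> = (\<Sum>p\<in>I. \<Sum>q\<in>I. (c p * cnj (wave p w)) * (c q * wave q w))"
    by (simp add: trig_sum_def sum_product)
  finally show ?thesis by (simp add: wave_diff mult_ac)
qed

lemma continuous_trig_power: "continuous_on A (trig_power I c)"
  unfolding trig_power_def[abs_def] trig_sum_def by (intro continuous_intros)

lemma trig_power_measurable [measurable]: "trig_power I c \<in> borel_measurable borel"
  by (intro borel_measurable_continuous_onI continuous_trig_power)

lemma trig_power_le: "trig_power I c w \<le> (\<Sum>p\<in>I. \<bar>c p\<bar>)\<^sup>2"
  unfolding trig_power_def trig_sum_def
  by (intro power_mono order_trans[OF norm_sum] sum_mono) (simp_all add: norm_mult)

lemma integrable_mult_trig_power:
  fixes h :: "real \<times> real \<Rightarrow> real"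
  assumes "h \<in> borel_measurable borel" "\<And>w. \<bar>h w\<bar> \<le> B"
  shows "integrable torus_law (\<lambda>w. h w * trig_power I c w)"
proof (rule integrable_torus_law)
  show "(\<lambda>w. h w * trig_power I c w) \<in> borel_measurable borel" using assms by measurable
  fix w
  show "norm (h w * trig_power I c w) \<le> B * (\<Sum>p\<in>I. \<bar>c p\<bar>)\<^sup>2"
    using assms(2)[of w] trig_power_le[of I c w] trig_power_nonneg[of I c w]
    by (simp add: abs_mult) (intro mult_mono, auto)
qed

lemma of_real_integral_mult_trig_power:
  fixes h :: "real \<times> real \<Rightarrow> real"
  assumes [measurable]: "h \<in> borel_measurable borel" and h: "\<And>w. \<bar>h w\<bar> \<le> B"
  shows "complex_of_real (\<integral>w. h w * trig_power I c w \<partial>torus_law) =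
     (\<Sum>p\<in>I. \<Sum>q\<in>I. c p * c q * (\<integral>w. h w * wave (q - p) w \<partial>torus_law))"
proof -
  have int: "integrable torus_law (\<lambda>w. complex_of_real (c p * c q) * (h w * wave (q - p) w))" for p q
    by (intro integrable_mult_right integrable_torus_law[where B = B]) (simp_all add: norm_mult h)
  have "complex_of_real (\<integral>w. h w * trig_power I c w \<partial>torus_law) =
      (\<integral>w. (\<Sum>p\<in>I. \<Sum>q\<in>I. complex_of_real (c p * c q) * (h w * wave (q - p) w)) \<partial>torus_law)"
    by (simp add: of_real_trig_power sum_distrib_left mult_ac flip: integral_complex_of_real)
  also have "\<dots> = (\<Sum>p\<in>I. \<Sum>q\<in>I. (\<integral>w. complex_of_real (c p * c q) * (h w * wave (q - p) w) \<partial>torus_law))"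
    using int by (simp add: Bochner_Integration.integral_sum Bochner_Integration.integrable_sum)
  finally show ?thesis by simp
qed

lemma integral_trig_power:
  assumes "finite I"
  shows "(\<integral>w. trig_power I c w \<partial>torus_law) = (\<Sum>p\<in>I. (c p)\<^sup>2)"
proof -
  have "complex_of_real (\<integral>w. trig_power I c w \<partial>torus_law) =
     (\<Sum>p\<in>I. \<Sum>q\<in>I. c p * c q * (\<integral>w. wave (q - p) w \<partial>torus_law))"
    using of_real_integral_mult_trig_power[of "\<lambda>_. 1" 1 I c] by simp
  also have "\<dots> = (\<Sum>p\<in>I. \<Sum>q\<in>I. if q = p then complex_of_real (c p * c q) else 0)"
    by (intro sum.cong refl) (simp add: integral_wave)
  also have "\<dots> = complex_of_real (\<Sum>p\<in>I. (c p)\<^sup>2)" using assms by (simp add: power2_eq_square)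
  finally show ?thesis using of_real_eq_iff by blast
qed

subsection \<open>Berezin-Lieb inequalities for Toeplitz blocks\<close>

abbreviation fejer :: "site set \<Rightarrow> real \<times> real \<Rightarrow> real" where
  "fejer I \<equiv> trig_power I (\<lambda>_. 1)"

lemma of_real_fejer_shift:
  "complex_of_real (fejer I (s - w)) = (\<Sum>p\<in>I. \<Sum>q\<in>I. wave (q - p) (s - w))"
  by (simp add: of_real_trig_power)

lemma integrable_mult_fejer_shift:
  fixes h :: "real \<times> real \<Rightarrow> 'b::{real_normed_algebra, banach, second_countable_topology}"
  assumes [measurable]: "h \<in> borel_measurable borel" and h: "\<And>s. norm (h s) \<le> B"
  shows "integrable torus_law (\<lambda>s. fejer I (s - w) *\<^sub>R h s)"
proof (rule integrable_torus_law)
  fix s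
  show "norm (fejer I (s - w) *\<^sub>R h s) \<le> (\<Sum>p\<in>I. \<bar>1\<bar>)\<^sup>2 * B"
    using h[of s] trig_power_le[of I "\<lambda>_. 1" "s - w"] trig_power_nonneg[of I "\<lambda>_. 1" "s - w"]
    by (simp add: abs_mult) (intro mult_mono, auto)
qed simp

lemma integral_wave_shift: "(\<integral>s. wave p (s - w) \<partial>torus_law) = (if p = 0 then 1 else 0)"
  by (simp add: wave_diff_right integral_wave)

text \<open>Orthogonality keeps exactly the pairs of sites that differ by \<open>h\<close>, so the
  Fourier coefficients of the Fejer kernel count the sites that stay in \<open>I\<close> under a
  translation. The shift by \<open>w\<close> is invisible because only the zero frequency
  survives.\<close>

lemma integral_wave_fejer_shift:
  assumes fin: "finite I"
  shows "(\<integral>s. fejer I (s - w) * Re (wave h (s - w)) \<partial>torus_law) = card {p \<in> I. p - h \<in> I}"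
proof -
  have int: "integrable torus_law (\<lambda>s. wave r (s - w))" for r
    by (rule integrable_torus_law[where B = 1]) simp_all
  have "(\<integral>s. fejer I (s - w) *\<^sub>R wave h (s - w) \<partial>torus_law) =
      (\<integral>s. (\<Sum>p\<in>I. \<Sum>q\<in>I. wave (q - p + h) (s - w)) \<partial>torus_law)"
    by (simp add: scaleR_conv_of_real of_real_fejer_shift sum_distrib_right wave_add)
  also have "\<dots> = (\<Sum>p\<in>I. \<Sum>q\<in>I. (\<integral>s. wave (q - p + h) (s - w) \<partial>torus_law))"
    using int by (simp add: Bochner_Integration.integral_sum Bochner_Integration.integrable_sum)
  also have "\<dots> = (\<Sum>p\<in>I. \<Sum>q\<in>I. if q = p - h then 1 else 0)"
    by (intro sum.cong refl) (auto simp: integral_wave_shift algebra_simps eq_diff_eq)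
  also have "\<dots> = (\<Sum>p\<in>I. if p - h \<in> I then 1 else 0)" using fin by simp
  also have "\<dots> = of_nat (card {p \<in> I. p - h \<in> I})" using fin by (simp add: sum.If_cases Int_def)
  finally have *: "(\<integral>s. fejer I (s - w) *\<^sub>R wave h (s - w) \<partial>torus_law) = of_nat (card {p \<in> I. p - h \<in> I})" .
  have "(\<integral>s. fejer I (s - w) * Re (wave h (s - w)) \<partial>torus_law) =
      Re (\<integral>s. fejer I (s - w) *\<^sub>R wave h (s - w) \<partial>torus_law)"
    by (subst integral_Re[symmetric], intro integrable_mult_fejer_shift[where B = 1]) simp_all
  then show ?thesis unfolding * by simp
qed

lemma integral_fejer_shift:
  assumes "finite I"
  shows "(\<integral>s. fejer I (s - w) \<partial>torus_law) = card I"
  using integral_wave_fejer_shift[OF assms, of w 0] by simp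

text \<open>The integral of \<open>2 - Re (wave (1, 0) s) - Re (wave (0, 1) s)\<close> against the
  Fejer kernel. For finite \<open>I\<close> it counts, in each coordinate direction, the sites whose
  predecessor lies outside \<open>I\<close>.\<close>

definition boundary_defect :: "site set \<Rightarrow> real" where
  "boundary_defect I = 2 * real (card I) - real (card {p \<in> I. p - (1, 0) \<in> I}) -
     real (card {p \<in> I. p - (0, 1) \<in> I})"

text \<open>Convexity on the half line in the form in which it is used: a supporting line at every
  point. The bound on the slopes controls the effect of replacing eigenvalue averages by the
  symbol.\<close>

definition tangent_bounded :: "real \<Rightarrow> (real \<Rightarrow> real) \<Rightarrow> bool" where
  "tangent_bounded L F \<longleftrightarrow> (\<forall>a\<ge>0. \<exists>d. \<bar>d\<bar> \<le> L \<and> (\<forall>x\<ge>0. F a + d * (x - a) \<le> F x))"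

text \<open>A finite section of the Toeplitz operator with symbol \<open>g\<close>, together with an
  eigenbasis. The section \<open>I\<close> is an arbitrary finite set; its shape matters only
  through \<open>boundary_defect\<close>.\<close>

locale toeplitz_block =
  fixes I :: "site set" and C :: "site \<Rightarrow> site \<Rightarrow> real" and g :: "real \<times> real \<Rightarrow> real" and B :: real
    and e :: "site \<Rightarrow> site \<Rightarrow> real" and l :: "site \<Rightarrow> real"
  assumes fin: "finite I"
    and orthonormal: "\<And>j k. j \<in> I \<Longrightarrow> k \<in> I \<Longrightarrow> ip I (e j) (e k) = (if j = k then 1 else 0)"
    and complete: "\<And>p q. p \<in> I \<Longrightarrow> q \<in> I \<Longrightarrow> (\<Sum>k\<in>I. e k p * e k q) = (if p = q then 1 else 0)"
    and eigen: "\<And>k p. k \<in> I \<Longrightarrow> p \<in> I \<Longrightarrow> kernel_op I C (e k) p = l k * e k p"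
    and g_meas [measurable]: "g \<in> borel_measurable borel"
    and g_bounds: "\<And>w. 0 \<le> g w" "\<And>w. g w \<le> B"
    and symbol: "\<And>p q. p \<in> I \<Longrightarrow> q \<in> I \<Longrightarrow>
      complex_of_real (C p q) = (\<integral>w. g w * wave (q - p) w \<partial>torus_law)"
begin

lemma kernel_expansion:
  assumes "p \<in> I" "q \<in> I"
  shows "C p q = (\<Sum>k\<in>I. l k * (e k p * e k q))"
proof -
  have "(\<Sum>k\<in>I. l k * (e k p * e k q)) = (\<Sum>k\<in>I. (\<Sum>r\<in>I. C p r * e k r) * e k q)"
    using eigen assms by (intro sum.cong refl) (simp add: kernel_op_def)
  also have "\<dots> = (\<Sum>r\<in>I. \<Sum>k\<in>I. C p r * e k r * e k q)"
    unfolding sum_distrib_right by (rule sum.swap)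
  also have "\<dots> = (\<Sum>r\<in>I. C p r * (\<Sum>k\<in>I. e k r * e k q))"
    by (simp add: sum_distrib_left mult.assoc)
  also have "\<dots> = (\<Sum>r\<in>I. if r = q then C p r else 0)"
    using assms complete by (intro sum.cong refl) simp
  finally show ?thesis using assms fin by simp
qed

lemma kernel_sym: "p \<in> I \<Longrightarrow> q \<in> I \<Longrightarrow> C p q = C q p"
  by (simp add: kernel_expansion mult.commute)

lemma integral_eigen_power: "k \<in> I \<Longrightarrow> (\<integral>w. trig_power I (e k) w \<partial>torus_law) = 1"
  using orthonormal[of k k] by (simp add: integral_trig_power fin ip_def power2_eq_square)

lemma integral_symbol_eigen_power:
  assumes "k \<in> I"
  shows "(\<integral>w. g w * trig_power I (e k) w \<partial>torus_law) = l k"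
proof -
  have "complex_of_real (\<integral>w. g w * trig_power I (e k) w \<partial>torus_law) =
     (\<Sum>p\<in>I. \<Sum>q\<in>I. e k p * e k q * (\<integral>w. g w * wave (q - p) w \<partial>torus_law))"
    using of_real_integral_mult_trig_power[OF g_meas, of B I "e k"] g_bounds by simp
  also have "\<dots> = (\<Sum>p\<in>I. \<Sum>q\<in>I. complex_of_real (e k p * (C p q * e k q)))"
    by (intro sum.cong refl) (simp add: symbol[symmetric])
  also have "\<dots> = complex_of_real (\<Sum>p\<in>I. e k p * kernel_op I C (e k) p)"
    by (simp add: kernel_op_def sum_distrib_left)
  also have "(\<Sum>p\<in>I. e k p * kernel_op I C (e k) p) = l k * ip I (e k) (e k)"
    unfolding ip_def sum_distrib_left using assms by (intro sum.cong refl) (simp add: eigen)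
  finally show ?thesis using orthonormal[OF assms assms] of_real_eq_iff by (metis (full_types) mult_1_right)
qed

lemma eigenvalue_nonneg:
  assumes "k \<in> I"
  shows "0 \<le> l k"
  unfolding integral_symbol_eigen_power[OF assms, symmetric]
  using g_bounds trig_power_nonneg by (intro Bochner_Integration.integral_nonneg) simp

lemma sum_eigen_power: "(\<Sum>k\<in>I. trig_power I (e k) w) = card I"
proof -
  have "complex_of_real (\<Sum>k\<in>I. trig_power I (e k) w) =
      (\<Sum>k\<in>I. \<Sum>p\<in>I. \<Sum>q\<in>I. e k p * e k q * wave (q - p) w)"
    by (simp add: of_real_trig_power)
  also have "\<dots> = (\<Sum>p\<in>I. \<Sum>k\<in>I. \<Sum>q\<in>I. e k p * e k q * wave (q - p) w)"
    by (rule sum.swap)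
  also have "\<dots> = (\<Sum>p\<in>I. \<Sum>q\<in>I. \<Sum>k\<in>I. e k p * e k q * wave (q - p) w)"
    by (intro sum.cong refl sum.swap)
  also have "\<dots> = (\<Sum>p\<in>I. \<Sum>q\<in>I. complex_of_real (\<Sum>k\<in>I. e k p * e k q) * wave (q - p) w)"
    by (simp add: sum_distrib_right)
  also have "\<dots> = (\<Sum>p\<in>I. \<Sum>q\<in>I. if p = q then 1 else 0)"
    by (intro sum.cong refl) (simp add: complete)
  also have "\<dots> = complex_of_real (card I)" using fin by simp
  finally show ?thesis using of_real_eq_iff by blast
qed

lemma sum_eigenvalue_power:
  "(\<Sum>k\<in>I. l k * trig_power I (e k) w) = (\<integral>s. g s * fejer I (s - w) \<partial>torus_law)"
proof -
  have int: "integrable torus_law (\<lambda>s. complex_of_real (g s) * wave r s)" for r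
    using g_bounds by (intro integrable_torus_law[where B = B]) (simp_all add: norm_mult)
  have "complex_of_real (\<Sum>k\<in>I. l k * trig_power I (e k) w) =
      (\<Sum>k\<in>I. \<Sum>p\<in>I. \<Sum>q\<in>I. l k * (e k p * e k q) * wave (q - p) w)"
    by (simp add: of_real_trig_power sum_distrib_left mult.assoc)
  also have "\<dots> = (\<Sum>p\<in>I. \<Sum>k\<in>I. \<Sum>q\<in>I. l k * (e k p * e k q) * wave (q - p) w)"
    by (rule sum.swap)
  also have "\<dots> = (\<Sum>p\<in>I. \<Sum>q\<in>I. \<Sum>k\<in>I. l k * (e k p * e k q) * wave (q - p) w)"
    by (intro sum.cong refl sum.swap)
  also have "\<dots> = (\<Sum>p\<in>I. \<Sum>q\<in>I. C p q * wave (q - p) w)"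
    by (simp add: sum_distrib_right kernel_expansion)
  also have "\<dots> = (\<Sum>q\<in>I. \<Sum>p\<in>I. C p q * wave (q - p) w)" by (rule sum.swap)
  \<comment> \<open>The spectral expansion yields \<open>wave (q - p)\<close> at \<open>w\<close>,
    whereas the kernel at \<open>s - w\<close> calls for its conjugate; symmetry of \<open>C\<close>
    exchanges the two.\<close>
  also have "\<dots> = (\<Sum>p\<in>I. \<Sum>q\<in>I. C p q * wave (p - q) w)"
    by (intro sum.cong refl) (simp add: kernel_sym)
  also have "\<dots> = (\<Sum>p\<in>I. \<Sum>q\<in>I. (\<integral>s. g s * wave (q - p) s \<partial>torus_law) * cnj (wave (q - p) w))"
    by (intro sum.cong refl) (simp add: symbol cnj_wave)
  also have "\<dots> = (\<Sum>p\<in>I. \<Sum>q\<in>I. (\<integral>s. g s * wave (q - p) s * cnj (wave (q - p) w) \<partial>torus_law))"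
    by simp
  also have "\<dots> = (\<integral>s. (\<Sum>p\<in>I. \<Sum>q\<in>I. g s * wave (q - p) s * cnj (wave (q - p) w)) \<partial>torus_law)"
    using int by (simp add: Bochner_Integration.integral_sum Bochner_Integration.integrable_sum)
  also have "\<dots> = (\<integral>s. complex_of_real (g s * fejer I (s - w)) \<partial>torus_law)"
    by (simp add: of_real_fejer_shift sum_distrib_left wave_diff_right mult.assoc)
  finally show ?thesis unfolding integral_complex_of_real of_real_eq_iff .
qed

text \<open>The assumed bound is a trigonometric polynomial in \<open>s - w\<close>, so its mean
  against the Fejer kernel is exact: the constant gives \<open>card I\<close>, the remainder the
  boundary defect. The result is therefore uniform in \<open>w\<close>.\<close>

lemma fejer_mean_deviation:
  assumes modulus: "\<And>s w. \<bar>g s - g w\<bar> \<le> \<epsilon> + c * (2 - Re (wave (1, 0) (s - w)) - Re (wave (0, 1) (s - w)))"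
  shows "\<bar>(\<Sum>k\<in>I. (l k - g w) * trig_power I (e k) w)\<bar> \<le>
    \<epsilon> * real (card I) + c * boundary_defect I"
proof -
  have int: "integrable torus_law (\<lambda>s. fejer I (s - w) * h s)"
    if "h \<in> borel_measurable borel" "\<And>s. \<bar>h s\<bar> \<le> A" for h :: "real \<times> real \<Rightarrow> real" and A
    using integrable_mult_fejer_shift[of h A I w] that by simp
  have g_abs: "\<bar>g s\<bar> \<le> B" for s using g_bounds[of s] by simp
  have Re_le: "\<bar>Re (wave h s)\<bar> \<le> 1" for h s
    using abs_Re_le_cmod[of "wave h s"] by simp
  note i1 = int[of "\<lambda>_. 1" 1, simplified] and ig = int[OF g_meas g_abs]
    and iw = int[of "\<lambda>s. Re (wave h (s - w))" 1 for h, OF _ Re_le, simplified]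
  have "(\<Sum>k\<in>I. (l k - g w) * trig_power I (e k) w) =
      (\<integral>s. g s * fejer I (s - w) \<partial>torus_law) - g w * (\<integral>s. fejer I (s - w) \<partial>torus_law)"
    by (simp add: left_diff_distrib sum_subtractf sum_eigenvalue_power sum_eigen_power
        integral_fejer_shift fin flip: sum_distrib_left)
  also have "\<dots> = (\<integral>s. g s * fejer I (s - w) - g w * fejer I (s - w) \<partial>torus_law)"
    using i1 ig by (simp add: mult.commute)
  also have "\<dots> = (\<integral>s. fejer I (s - w) * (g s - g w) \<partial>torus_law)"
    by (simp add: algebra_simps)
  also have "\<bar>\<dots>\<bar> \<le> (\<integral>s. \<bar>fejer I (s - w) * (g s - g w)\<bar> \<partial>torus_law)"
    by (rule integral_abs_bound)
  also have "\<dots> \<le> (\<integral>s. \<epsilon> * fejer I (s - w) + c * (2 * fejer I (s - w) -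
      fejer I (s - w) * Re (wave (1, 0) (s - w)) - fejer I (s - w) * Re (wave (0, 1) (s - w))) \<partial>torus_law)"
  proof (rule integral_mono)
    show "integrable torus_law (\<lambda>s. \<bar>fejer I (s - w) * (g s - g w)\<bar>)"
      using i1 ig by (simp add: right_diff_distrib)
    fix s
    have "\<bar>fejer I (s - w) * (g s - g w)\<bar> = fejer I (s - w) * \<bar>g s - g w\<bar>"
      by (simp add: abs_mult trig_power_nonneg)
    also have "\<dots> \<le> fejer I (s - w) * (\<epsilon> + c * (2 - Re (wave (1, 0) (s - w)) - Re (wave (0, 1) (s - w))))"
      by (intro mult_left_mono modulus trig_power_nonneg)
    finally show "\<bar>fejer I (s - w) * (g s - g w)\<bar> \<le> \<epsilon> * fejer I (s - w) + c * (2 * fejer I (s - w) -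
      fejer I (s - w) * Re (wave (1, 0) (s - w)) - fejer I (s - w) * Re (wave (0, 1) (s - w)))"
      by (simp add: algebra_simps)
  qed (use i1 iw in auto)
  also have "\<dots> = \<epsilon> * real (card I) + c * boundary_defect I"
    using i1 iw by (simp add: integral_fejer_shift integral_wave_fejer_shift fin boundary_defect_def)
  finally show ?thesis .
qed

text \<open>The Berezin--Lieb inequalities: convexity of \<open>F\<close> and the fact that the functions
  \<open>trig_power I (e k)\<close> are probability densities for fixed \<open>k\<close> and weights of total mass
  \<open>card I\<close> for fixed \<open>w\<close> give the upper and the lower bound, respectively.\<close>

theorem szego_bound:
  assumes F: "tangent_bounded L F" and Fg_meas [measurable]: "(\<lambda>w. F (g w)) \<in> borel_measurable borel"
    and Fg: "\<And>w. \<bar>F (g w)\<bar> \<le> A"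
    and modulus: "\<And>s w. \<bar>g s - g w\<bar> \<le> \<epsilon> + c * (2 - Re (wave (1, 0) (s - w)) - Re (wave (0, 1) (s - w)))"
  shows "\<bar>(\<Sum>k\<in>I. F (l k)) - real (card I) * (\<integral>w. F (g w) \<partial>torus_law)\<bar> \<le>
    L * (\<epsilon> * real (card I) + c * boundary_defect I)"
proof -
  let ?S = "\<Sum>k\<in>I. F (l k)" and ?R = "real (card I) * (\<integral>w. F (g w) \<partial>torus_law)"
    and ?\<delta> = "\<epsilon> * real (card I) + c * boundary_defect I"
  interpret prob_space torus_law by (rule prob_space_torus_law)
  have g_abs: "\<bar>g s\<bar> \<le> B" for s using g_bounds[of s] by simp
  have ip1: "integrable torus_law (trig_power I (e k))" for k
    using integrable_mult_trig_power[of "\<lambda>_. 1" 1 I "e k"] by simp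
  note ig = integrable_mult_trig_power[OF g_meas g_abs]
  note iF = integrable_mult_trig_power[OF Fg_meas Fg]
  have L0: "0 \<le> L" using F[unfolded tangent_bounded_def, rule_format, of 0] by force
  have Fl: "F (l k) \<le> (\<integral>w. F (g w) * trig_power I (e k) w \<partial>torus_law)" if k: "k \<in> I" for k
  proof -
    \<comment> \<open>Jensen: the tangent is drawn at the eigenvalue, which is the mean of
      \<open>g\<close> under the density of its eigenvector, so the linear term integrates to
      zero.\<close>
    obtain d where d: "\<And>x. 0 \<le> x \<Longrightarrow> F (l k) + d * (x - l k) \<le> F x"
      using F eigenvalue_nonneg[OF k] unfolding tangent_bounded_def by blast
    have "F (l k) = (\<integral>w. (F (l k) - d * l k) * trig_power I (e k) w + d * (g w * trig_power I (e k) w) \<partial>torus_law)"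
      using ip1 ig k by (simp add: integral_eigen_power integral_symbol_eigen_power)
    also have "\<dots> \<le> (\<integral>w. F (g w) * trig_power I (e k) w \<partial>torus_law)"
    proof (rule integral_mono)
      fix w
      show "(F (l k) - d * l k) * trig_power I (e k) w + d * (g w * trig_power I (e k) w) \<le> F (g w) * trig_power I (e k) w"
        using mult_right_mono[OF d[OF g_bounds(1)[of w]] trig_power_nonneg[of I "e k" w]]
        by (simp add: algebra_simps)
    qed (use ip1 ig iF in auto)
    finally show ?thesis .
  qed
  have "?S \<le> (\<Sum>k\<in>I. \<integral>w. F (g w) * trig_power I (e k) w \<partial>torus_law)" by (intro sum_mono Fl)
  also have "\<dots> = (\<integral>w. F (g w) * (\<Sum>k\<in>I. trig_power I (e k) w) \<partial>torus_law)"
    using iF by (simp add: sum_distrib_left)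
  also have "\<dots> = ?R" by (simp add: sum_eigen_power)
  finally have upper: "?S \<le> ?R" .
  have "?R - L * ?\<delta> = (\<integral>w. real (card I) * F (g w) - L * ?\<delta> \<partial>torus_law)"
    using integrable_torus_law[OF Fg_meas, of A] Fg prob_space by simp
  also have "\<dots> \<le> (\<integral>w. (\<Sum>k\<in>I. F (l k) * trig_power I (e k) w) \<partial>torus_law)"
  proof (rule integral_mono)
    show "integrable torus_law (\<lambda>w. real (card I) * F (g w) - L * ?\<delta>)"
      using integrable_torus_law[OF Fg_meas, of A] Fg by simp
    show "integrable torus_law (\<lambda>w. \<Sum>k\<in>I. F (l k) * trig_power I (e k) w)"
      using ip1 by simp
    fix w
    \<comment> \<open>Now the tangent is drawn at \<open>g w\<close>. Its slope is common to all
      \<open>k\<close>, so the linear terms add up to the deviation of the Fejer mean at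
      \<open>w\<close>.\<close>
    obtain d where d: "\<bar>d\<bar> \<le> L" "\<And>x. 0 \<le> x \<Longrightarrow> F (g w) + d * (x - g w) \<le> F x"
      using F g_bounds(1) unfolding tangent_bounded_def by blast
    have "- (L * ?\<delta>) \<le> d * (\<Sum>k\<in>I. (l k - g w) * trig_power I (e k) w)"
    proof -
      have "\<bar>d * (\<Sum>k\<in>I. (l k - g w) * trig_power I (e k) w)\<bar> \<le> L * ?\<delta>"
        unfolding abs_mult using d(1) L0 by (intro mult_mono fejer_mean_deviation modulus) auto
      then show ?thesis by linarith
    qed
    then have "real (card I) * F (g w) - L * ?\<delta> \<le> F (g w) * (\<Sum>k\<in>I. trig_power I (e k) w) +
        d * (\<Sum>k\<in>I. (l k - g w) * trig_power I (e k) w)"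
      unfolding sum_eigen_power by (simp add: mult.commute)
    also have "\<dots> = (\<Sum>k\<in>I. (F (g w) + d * (l k - g w)) * trig_power I (e k) w)"
      by (simp add: sum_distrib_left sum.distrib distrib_right mult.assoc)
    also have "\<dots> \<le> (\<Sum>k\<in>I. F (l k) * trig_power I (e k) w)"
      by (intro sum_mono mult_right_mono d trig_power_nonneg eigenvalue_nonneg)
    finally show "real (card I) * F (g w) - L * ?\<delta> \<le> (\<Sum>k\<in>I. F (l k) * trig_power I (e k) w)" .
  qed
  also have "\<dots> = ?S" using ip1 by (simp add: integral_eigen_power)
  \<comment> \<open>The sign of \<open>L * ?\<delta>\<close> is read off from the two bounds
    themselves: the sum lies between \<open>?R - L * ?\<delta>\<close> and
    \<open>?R\<close>.\<close>
  finally show ?thesis using upper L0 by (auto simp: abs_le_iff)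
qed

end

section \<open>The two convex pieces of the divergence\<close>

lemma tangent_bounded_neg_ln:
  assumes b: "0 < b"
  shows "tangent_bounded (1 / (2 * b)) (\<lambda>x. - 1/2 * ln ((b + x) / b))"
  unfolding tangent_bounded_def
proof (intro allI impI exI conjI)
  fix a x :: real assume a: "0 \<le> a"
  \<comment> \<open>This goal also fixes the slope left open by \<open>exI\<close>: the derivative
    at \<open>a\<close>, largest in modulus at \<open>a = 0\<close>.\<close>
  show "\<bar>- 1 / (2 * (b + a))\<bar> \<le> 1 / (2 * b)" using a b by (simp add: field_simps)
  assume x: "0 \<le> x"
  define r where "r = (x - a) / (b + a)"
  have "ln ((b + x) / (b + a)) \<le> (b + x) / (b + a) - 1"
    using a b x by (intro ln_le_minus_one) simp
  also have "(b + x) / (b + a) - 1 = r" using a b by (simp add: r_def field_simps)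
  finally have ln_le: "ln (b + x) \<le> ln (b + a) + r"
    using a b x by (simp add: ln_div)
  have "- 1 / (2 * (b + a)) * (x - a) = - r / 2"
    using a b by (simp add: r_def field_simps)
  moreover have "ln ((b + x) / b) = ln (b + x) - ln b" "ln ((b + a) / b) = ln (b + a) - ln b"
    using a b x by (simp_all add: ln_div)
  ultimately show "- 1/2 * ln ((b + a) / b) + - 1 / (2 * (b + a)) * (x - a) \<le> - 1/2 * ln ((b + x) / b)"
    using ln_le by (simp only: diff_divide_distrib) (simp add: field_simps)
qed

lemma tangent_bounded_inverse:
  assumes b: "0 < b"
  shows "tangent_bounded (1 / (2 * b)) (\<lambda>x. 1/2 * (b / (b + x)))"
  unfolding tangent_bounded_def
proof (intro allI impI exI conjI)
  fix a x :: real assume a: "0 \<le> a"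
  have "b * b \<le> (b + a)\<^sup>2" unfolding power2_eq_square using a b by (intro mult_mono) auto
  then show "\<bar>- b / (2 * (b + a)\<^sup>2)\<bar> \<le> 1 / (2 * b)" using a b by (simp add: field_simps)
  assume x: "0 \<le> x"
  \<comment> \<open>The gap between the hyperbola and its tangent is an explicit nonnegative
    quotient.\<close>
  have "1 / (b + x) - (1 / (b + a) - (x - a) / (b + a)\<^sup>2) = (x - a)\<^sup>2 / ((b + x) * (b + a)\<^sup>2)"
    using a b x by (simp add: divide_simps) (simp add: power2_eq_square algebra_simps)
  also have "\<dots> \<ge> 0" using a b x by simp
  finally have "1 / (b + a) - (x - a) / (b + a)\<^sup>2 \<le> 1 / (b + x)" by simp
  from mult_left_mono[OF this, of "b / 2"]
  show "1/2 * (b / (b + a)) + - b / (2 * (b + a)\<^sup>2) * (x - a) \<le> 1/2 * (b / (b + x))"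
    using b by (simp add: algebra_simps)
qed

section \<open>Size and boundary of the observation square\<close>

lemma finite_site_square [simp]: "finite (site_square m)"
  by (simp add: site_square_def)

lemma card_site_square: "card (site_square m) = (2 * m + 1)\<^sup>2"
proof -
  have "nat (2 * int m + 1) = 2 * m + 1" by simp
  then show ?thesis by (simp add: site_square_def power2_eq_square)
qed

text \<open>In each direction a single side of \<open>2 * m + 1\<close> sites loses its predecessor,
  so the boundary is of the order of the square root of the number of sites.\<close>

lemma boundary_defect_site_square: "boundary_defect (site_square m) = 2 * (2 * real m + 1)"
proof -
  have *: "nat (1 + 2 * int m) = 2 * m + 1" by simp
  have "{p \<in> site_square m. p - (1, 0) \<in> site_square m} = {- int m + 1..int m} \<times> {- int m..int m}"
    "{p \<in> site_square m. p - (0, 1) \<in> site_square m} = {- int m..int m} \<times> {- int m + 1..int m}"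
    by (auto simp: site_square_def)
  then show ?thesis
    unfolding boundary_defect_def card_site_square by (simp add: * power2_eq_square algebra_simps)
qed

subsection \<open>The symbol of the autoregression\<close>

lemma car_symbol_wave: "car_symbol \<theta> w = (\<Sum>p | \<theta> p \<noteq> 0. \<theta> p * cnj (wave p w))"
  by (simp add: car_symbol_def wave_def exp_cnj)

lemma car_spectral_density_eq: "4 * pi\<^sup>2 * car_spectral_density \<theta> w = Re (1 / car_symbol \<theta> w)"
proof -
  have Re_mult: "Re (complex_of_real c * z) = c * Re z" for c z by simp
  have "car_spectral_density \<theta> w = Re (complex_of_real (1 / (4 * pi\<^sup>2)) * (1 / car_symbol \<theta> w))"
    by (simp add: car_spectral_density_def)
  also have "\<dots> = 1 / (4 * pi\<^sup>2) * Re (1 / car_symbol \<theta> w)"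
    by (rule Re_mult)
  finally show ?thesis by simp
qed

lemma wave_periodic:
  "wave p (x + 2 * pi * of_int j, y + 2 * pi * of_int k) = wave p (x, y)"
  unfolding wave_def exp_eq
  by (rule exI[of _ "fst p * j + snd p * k"]) (simp add: freq_pairing_def algebra_simps)

lemma reduce_mod_2pi: "\<exists>k::int. x + 2 * pi * of_int k \<in> {-pi<..pi}"
proof -
  \<comment> \<open>The ceiling rather than the floor, because the target interval is open at
    \<open>-pi\<close> and closed at \<open>pi\<close>.\<close>
  define k where "k = \<lceil>(x - pi) / (2 * pi)\<rceil>"
  have "of_int k - 1 < (x - pi) / (2 * pi)" "(x - pi) / (2 * pi) \<le> of_int k"
    unfolding k_def by linarith+
  then have "x + 2 * pi * of_int (- k) \<in> {-pi<..pi}"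
    by (simp add: field_simps)
  then show ?thesis by blast
qed

text \<open>The assumptions on the symbol concern one half-open period square, while Fejer means
  involve shifted frequencies; periodicity bridges the two.\<close>

lemma wave_representative:
  obtains v where "v \<in> {-pi<..pi} \<times> {-pi<..pi}" "\<And>p. wave p v = wave p w"
proof -
  obtain x y where w: "w = (x, y)" by (cases w)
  obtain j k :: int where "x + 2 * pi * of_int j \<in> {-pi<..pi}" "y + 2 * pi * of_int k \<in> {-pi<..pi}"
    using reduce_mod_2pi[of x] reduce_mod_2pi[of y] by blast
  then show ?thesis
    by (intro that[of "(x + 2 * pi * of_int j, y + 2 * pi * of_int k)"]) (simp_all only: w wave_periodic mem_Sigma_iff simp_thms)
qed

lemma norm_iexp_mult_int_diff_1:
  "cmod (iexp (of_int k * x) - 1) \<le> \<bar>of_int k\<bar> * cmod (iexp x - 1)"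
proof -
  have nat: "cmod (iexp (real n * x) - 1) \<le> real n * cmod (iexp x - 1)" for n
  proof -
    have "iexp (real n * x) = iexp x ^ n"
      by (simp add: exp_of_nat_mult[symmetric] mult_ac)
    then show ?thesis using norm_power_diff[of "iexp x" 1 n] by simp
  qed
  show ?thesis
  proof (cases "0 \<le> k")
    case True
    then show ?thesis using nat[of "nat k"] by simp
  next
    case False
    have "iexp (of_int k * x) - 1 = cnj (iexp (real (nat (- k)) * x) - 1)"
      using False by (simp add: exp_cnj)
    then have "cmod (iexp (of_int k * x) - 1) = cmod (iexp (real (nat (- k)) * x) - 1)"
      by (simp only: complex_mod_cnj)
    then show ?thesis using nat[of "nat (- k)"] False by simp
  qed
qed

lemma norm_wave_diff_1:
  "cmod (wave p u - 1) \<le> real_of_int (\<bar>fst p\<bar> + \<bar>snd p\<bar>) * (cmod (wave (1, 0) u - 1) + cmod (wave (0, 1) u - 1))"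
proof -
  let ?a = "iexp (of_int (fst p) * fst u)" and ?b = "iexp (of_int (snd p) * snd u)"
  have "wave p u - 1 = ?a * (?b - 1) + (?a - 1)"
    by (simp add: wave_def freq_pairing_def exp_add distrib_left algebra_simps)
  then have "cmod (wave p u - 1) \<le> cmod (?a * (?b - 1)) + cmod (?a - 1)"
    by (metis norm_triangle_ineq)
  also have "\<dots> = cmod (?b - 1) + cmod (?a - 1)" by (simp add: norm_mult)
  also have "\<dots> \<le> \<bar>of_int (snd p)\<bar> * cmod (iexp (snd u) - 1) + \<bar>of_int (fst p)\<bar> * cmod (iexp (fst u) - 1)"
    by (intro add_mono norm_iexp_mult_int_diff_1)
  also have "\<dots> \<le> real_of_int (\<bar>fst p\<bar> + \<bar>snd p\<bar>) * cmod (iexp (snd u) - 1) +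
      real_of_int (\<bar>fst p\<bar> + \<bar>snd p\<bar>) * cmod (iexp (fst u) - 1)"
    by (intro add_mono mult_right_mono) simp_all
  finally show ?thesis by (simp add: wave_def freq_pairing_def distrib_left)
qed

text \<open>AM-GM, applied to \<open>(cmod (wave h u - 1))\<^sup>2 = 2 - 2 * Re (wave h u)\<close>.\<close>

lemma norm_wave_diff_1_le:
  assumes "0 < \<eta>"
  shows "cmod (wave h u - 1) \<le> \<eta> + (1 - Re (wave h u)) / (2 * \<eta>)"
proof -
  let ?y = "cmod (wave h u - 1)" and ?z = "wave h u"
  have "(Re ?z)\<^sup>2 + (Im ?z)\<^sup>2 = 1" using cmod_power2[of ?z] by simp
  then have y2: "?y\<^sup>2 = 2 - 2 * Re ?z" unfolding cmod_power2 by (simp add: power2_eq_square algebra_simps)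
  have "0 \<le> (?y - 2 * \<eta>)\<^sup>2" by simp
  then have "4 * \<eta> * ?y \<le> 4 * \<eta>\<^sup>2 + ?y\<^sup>2" by (simp add: power2_eq_square algebra_simps)
  then show ?thesis unfolding y2 using assms by (simp add: field_simps power2_eq_square)
qed

locale car_symbol_positive =
  fixes \<theta> :: "site \<Rightarrow> real"
  assumes finite_support: "finite {p. \<theta> p \<noteq> 0}"
    and symbol_nonzero: "\<And>w. w \<in> {-pi<..pi} \<times> {-pi<..pi} \<Longrightarrow> car_symbol \<theta> w \<noteq> 0"
    and density_pos: "\<And>w. w \<in> {-pi<..pi} \<times> {-pi<..pi} \<Longrightarrow> car_spectral_density \<theta> w > 0"
begin

text \<open>The factor makes \<open>symbol\<close> the reciprocal of the trigonometric polynomial,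
  and the covariances its Fourier coefficients with respect to \<open>torus_law\<close>.\<close>

definition symbol :: "real \<times> real \<Rightarrow> real" where
  "symbol w = 4 * pi\<^sup>2 * car_spectral_density \<theta> w"

lemma symbol_eq: "symbol w = Re (1 / car_symbol \<theta> w)"
  by (simp only: symbol_def car_spectral_density_eq)

lemma continuous_car_symbol: "continuous_on A (car_symbol \<theta>)"
  unfolding car_symbol_wave[abs_def] by (intro continuous_intros)

lemma car_symbol_representative:
  obtains v where "v \<in> {-pi<..pi} \<times> {-pi<..pi}" "car_symbol \<theta> v = car_symbol \<theta> w"
proof -
  obtain v where v: "v \<in> {-pi<..pi} \<times> {-pi<..pi}" "\<And>p. wave p v = wave p w"
    using wave_representative[of w] by blast
  show ?thesis by (rule that[OF v(1)]) (simp add: car_symbol_wave v(2))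
qed

lemma car_symbol_nonzero: "car_symbol \<theta> w \<noteq> 0"
proof -
  obtain v where v: "v \<in> {-pi<..pi} \<times> {-pi<..pi}" "car_symbol \<theta> v = car_symbol \<theta> w"
    by (rule car_symbol_representative)
  show ?thesis using symbol_nonzero[OF v(1)] v(2) by simp
qed

lemma symbol_pos: "0 < symbol w"
proof -
  obtain v where v: "v \<in> {-pi<..pi} \<times> {-pi<..pi}" "car_symbol \<theta> v = car_symbol \<theta> w"
    by (rule car_symbol_representative)
  have "0 < symbol v" using density_pos[OF v(1)] by (simp add: symbol_def)
  then show ?thesis by (simp add: symbol_eq v)
qed

lemma continuous_symbol: "continuous_on A symbol"
  unfolding symbol_eq[abs_def] using car_symbol_nonzero
  by (intro continuous_intros continuous_car_symbol) simp

lemma symbol_measurable [measurable]: "symbol \<in> borel_measurable borel"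
  by (intro borel_measurable_continuous_onI continuous_symbol)

text \<open>The minimum is attained on the closed square, which is compact, and periodicity extends
  it to all frequencies.\<close>

lemma car_symbol_lower_bound:
  obtains b where "0 < b" "\<And>w. b \<le> cmod (car_symbol \<theta> w)"
proof -
  have "compact freq_square" by (intro compact_Times) simp_all
  moreover have "(0, 0) \<in> freq_square" by simp
  moreover have "continuous_on freq_square (\<lambda>w. cmod (car_symbol \<theta> w))"
    by (intro continuous_intros continuous_car_symbol)
  ultimately obtain u where u: "\<And>v. v \<in> freq_square \<Longrightarrow> cmod (car_symbol \<theta> u) \<le> cmod (car_symbol \<theta> v)"
    using continuous_attains_inf[of freq_square "\<lambda>w. cmod (car_symbol \<theta> w)"] by blast
  show ?thesis
  proof
    show "0 < cmod (car_symbol \<theta> u)" using car_symbol_nonzero by simp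
    fix w
    obtain v where v: "v \<in> {-pi<..pi} \<times> {-pi<..pi}" "car_symbol \<theta> v = car_symbol \<theta> w"
      by (rule car_symbol_representative)
    then have "v \<in> freq_square" by (auto simp: mem_Times_iff)
    then show "cmod (car_symbol \<theta> u) \<le> cmod (car_symbol \<theta> w)" using u[of v] v(2) by simp
  qed
qed

lemma symbol_bounded:
  obtains B where "\<And>w. symbol w \<le> B"
proof -
  obtain b where b: "0 < b" "\<And>w. b \<le> cmod (car_symbol \<theta> w)" by (rule car_symbol_lower_bound) blast
  show ?thesis
  proof
    fix w
    have "symbol w \<le> cmod (1 / car_symbol \<theta> w)" unfolding symbol_eq by (rule complex_Re_le_cmod)
    also have "\<dots> \<le> 1 / b" using b by (simp add: norm_divide frac_le)
    finally show "symbol w \<le> 1 / b" .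
  qed
qed

text \<open>The symbol is Lipschitz in the two basic waves with constant \<open>A\<close>: its
  denominator is a trigonometric polynomial bounded away from zero. AM-GM then trades each distance
  \<open>cmod (wave h u - 1)\<close> for a small constant plus a multiple of
  \<open>1 - Re (wave h u)\<close>, the form whose Fejer mean is explicit.\<close>

lemma symbol_modulus:
  assumes "0 < \<epsilon>"
  obtains c where "\<And>s w. \<bar>symbol s - symbol w\<bar> \<le>
    \<epsilon> + c * (2 - Re (wave (1, 0) (s - w)) - Re (wave (0, 1) (s - w)))"
proof -
  obtain b where b: "0 < b" "\<And>w. b \<le> cmod (car_symbol \<theta> w)" by (rule car_symbol_lower_bound) blast
  define A where "A = (\<Sum>p | \<theta> p \<noteq> 0. \<bar>\<theta> p\<bar> * real_of_int (\<bar>fst p\<bar> + \<bar>snd p\<bar>)) / b\<^sup>2"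
  have A: "0 \<le> A" unfolding A_def by (intro divide_nonneg_nonneg sum_nonneg) auto
  \<comment> \<open>Two waves each contribute \<open>A * \<eta>\<close>, and together they must stay
    below \<open>\<epsilon>\<close>; the summand 2 keeps the denominator positive when
    \<open>A = 0\<close>.\<close>
  define \<eta> where "\<eta> = \<epsilon> / (2 * A + 2)"
  have \<eta>: "0 < \<eta>" "A * (2 * \<eta>) \<le> \<epsilon>" using A assms by (simp_all add: \<eta>_def field_simps)
  show ?thesis
  proof
    fix s w :: "real \<times> real"
    define Y where "Y = cmod (wave (1, 0) (s - w) - 1) + cmod (wave (0, 1) (s - w) - 1)"
    have wave: "cmod (wave p s - wave p w) \<le> real_of_int (\<bar>fst p\<bar> + \<bar>snd p\<bar>) * Y" for p
    proof -
      have "cnj (wave p w) * wave p w = 1"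
        using complex_norm_square[of "wave p w"] by (simp add: mult.commute)
      then have "wave p s - wave p w = (wave p (s - w) - 1) * wave p w"
        by (simp add: wave_diff_right left_diff_distrib mult.assoc)
      then have "cmod (wave p s - wave p w) = cmod (wave p (s - w) - 1)" by (simp add: norm_mult)
      then show ?thesis using norm_wave_diff_1 by (simp add: Y_def)
    qed
    have "car_symbol \<theta> w - car_symbol \<theta> s = (\<Sum>p | \<theta> p \<noteq> 0. \<theta> p * cnj (wave p w - wave p s))"
      by (simp add: car_symbol_wave right_diff_distrib sum_subtractf)
    also have "cmod \<dots> \<le> (\<Sum>p | \<theta> p \<noteq> 0. \<bar>\<theta> p\<bar> * (real_of_int (\<bar>fst p\<bar> + \<bar>snd p\<bar>) * Y))"
    proof (intro order_trans[OF norm_sum] sum_mono)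
      fix p
      have "cmod (\<theta> p * cnj (wave p w - wave p s)) = \<bar>\<theta> p\<bar> * cmod (wave p s - wave p w)"
        unfolding norm_mult complex_mod_cnj by (simp add: norm_minus_commute)
      also have "\<dots> \<le> \<bar>\<theta> p\<bar> * (real_of_int (\<bar>fst p\<bar> + \<bar>snd p\<bar>) * Y)"
        by (intro mult_left_mono wave) simp
      finally show "cmod (\<theta> p * cnj (wave p w - wave p s)) \<le> \<bar>\<theta> p\<bar> * (real_of_int (\<bar>fst p\<bar> + \<bar>snd p\<bar>) * Y)" .
    qed
    also have "\<dots> = b\<^sup>2 * (A * Y)"
      using b(1) by (simp add: A_def sum_distrib_right mult.assoc)
    finally have diff: "cmod (car_symbol \<theta> w - car_symbol \<theta> s) \<le> b\<^sup>2 * (A * Y)" .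
    have "symbol s - symbol w = Re (1 / car_symbol \<theta> s - 1 / car_symbol \<theta> w)"
      unfolding symbol_eq by (rule minus_complex.simps(1)[symmetric])
    also have "\<bar>\<dots>\<bar> \<le> cmod (1 / car_symbol \<theta> s - 1 / car_symbol \<theta> w)" by (rule abs_Re_le_cmod)
    also have "1 / car_symbol \<theta> s - 1 / car_symbol \<theta> w =
        (car_symbol \<theta> w - car_symbol \<theta> s) / (car_symbol \<theta> s * car_symbol \<theta> w)"
      using car_symbol_nonzero by (simp add: field_simps)
    also have "cmod \<dots> \<le> b\<^sup>2 * (A * Y) / b\<^sup>2"
      unfolding norm_divide norm_mult
    proof (rule frac_le[OF _ diff])
      show "b\<^sup>2 \<le> cmod (car_symbol \<theta> s) * cmod (car_symbol \<theta> w)"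
        unfolding power2_eq_square using b(1) by (intro mult_mono b(2)) auto
      show "0 \<le> b\<^sup>2 * (A * Y)" using diff norm_ge_zero order_trans by blast
    qed (use b(1) in simp)
    also have "\<dots> = A * Y" using b(1) by simp
    also have "\<dots> \<le> A * ((\<eta> + (1 - Re (wave (1, 0) (s - w))) / (2 * \<eta>)) + (\<eta> + (1 - Re (wave (0, 1) (s - w))) / (2 * \<eta>)))"
      unfolding Y_def by (intro mult_left_mono add_mono norm_wave_diff_1_le \<eta> A)
    also have "\<dots> = A * (2 * \<eta>) + A / (2 * \<eta>) * (2 - Re (wave (1, 0) (s - w)) - Re (wave (0, 1) (s - w)))"
      using \<eta>(1) by (simp add: field_simps)
    also have "\<dots> \<le> \<epsilon> + A / (2 * \<eta>) * (2 - Re (wave (1, 0) (s - w)) - Re (wave (0, 1) (s - w)))"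
      using \<eta>(2) by simp
    finally show "\<bar>symbol s - symbol w\<bar> \<le>
      \<epsilon> + A / (2 * \<eta>) * (2 - Re (wave (1, 0) (s - w)) - Re (wave (0, 1) (s - w)))" .
  qed
qed

end

section \<open>Characteristic functions of signal and noise\<close>

lemma gaussian_field_char:
  assumes M: "prob_space M" and G: "gaussian_field M X" and Z: "zero_mean M X" and S: "stationary M X"
    and fin: "finite I"
  shows "(\<integral>\<omega>. iexp (\<Sum>p\<in>I. a p * X p \<omega>) \<partial>M) =
    complex_of_real (exp (- (\<Sum>p\<in>I. \<Sum>q\<in>I. a p * a q * (\<integral>\<omega>. X p \<omega> * X q \<omega> \<partial>M)) / 2))"
proof -
  have [measurable]: "X p \<in> borel_measurable M" for p using G unfolding gaussian_field_def by blast
  define T where "T \<omega> = (\<Sum>p\<in>I. a p * X p \<omega>)" for \<omega>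
  have [measurable]: "T \<in> borel_measurable M" unfolding T_def[abs_def] by measurable
  \<comment> \<open>\<open>gaussian_field\<close> promises only some normal law, possibly
    degenerate; its parameters are recovered from the first two moments.\<close>
  obtain \<mu> s where s: "0 \<le> s" "distr M borel T = normal_law \<mu> s"
    using G fin unfolding gaussian_field_def T_def[abs_def] by blast
  have iX: "integrable M (X p)" "(\<integral>\<omega>. X p \<omega> \<partial>M) = 0" for p using Z unfolding zero_mean_def by blast+
  have iXX: "integrable M (\<lambda>\<omega>. X p \<omega> * X q \<omega>)" for p q using S unfolding stationary_def by blast
  have "\<mu> = (\<integral>x. x \<partial>distr M borel T)"
    using normal_law_moments(1)[OF s(1), of \<mu>] by (simp add: s(2) has_bochner_integral_iff)
  also have "\<dots> = (\<integral>\<omega>. T \<omega> \<partial>M)" by (simp add: integral_distr)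
  also have "\<dots> = 0" unfolding T_def using iX by (simp add: Bochner_Integration.integral_sum)
  finally have \<mu>: "\<mu> = 0" .
  have "s = (\<integral>x. x\<^sup>2 \<partial>distr M borel T)"
    using normal_law_moments(2)[OF s(1), of \<mu>] by (simp add: s(2) \<mu> has_bochner_integral_iff)
  also have "\<dots> = (\<integral>\<omega>. (T \<omega>)\<^sup>2 \<partial>M)" by (simp add: integral_distr)
  also have "\<dots> = (\<integral>\<omega>. (\<Sum>p\<in>I. \<Sum>q\<in>I. a p * a q * (X p \<omega> * X q \<omega>)) \<partial>M)"
    unfolding T_def power2_eq_square sum_product by (simp add: mult_ac)
  also have "\<dots> = (\<Sum>p\<in>I. \<Sum>q\<in>I. a p * a q * (\<integral>\<omega>. X p \<omega> * X q \<omega> \<partial>M))"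
    using iXX by (simp add: Bochner_Integration.integral_sum Bochner_Integration.integrable_sum)
  finally have s_eq: "s = (\<Sum>p\<in>I. \<Sum>q\<in>I. a p * a q * (\<integral>\<omega>. X p \<omega> * X q \<omega> \<partial>M))" .
  have "(\<integral>\<omega>. iexp (T \<omega>) \<partial>M) = (\<integral>x. iexp (1 * x) \<partial>distr M borel T)" by (simp add: integral_distr)
  also have "\<dots> = complex_of_real (exp (- s / 2))"
    unfolding s(2) \<mu> char_normal_law[OF s(1)] by simp
  finally show ?thesis by (simp add: s_eq T_def)
qed

lemma iid_normal_char:
  assumes M: "prob_space M" and W: "prob_space.indep_vars M (\<lambda>_. borel) W UNIV"
    and law: "\<And>p. distr M borel (W p) = normal_law 0 s" and s: "0 \<le> s" and I: "finite I" "I \<noteq> {}"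
  shows "(\<integral>\<omega>. iexp (\<Sum>p\<in>I. a p * W p \<omega>) \<partial>M) = complex_of_real (exp (- (s * (\<Sum>p\<in>I. (a p)\<^sup>2)) / 2))"
proof -
  interpret prob_space M by fact
  have W_meas [measurable]: "W p \<in> borel_measurable M" for p using W unfolding indep_vars_def by simp
  have "indep_vars (\<lambda>_. borel) W I" using W by (rule indep_vars_subset) simp
  then have "distr M (PiM I (\<lambda>_. borel)) (\<lambda>\<omega>. \<lambda>p\<in>I. W p \<omega>) = PiM I (\<lambda>p. normal_law 0 s)"
    using indep_vars_iff_distr_eq_PiM'[OF I(2), where M' = "\<lambda>_. borel" and X = W] by (simp add: law)
  moreover have "(\<integral>\<omega>. iexp (\<Sum>p\<in>I. a p * W p \<omega>) \<partial>M) =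
      (\<integral>x. iexp (\<Sum>p\<in>I. a p * x p) \<partial>distr M (PiM I (\<lambda>_. borel)) (\<lambda>\<omega>. \<lambda>p\<in>I. W p \<omega>))"
    by (subst integral_distr) simp_all
  ultimately show ?thesis
    using char_PiM_normal_law[OF I(1), of "\<lambda>_. s" a] s by (simp add: sum_distrib_left)
qed

subsection \<open>The log-likelihood ratio\<close>

lemma (in prob_space) indep_char_add:
  fixes X W :: "site \<Rightarrow> 'a \<Rightarrow> real"
  assumes indep: "indep_var (PiM UNIV (\<lambda>_. borel)) (\<lambda>\<omega> p. X p \<omega>) (PiM UNIV (\<lambda>_. borel)) (\<lambda>\<omega> p. W p \<omega>)"
  shows "(\<integral>\<omega>. iexp (\<Sum>p\<in>I. a p * (X p \<omega> + W p \<omega>)) \<partial>M) =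
    (\<integral>\<omega>. iexp (\<Sum>p\<in>I. a p * X p \<omega>) \<partial>M) * (\<integral>\<omega>. iexp (\<Sum>p\<in>I. a p * W p \<omega>) \<partial>M)"
proof -
  have m: "(\<lambda>x. iexp (\<Sum>p\<in>I. a p * x p)) \<in> measurable (PiM UNIV (\<lambda>_. borel)) borel"
    by measurable
  have ind: "indep_var borel (\<lambda>\<omega>. iexp (\<Sum>p\<in>I. a p * X p \<omega>)) borel (\<lambda>\<omega>. iexp (\<Sum>p\<in>I. a p * W p \<omega>))"
    using indep_var_compose[OF indep m m] by (simp add: comp_def)
  have int: "integrable M (\<lambda>\<omega>. iexp (\<Sum>p\<in>I. a p * X p \<omega>))" "integrable M (\<lambda>\<omega>. iexp (\<Sum>p\<in>I. a p * W p \<omega>))"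
    using indep_var_rv1[OF ind] indep_var_rv2[OF ind] by (auto intro!: integrable_const_bound[of _ 1])
  have "(\<integral>\<omega>. iexp (\<Sum>p\<in>I. a p * (X p \<omega> + W p \<omega>)) \<partial>M) =
      (\<integral>\<omega>. iexp (\<Sum>p\<in>I. a p * X p \<omega>) * iexp (\<Sum>p\<in>I. a p * W p \<omega>) \<partial>M)"
    by (simp add: distrib_left sum.distrib exp_add)
  also have "\<dots> = (\<integral>\<omega>. iexp (\<Sum>p\<in>I. a p * X p \<omega>) \<partial>M) * (\<integral>\<omega>. iexp (\<Sum>p\<in>I. a p * W p \<omega>) \<partial>M)"
    using ind int by (rule indep_var_lebesgue_integral)
  finally show ?thesis .
qed

text \<open>In the coordinates of an orthonormal eigenbasis of the signal covariance both hypotheses are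
  product laws, so the likelihood ratio is a product of one-dimensional ones.\<close>

lemma gaussian_shift_llr:
  fixes I :: "'i set" and C e :: "'i \<Rightarrow> 'i \<Rightarrow> real"
  assumes fin: "finite I"
    and orthonormal: "\<And>j k. j \<in> I \<Longrightarrow> k \<in> I \<Longrightarrow> ip I (e j) (e k) = (if j = k then 1 else 0)"
    and complete: "\<And>p q. p \<in> I \<Longrightarrow> q \<in> I \<Longrightarrow> (\<Sum>k\<in>I. e k p * e k q) = (if p = q then 1 else 0)"
    and eigen: "\<And>k p. k \<in> I \<Longrightarrow> p \<in> I \<Longrightarrow> kernel_op I C (e k) p = l k * e k p"
    and l: "\<And>k. k \<in> I \<Longrightarrow> 0 \<le> l k" and s: "0 < s"
    and Q: "prob_space Q0" "prob_space Q1"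
    and sets: "sets Q0 = sets (PiM I (\<lambda>_. borel))" "sets Q1 = sets (PiM I (\<lambda>_. borel))"
    and char0: "\<And>a. (\<integral>y. iexp (\<Sum>p\<in>I. a p * y p) \<partial>Q0) = complex_of_real (exp (- (s * (\<Sum>p\<in>I. (a p)\<^sup>2)) / 2))"
    and char1: "\<And>a. (\<integral>y. iexp (\<Sum>p\<in>I. a p * y p) \<partial>Q1) =
      complex_of_real (exp (- (s * (\<Sum>p\<in>I. (a p)\<^sup>2) + (\<Sum>p\<in>I. \<Sum>q\<in>I. a p * a q * C p q)) / 2))"
  obtains \<Lambda> where "\<Lambda> \<in> borel_measurable Q0" "Q1 = density Q0 (\<lambda>y. exp (- \<Lambda> y))"
    "integrable Q0 (\<lambda>y. (\<Lambda> y - (\<Sum>k\<in>I. normal_kl s (s + l k)))\<^sup>2)"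
    "(\<integral>y. (\<Lambda> y - (\<Sum>k\<in>I. normal_kl s (s + l k)))\<^sup>2 \<partial>Q0) \<le> 1 / 2 * card I"
proof -
  let ?B = "PiM I (\<lambda>_. borel :: real measure)"
  define N where "N r = PiM I (\<lambda>k. normal_law 0 (r k))" for r
  have sets_N [measurable_cong]: "sets (N r) = sets ?B" for r
    unfolding N_def by (intro sets_PiM_cong) simp_all
  note [measurable_cong] = sets
  define T where "T y = (\<lambda>k\<in>I. \<Sum>p\<in>I. e k p * y p)" for y :: "'i \<Rightarrow> real"
  define T' where "T' z = (\<lambda>p\<in>I. \<Sum>k\<in>I. e k p * z k)" for z :: "'i \<Rightarrow> real"
  have T_meas [measurable]: "T \<in> measurable ?B ?B" unfolding T_def[abs_def] by measurable
  have T'_meas [measurable]: "T' \<in> measurable ?B ?B" unfolding T'_def[abs_def] by measurable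
  have T_inverse: "T' (T y) = y" if "y \<in> space ?B" for y
  proof (rule extensionalityI[of _ I])
    show "T' (T y) \<in> extensional I" by (simp add: T'_def)
    show "y \<in> extensional I" using that by (simp add: space_PiM PiE_def)
    fix p assume p: "p \<in> I"
    have "T' (T y) p = (\<Sum>k\<in>I. \<Sum>q\<in>I. e k p * (e k q * y q))"
      using p by (simp add: T'_def T_def sum_distrib_left)
    also have "\<dots> = (\<Sum>q\<in>I. \<Sum>k\<in>I. e k p * (e k q * y q))" by (rule sum.swap)
    also have "\<dots> = (\<Sum>q\<in>I. (\<Sum>k\<in>I. e k p * e k q) * y q)" by (simp add: sum_distrib_right mult.assoc)
    also have "\<dots> = (\<Sum>q\<in>I. if p = q then y q else 0)"
      using p by (intro sum.cong refl) (simp add: complete)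
    finally show "T' (T y) p = y p" using p fin by simp
  qed
  \<comment> \<open>Since \<open>T'\<close> undoes \<open>T\<close> on the sample space, a law is
    determined by its image in eigen-coordinates; identities between laws can therefore be proved
    there.\<close>
  have distr_inj: "A = A'" if A: "sets A = sets ?B" "sets A' = sets ?B" "distr A ?B T = distr A' ?B T" for A A'
  proof -
    have undo: "distr (distr D ?B T) ?B T' = D" if D [measurable_cong]: "sets D = sets ?B" for D
    proof -
      have "distr (distr D ?B T) ?B T' = distr D ?B (\<lambda>y. T' (T y))"
        by (subst distr_distr) (simp_all add: comp_def)
      also have "\<dots> = distr D D (\<lambda>y. y)"
        using sets_eq_imp_space_eq[OF D] by (intro distr_cong) (simp_all add: D T_inverse)
      finally show ?thesis by (simp add: distr_id)
    qed
    have "A = distr (distr A ?B T) ?B T'" by (rule undo[OF A(1), symmetric])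
    also have "\<dots> = distr (distr A' ?B T) ?B T'" by (simp only: A(3))
    also have "\<dots> = A'" by (rule undo[OF A(2)])
    finally show ?thesis .
  qed
  \<comment> \<open>The adjoint of \<open>T\<close>: a frequency \<open>u\<close> in
    eigen-coordinates becomes the frequency \<open>\<beta> u\<close> in site coordinates. It is an
    isometry (\<open>\<beta>_sq\<close>) and diagonalises the signal covariance
    (\<open>\<beta>_C\<close>), so both exponents turn into diagonal forms.\<close>
  define \<beta> where "\<beta> u p = (\<Sum>k\<in>I. u k * e k p)" for u :: "'i \<Rightarrow> real" and p
  have lin: "(\<Sum>k\<in>I. u k * (\<Sum>p\<in>I. e k p * y p)) = (\<Sum>p\<in>I. \<beta> u p * y p)" for u y
  proof -
    have "(\<Sum>k\<in>I. u k * (\<Sum>p\<in>I. e k p * y p)) = (\<Sum>k\<in>I. \<Sum>p\<in>I. u k * e k p * y p)"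
      by (simp add: sum_distrib_left mult.assoc)
    also have "\<dots> = (\<Sum>p\<in>I. \<Sum>k\<in>I. u k * e k p * y p)" by (rule sum.swap)
    finally show ?thesis by (simp add: \<beta>_def sum_distrib_right)
  qed
  have \<beta>_kernel: "(\<Sum>q\<in>I. C p q * \<beta> u q) = (\<Sum>k\<in>I. u k * l k * e k p)" if p: "p \<in> I" for u p
  proof -
    have "(\<Sum>q\<in>I. C p q * \<beta> u q) = (\<Sum>q\<in>I. \<Sum>k\<in>I. u k * (C p q * e k q))"
      by (simp add: \<beta>_def sum_distrib_left mult_ac)
    also have "\<dots> = (\<Sum>k\<in>I. \<Sum>q\<in>I. u k * (C p q * e k q))" by (rule sum.swap)
    also have "\<dots> = (\<Sum>k\<in>I. u k * kernel_op I C (e k) p)" by (simp add: kernel_op_def sum_distrib_left)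
    finally show ?thesis using eigen p by (simp add: mult.assoc)
  qed
  have \<beta>_pair: "(\<Sum>p\<in>I. \<beta> u p * (\<Sum>k\<in>I. v k * e k p)) = (\<Sum>k\<in>I. u k * v k)" for u v
  proof -
    have "(\<Sum>p\<in>I. \<beta> u p * (\<Sum>k\<in>I. v k * e k p)) = (\<Sum>p\<in>I. \<Sum>k\<in>I. v k * (e k p * \<beta> u p))"
      by (simp add: sum_distrib_left mult_ac)
    also have "\<dots> = (\<Sum>k\<in>I. \<Sum>p\<in>I. v k * (e k p * \<beta> u p))" by (rule sum.swap)
    also have "\<dots> = (\<Sum>k\<in>I. v k * (\<Sum>j\<in>I. u j * ip I (e j) (e k)))"
    proof (intro sum.cong refl)
      fix k
      have "(\<Sum>p\<in>I. e k p * \<beta> u p) = (\<Sum>p\<in>I. \<Sum>j\<in>I. u j * (e j p * e k p))"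
        by (simp add: \<beta>_def sum_distrib_left mult_ac)
      also have "\<dots> = (\<Sum>j\<in>I. u j * ip I (e j) (e k))"
        by (subst sum.swap) (simp add: ip_def sum_distrib_left)
      finally show "(\<Sum>p\<in>I. v k * (e k p * \<beta> u p)) = v k * (\<Sum>j\<in>I. u j * ip I (e j) (e k))"
        by (simp flip: sum_distrib_left)
    qed
    also have "\<dots> = (\<Sum>k\<in>I. v k * (\<Sum>j\<in>I. if j = k then u j else 0))"
      by (intro sum.cong refl arg_cong2[where f = "(*)"]) (simp add: orthonormal)
    finally show ?thesis using fin by (simp add: mult.commute)
  qed
  have \<beta>_sq: "(\<Sum>p\<in>I. (\<beta> u p)\<^sup>2) = (\<Sum>k\<in>I. (u k)\<^sup>2)" for u
    using \<beta>_pair[of u u] by (simp add: power2_eq_square flip: \<beta>_def)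
  have \<beta>_C: "(\<Sum>p\<in>I. \<Sum>q\<in>I. \<beta> u p * \<beta> u q * C p q) = (\<Sum>k\<in>I. l k * (u k)\<^sup>2)" for u
  proof -
    have "(\<Sum>p\<in>I. \<Sum>q\<in>I. \<beta> u p * \<beta> u q * C p q) = (\<Sum>p\<in>I. \<beta> u p * (\<Sum>q\<in>I. C p q * \<beta> u q))"
      by (simp add: sum_distrib_left mult_ac)
    also have "\<dots> = (\<Sum>p\<in>I. \<beta> u p * (\<Sum>k\<in>I. (u k * l k) * e k p))"
      by (intro sum.cong refl) (simp add: \<beta>_kernel)
    also have "\<dots> = (\<Sum>k\<in>I. u k * (u k * l k))" by (rule \<beta>_pair)
    finally show ?thesis by (simp add: power2_eq_square mult_ac)
  qed
  have law0: "distr Q0 ?B T = N (\<lambda>_. s)"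
    unfolding T_def[abs_def] N_def
  proof (rule distr_eq_PiM_normal_lawI[OF Q(1) fin])
    fix u
    show "(\<integral>y. iexp (\<Sum>k\<in>I. u k * (\<Sum>p\<in>I. e k p * y p)) \<partial>Q0) = complex_of_real (exp (- (\<Sum>k\<in>I. s * (u k)\<^sup>2) / 2))"
      unfolding lin char0 \<beta>_sq by (simp add: sum_distrib_left)
  qed (use s in simp_all)
  have law1: "distr Q1 ?B T = N (\<lambda>k. s + l k)"
    unfolding T_def[abs_def] N_def
  proof (rule distr_eq_PiM_normal_lawI[OF Q(2) fin])
    fix u
    show "(\<integral>y. iexp (\<Sum>k\<in>I. u k * (\<Sum>p\<in>I. e k p * y p)) \<partial>Q1) = complex_of_real (exp (- (\<Sum>k\<in>I. (s + l k) * (u k)\<^sup>2) / 2))"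
      unfolding lin char1 \<beta>_sq \<beta>_C by (simp add: sum_distrib_left sum.distrib distrib_right)
  qed (use s l in simp_all)
  define \<Lambda>' where "\<Lambda>' z = (\<Sum>k\<in>I. normal_llr s (s + l k) (z k))" for z
  have \<Lambda>'_meas [measurable]: "\<Lambda>' \<in> borel_measurable ?B" unfolding \<Lambda>'_def[abs_def] by measurable
  have dens: "N (\<lambda>k. s + l k) = density (N (\<lambda>_. s)) (\<lambda>z. exp (- \<Lambda>' z))"
  proof -
    have "N (\<lambda>k. s + l k) = density (N (\<lambda>_. s)) (\<lambda>z. \<Prod>k\<in>I. ennreal (exp (- normal_llr s (s + l k) (z k))))"
      unfolding N_def
    proof (rule PiM_density[OF fin])
      fix k assume k: "k \<in> I"
      show "prob_space (normal_law 0 s)" using s by (intro prob_space_normal_law) simp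
      show "prob_space (normal_law 0 (s + l k))" using s l[OF k] by (intro prob_space_normal_law) simp
      show "normal_law 0 (s + l k) = density (normal_law 0 s) (\<lambda>x. ennreal (exp (- normal_llr s (s + l k) x)))"
        using s l[OF k] by (intro normal_law_density) auto
    qed simp
    then show ?thesis by (simp add: \<Lambda>'_def prod_ennreal exp_sum fin flip: sum_negf)
  qed
  define \<Lambda> where "\<Lambda> y = \<Lambda>' (T y)" for y
  have \<Lambda>_meas: "\<Lambda> \<in> borel_measurable Q0" unfolding \<Lambda>_def[abs_def] by measurable
  \<comment> \<open>The density in eigen-coordinates is pulled back along \<open>T\<close>; the two
    candidate laws have the same image, so they agree.\<close>
  have "Q1 = density Q0 (\<lambda>y. exp (- \<Lambda> y))"
  proof (rule distr_inj)
    show "distr Q1 ?B T = distr (density Q0 (\<lambda>y. exp (- \<Lambda> y))) ?B T"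
      unfolding law1 dens law0[symmetric] \<Lambda>_def by (rule density_distr) measurable
  qed (simp_all add: sets)
  moreover define g where "g k x = normal_llr s (s + l k) x - normal_kl s (s + l k)" for k x
  have g: "integrable (normal_law 0 s) (g k)" "(\<integral>x. g k x \<partial>normal_law 0 s) = 0" if "k \<in> I" for k
  proof -
    interpret prob_space "normal_law 0 s" using s by (intro prob_space_normal_law) simp
    have "has_bochner_integral (normal_law 0 s) (normal_llr s (s + l k)) (normal_kl s (s + l k))"
      using s l[OF that] by (intro normal_llr_mean) auto
    moreover have "has_bochner_integral (normal_law 0 s) (\<lambda>x. normal_kl s (s + l k)) (normal_kl s (s + l k))"
      using prob_space by (simp add: has_bochner_integral_iff)
    ultimately have "has_bochner_integral (normal_law 0 s) (g k) (normal_kl s (s + l k) - normal_kl s (s + l k))"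
      unfolding g_def[abs_def] by (rule has_bochner_integral_diff)
    then show "integrable (normal_law 0 s) (g k)" "(\<integral>x. g k x \<partial>normal_law 0 s) = 0"
      by (simp_all add: has_bochner_integral_iff)
  qed
  have g2: "integrable (normal_law 0 s) (\<lambda>x. (g k x)\<^sup>2)" "(\<integral>x. (g k x)\<^sup>2 \<partial>normal_law 0 s) \<le> 1 / 2" if "k \<in> I" for k
    unfolding g_def by (rule normal_llr_variance; use s l[OF that] in simp)+
  have centered: "\<Lambda>' z - (\<Sum>k\<in>I. normal_kl s (s + l k)) = (\<Sum>k\<in>I. g k (z k))" for z
    by (simp add: \<Lambda>'_def g_def sum_subtractf)
  have N_prob: "prob_space (normal_law 0 s)" using s by (intro prob_space_normal_law) simp
  have var: "integrable (N (\<lambda>_. s)) (\<lambda>z. (\<Lambda>' z - (\<Sum>k\<in>I. normal_kl s (s + l k)))\<^sup>2)"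
    "(\<integral>z. (\<Lambda>' z - (\<Sum>k\<in>I. normal_kl s (s + l k)))\<^sup>2 \<partial>N (\<lambda>_. s)) \<le> card I * (1 / 2)"
    unfolding N_def centered by (rule PiM_sum_variance_le[OF fin N_prob]; (rule g g2; assumption))+
  have "integrable Q0 (\<lambda>y. (\<Lambda> y - (\<Sum>k\<in>I. normal_kl s (s + l k)))\<^sup>2)"
    using var(1) unfolding law0[symmetric] \<Lambda>_def by (subst (asm) integrable_distr_eq) simp_all
  moreover have "(\<integral>y. (\<Lambda> y - (\<Sum>k\<in>I. normal_kl s (s + l k)))\<^sup>2 \<partial>Q0) \<le> 1 / 2 * card I"
    using var(2) unfolding law0[symmetric] \<Lambda>_def by (subst (asm) integral_distr) (simp_all add: mult.commute)
  ultimately show ?thesis using \<Lambda>_meas by (intro that)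
qed

section \<open>From randomized tests of observations to tests under the null law\<close>

lemma randomized_test_iff_test_on:
  assumes "sets Q = sets (PiM I (\<lambda>_. borel :: real measure))"
  shows "randomized_test I \<phi> \<longleftrightarrow> test_on Q \<phi>"
  unfolding randomized_test_def test_on_def
  using measurable_cong_sets[OF assms refl, where N = "borel :: real measure"] sets_eq_imp_space_eq[OF assms] by simp

lemma observe_measurable:
  assumes "\<And>p. p \<in> I \<Longrightarrow> Y p \<in> borel_measurable M"
  shows "observe I Y \<in> measurable M (PiM I (\<lambda>_. borel))"
  unfolding observe_def[abs_def] using assms by (intro measurable_restrict) auto

lemma false_alarm_prob_distr:
  assumes "observe I Y \<in> measurable M (PiM I (\<lambda>_. borel))" "randomized_test I \<phi>"
  shows "false_alarm_prob M I Y \<phi> = (\<integral>y. \<phi> y \<partial>distr M (PiM I (\<lambda>_. borel)) (observe I Y))"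
  using assms unfolding false_alarm_prob_def randomized_test_def by (subst integral_distr) auto

lemma miss_prob_density:
  assumes Y: "observe I Y \<in> measurable M (PiM I (\<lambda>_. borel))" and \<phi>: "randomized_test I \<phi>"
    and Q: "sets Q = sets (PiM I (\<lambda>_. borel))" "\<Lambda> \<in> borel_measurable Q"
    and dens: "distr M (PiM I (\<lambda>_. borel)) (observe I Y) = density Q (\<lambda>y. exp (- \<Lambda> y))"
  shows "miss_prob M I Y \<phi> = (\<integral>y. (1 - \<phi> y) * exp (- \<Lambda> y) \<partial>Q)"
proof -
  have "miss_prob M I Y \<phi> = (\<integral>y. 1 - \<phi> y \<partial>distr M (PiM I (\<lambda>_. borel)) (observe I Y))"
    using Y \<phi> unfolding miss_prob_def randomized_test_def by (subst integral_distr) auto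
  also have "\<dots> = (\<integral>y. exp (- \<Lambda> y) *\<^sub>R (1 - \<phi> y) \<partial>Q)"
    unfolding dens using Q(2) \<phi>[unfolded randomized_test_iff_test_on[OF Q(1)] test_on_def]
    by (intro integral_density) auto
  finally show ?thesis by (simp add: mult.commute)
qed

lemma neyman_pearson_detector_iff_optimal_test:
  assumes Y0: "observe I Y0 \<in> measurable M (PiM I (\<lambda>_. borel))"
    and Y1: "observe I Y1 \<in> measurable M (PiM I (\<lambda>_. borel))"
    and Q: "Q = distr M (PiM I (\<lambda>_. borel)) (observe I Y0)"
    and \<Lambda>: "\<Lambda> \<in> borel_measurable Q"
    and dens: "distr M (PiM I (\<lambda>_. borel)) (observe I Y1) = density Q (\<lambda>y. exp (- \<Lambda> y))"
  shows "neyman_pearson_detector M I Y0 Y1 \<alpha> \<phi> \<longleftrightarrow> optimal_test Q (\<lambda>y. exp (- \<Lambda> y)) \<alpha> \<phi>"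
proof -
  have sets: "sets Q = sets (PiM I (\<lambda>_. borel))" by (simp add: Q)
  note iff = randomized_test_iff_test_on[OF sets]
  have "false_alarm_prob M I Y0 \<psi> = (\<integral>y. \<psi> y \<partial>Q)" "miss_prob M I Y1 \<psi> = (\<integral>y. (1 - \<psi> y) * exp (- \<Lambda> y) \<partial>Q)"
    if "test_on Q \<psi>" for \<psi>
    using that false_alarm_prob_distr[OF Y0] miss_prob_density[OF Y1 _ sets \<Lambda> dens] by (simp_all add: iff Q)
  then show ?thesis unfolding neyman_pearson_detector_def optimal_test_def iff by auto
qed

subsection \<open>The error exponent\<close>

lemma (in toeplitz_block) kl_sum_bound:
  assumes s: "0 < s"
    and modulus: "\<And>s w. \<bar>g s - g w\<bar> \<le> \<epsilon> + c * (2 - Re (wave (1, 0) (s - w)) - Re (wave (0, 1) (s - w)))"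
  shows "\<bar>(\<Sum>k\<in>I. normal_kl s (s + l k)) - real (card I) * (\<integral>w. normal_kl s (s + g w) \<partial>torus_law)\<bar> \<le>
    1 / s * (\<epsilon> * real (card I) + c * boundary_defect I)"
proof -
  interpret prob_space torus_law by (rule prob_space_torus_law)
  \<comment> \<open>Both functions are convex with slopes at most \<open>1 / (2 * s)\<close> in
    modulus, so their difference incurs the factor \<open>1 / s\<close>. The constant
    \<open>1/2\<close> cancels because \<open>torus_law\<close> has mass one.\<close>
  define F1 F2 where "F1 x = - 1/2 * ln ((s + x) / s)" and "F2 x = 1/2 * (s / (s + x))" for x
  have kl: "normal_kl s (s + x) = F2 x - F1 x - 1/2" for x by (simp add: normal_kl_def F1_def F2_def)
  have meas [measurable]: "(\<lambda>w. F1 (g w)) \<in> borel_measurable borel" "(\<lambda>w. F2 (g w)) \<in> borel_measurable borel"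
    unfolding F1_def F2_def by measurable
  have F1: "\<bar>F1 (g w)\<bar> \<le> 1/2 * ln ((s + B) / s)" for w
  proof -
    have "0 \<le> ln ((s + g w) / s)" using s g_bounds[of w] by (simp add: field_simps)
    moreover have "ln ((s + g w) / s) \<le> ln ((s + B) / s)"
      using s g_bounds(1)[of w] g_bounds(2)[of w] by (subst ln_le_cancel_iff) (auto simp: divide_simps)
    ultimately show ?thesis by (simp add: F1_def)
  qed
  have F2: "\<bar>F2 (g w)\<bar> \<le> 1/2" for w using s g_bounds(1)[of w] by (simp add: F2_def abs_mult field_simps)
  have i: "integrable torus_law (\<lambda>w. F1 (g w))" "integrable torus_law (\<lambda>w. F2 (g w))"
    by (rule integrable_torus_law[OF meas(1)], subst real_norm_def, rule F1)
       (rule integrable_torus_law[OF meas(2)], subst real_norm_def, rule F2)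
  have "tangent_bounded (1 / (2 * s)) F1" "tangent_bounded (1 / (2 * s)) F2"
    using tangent_bounded_neg_ln[OF s] tangent_bounded_inverse[OF s] by (simp_all only: F1_def[abs_def] F2_def[abs_def])
  note b1 = szego_bound[OF this(1) meas(1) F1 modulus] and b2 = szego_bound[OF this(2) meas(2) F2 modulus]
  have "(\<Sum>k\<in>I. normal_kl s (s + l k)) - real (card I) * (\<integral>w. normal_kl s (s + g w) \<partial>torus_law) =
     ((\<Sum>k\<in>I. F2 (l k)) - real (card I) * (\<integral>w. F2 (g w) \<partial>torus_law)) -
     ((\<Sum>k\<in>I. F1 (l k)) - real (card I) * (\<integral>w. F1 (g w) \<partial>torus_law))"
    unfolding kl using i prob_space by (simp add: sum_subtractf sum.distrib algebra_simps)
  also have "\<bar>\<dots>\<bar> \<le> 1 / (2 * s) * (\<epsilon> * real (card I) + c * boundary_defect I) +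
      1 / (2 * s) * (\<epsilon> * real (card I) + c * boundary_defect I)"
    by (rule order_trans[OF abs_triangle_ineq4 add_mono[OF b2 b1]])
  also have "\<dots> = 1 / s * (\<epsilon> * real (card I) + c * boundary_defect I)"
    using s by (simp add: field_simps)
  finally show ?thesis .
qed

theorem theorem1:
  fixes \<theta> :: "int \<times> int \<Rightarrow> real"
    and \<sigma> :: real
    and M :: "'a measure"
    and X W :: "int \<times> int \<Rightarrow> 'a \<Rightarrow> real"
  assumes "finite {p. \<theta> p \<noteq> 0}"
    and "\<And>i j. \<theta> (i, j) = \<theta> (- i, - j)"
    and "\<theta> (0, 0) > 0"
    and "\<And>w. w \<in> {-pi<..pi} \<times> {-pi<..pi} \<Longrightarrow> car_symbol \<theta> w \<noteq> 0"
    and "\<And>w. w \<in> {-pi<..pi} \<times> {-pi<..pi} \<Longrightarrow> car_spectral_density \<theta> w > 0"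
    and "prob_space M"
    and "car_field M \<theta> X"
    and "\<sigma> > 0"
    and "prob_space.indep_vars M (\<lambda>_. borel) W UNIV"
    and "\<And>p. distr M borel (W p) = normal_law 0 (\<sigma>\<^sup>2)"
    and "prob_space.indep_var M
           (PiM UNIV (\<lambda>_. borel)) (\<lambda>\<omega> p. X p \<omega>) (PiM UNIV (\<lambda>_. borel)) (\<lambda>\<omega> p. W p \<omega>)"
  shows "\<exists>K :: real.
    (\<forall>\<alpha>. 0 < \<alpha> \<and> \<alpha> < 1 \<longrightarrow>
       (\<forall>m. \<exists>\<phi>. neyman_pearson_detector M (site_square m) W (\<lambda>p \<omega>. X p \<omega> + W p \<omega>) \<alpha> \<phi>) \<and>
       (\<forall>\<delta>. (\<forall>m. neyman_pearson_detector M (site_square m) W (\<lambda>p \<omega>. X p \<omega> + W p \<omega>) \<alpha> (\<delta> m)) \<longrightarrow>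
          (\<lambda>m. - (1 / real ((2 * m + 1)\<^sup>2)) *
                 ln (miss_prob M (site_square m) (\<lambda>p \<omega>. X p \<omega> + W p \<omega>) (\<delta> m))) \<longlonglongrightarrow> K)) \<and>
    K = 1 / (4 * pi\<^sup>2) *
        (LINT w:freq_square|lborel.
           1/2 * ln ((\<sigma>\<^sup>2 + 4 * pi\<^sup>2 * car_spectral_density \<theta> w) / \<sigma>\<^sup>2)
           + 1/2 * (\<sigma>\<^sup>2 / (\<sigma>\<^sup>2 + 4 * pi\<^sup>2 * car_spectral_density \<theta> w)) - 1/2) \<and>
    K = 1 / (4 * pi\<^sup>2) *
        (LINT w:freq_square|lborel.
           kl_div (normal_law 0 (\<sigma>\<^sup>2 / (4 * pi\<^sup>2)))
                  (normal_law 0 (\<sigma>\<^sup>2 / (4 * pi\<^sup>2) + car_spectral_density \<theta> w)))"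
proof -
  interpret prob_space M by fact
  interpret car_symbol_positive \<theta> using assms(1,4,5) by unfold_locales
  have G: "gaussian_field M X" and Z: "zero_mean M X" and S: "stationary M X"
    and f: "has_spectral_density M X (car_spectral_density \<theta>)"
    using assms(7) unfolding car_field_def by blast+
  have X_meas [measurable]: "X p \<in> borel_measurable M" for p using G unfolding gaussian_field_def by blast
  have W_meas [measurable]: "W p \<in> borel_measurable M" for p
    using assms(9) unfolding indep_vars_def by blast
  define s where "s = \<sigma>\<^sup>2"
  have s: "0 < s" using assms(8) by (simp add: s_def)
  define K where "K = (\<integral>w. normal_kl s (s + symbol w) \<partial>torus_law)"
  have normal_kl_meas [measurable]: "(\<lambda>w. normal_kl s (s + symbol w)) \<in> borel_measurable borel"
    unfolding normal_kl_def by measurable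
  define C where "C p q = (\<integral>\<omega>. X p \<omega> * X q \<omega> \<partial>M)" for p q
  \<comment> \<open>Stationarity makes the covariance a function of \<open>q - p\<close>, and the
    normalisation of \<open>torus_law\<close> is offset by the factor in
    \<open>symbol\<close>.\<close>
  have C_symbol: "complex_of_real (C p q) = (\<integral>w. symbol w * wave (q - p) w \<partial>torus_law)" for p q
  proof -
    have "C p q = (\<integral>\<omega>. X p \<omega> * X (p + (q - p)) \<omega> \<partial>M)" by (simp add: C_def)
    also have "\<dots> = autocov M X (q - p)" using S unfolding stationary_def autocov_def by blast
    finally have "complex_of_real (C p q) = (LINT w:freq_square|lborel.
           complex_of_real (car_spectral_density \<theta> w) * exp (\<i> * complex_of_real (freq_pairing (q - p) w)))"
      using f unfolding has_spectral_density_def by metis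
    also have "\<dots> = (LINT w:freq_square|lborel. (1 / (4 * pi\<^sup>2)) *\<^sub>R (complex_of_real (symbol w) * wave (q - p) w))"
      by (simp add: symbol_def wave_def scaleR_conv_of_real)
    also have "\<dots> = (1 / (4 * pi\<^sup>2)) *\<^sub>R (LINT w:freq_square|lborel. complex_of_real (symbol w) * wave (q - p) w)"
      by (rule set_integral_scaleR_right)
    also have "\<dots> = (\<integral>w. symbol w * wave (q - p) w \<partial>torus_law)"
      by (rule integral_torus_law[symmetric]) measurable
    finally show ?thesis .
  qed
  obtain B where B: "\<And>w. symbol w \<le> B" by (rule symbol_bounded) blast
  let ?Y = "\<lambda>p \<omega>. X p \<omega> + W p \<omega>"
  define Q0 Q1 where "Q0 m = distr M (PiM (site_square m) (\<lambda>_. borel)) (observe (site_square m) W)"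
    and "Q1 m = distr M (PiM (site_square m) (\<lambda>_. borel)) (observe (site_square m) ?Y)" for m
  have obs [measurable]: "observe I W \<in> measurable M (PiM I (\<lambda>_. borel))"
    "observe I ?Y \<in> measurable M (PiM I (\<lambda>_. borel))" for I
    by (intro observe_measurable; measurable)+
  have prob: "prob_space (Q0 m)" "prob_space (Q1 m)" for m
    unfolding Q0_def Q1_def by (intro prob_space_distr obs)+
  define n where "n m = real ((2 * m + 1)\<^sup>2)" for m
  have card: "real (card (site_square m)) = n m" for m by (simp only: card_site_square n_def)
  \<comment> \<open>\<open>\<Lambda>\<close> is fixed for each \<open>m\<close> before \<open>\<epsilon>\<close> and \<open>c\<close>, since \<open>\<epsilon>\<close> is chosen only in the limit.\<close>
  have "\<exists>\<Lambda> \<mu>. \<Lambda> \<in> borel_measurable (Q0 m) \<and> Q1 m = density (Q0 m) (\<lambda>y. exp (- \<Lambda> y)) \<and>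
      integrable (Q0 m) (\<lambda>y. (\<Lambda> y - \<mu>)\<^sup>2) \<and> (\<integral>y. (\<Lambda> y - \<mu>)\<^sup>2 \<partial>Q0 m) \<le> 1 / 2 * n m \<and>
      (\<forall>\<epsilon> c. (\<forall>s w. \<bar>symbol s - symbol w\<bar> \<le> \<epsilon> + c * (2 - Re (wave (1, 0) (s - w)) - Re (wave (0, 1) (s - w)))) \<longrightarrow>
        \<bar>\<mu> - n m * K\<bar> \<le> 1 / s * (\<epsilon> * n m + c * (2 * (2 * real m + 1))))" for m
  proof -
    let ?I = "site_square m"
    have ne: "?I \<noteq> {}" by (auto simp: site_square_def)
    have C_sym: "C p q = C q p" for p q by (simp add: C_def mult.commute)
    obtain e l where el:
      "\<And>j k. j \<in> ?I \<Longrightarrow> k \<in> ?I \<Longrightarrow> ip ?I (e j) (e k) = (if j = k then 1 else 0)"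
      "\<And>p q. p \<in> ?I \<Longrightarrow> q \<in> ?I \<Longrightarrow> (\<Sum>k\<in>?I. e k p * e k q) = (if p = q then 1 else 0)"
      "\<And>k p. k \<in> ?I \<Longrightarrow> p \<in> ?I \<Longrightarrow> kernel_op ?I C (e k) p = l k * e k p"
      by (rule symmetric_kernel_eigenbasis[where I = ?I and C = C, OF finite_site_square C_sym]) blast
    interpret toeplitz_block ?I C symbol B e l
      by unfold_locales (auto simp: el C_symbol B intro: less_imp_le[OF symbol_pos])
    have char_W: "(\<integral>\<omega>. iexp (\<Sum>p\<in>?I. a p * W p \<omega>) \<partial>M) =
        complex_of_real (exp (- (s * (\<Sum>p\<in>?I. (a p)\<^sup>2)) / 2))" for a
      using s unfolding s_def by (intro iid_normal_char assms ne finite_site_square) simp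
    have char0: "(\<integral>y. iexp (\<Sum>p\<in>?I. a p * y p) \<partial>Q0 m) =
        complex_of_real (exp (- (s * (\<Sum>p\<in>?I. (a p)\<^sup>2)) / 2))" for a
      unfolding char_W[symmetric] Q0_def by (subst integral_distr) (simp_all add: observe_def)
    have "(\<integral>y. iexp (\<Sum>p\<in>?I. a p * y p) \<partial>Q1 m) = (\<integral>\<omega>. iexp (\<Sum>p\<in>?I. a p * ?Y p \<omega>) \<partial>M)" for a
      unfolding Q1_def by (subst integral_distr) (simp_all add: observe_def)
    also have "(\<integral>\<omega>. iexp (\<Sum>p\<in>?I. a p * ?Y p \<omega>) \<partial>M) =
        complex_of_real (exp (- (\<Sum>p\<in>?I. \<Sum>q\<in>?I. a p * a q * C p q) / 2)) *
        complex_of_real (exp (- (s * (\<Sum>p\<in>?I. (a p)\<^sup>2)) / 2))" for a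
      unfolding indep_char_add[OF assms(11)] char_W C_def
      by (simp only: gaussian_field_char[OF assms(6) G Z S finite_site_square])
    also have "complex_of_real (exp (- (\<Sum>p\<in>?I. \<Sum>q\<in>?I. a p * a q * C p q) / 2)) *
        complex_of_real (exp (- (s * (\<Sum>p\<in>?I. (a p)\<^sup>2)) / 2)) =
        complex_of_real (exp (- (s * (\<Sum>p\<in>?I. (a p)\<^sup>2) + (\<Sum>p\<in>?I. \<Sum>q\<in>?I. a p * a q * C p q)) / 2))" for a
      by (simp add: mult_exp_exp add_divide_distrib algebra_simps flip: of_real_mult)
    finally have char1: "(\<integral>y. iexp (\<Sum>p\<in>?I. a p * y p) \<partial>Q1 m) =
        complex_of_real (exp (- (s * (\<Sum>p\<in>?I. (a p)\<^sup>2) + (\<Sum>p\<in>?I. \<Sum>q\<in>?I. a p * a q * C p q)) / 2))" for a .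
    have sets: "sets (Q0 m) = sets (PiM ?I (\<lambda>_. borel))" "sets (Q1 m) = sets (PiM ?I (\<lambda>_. borel))"
      by (simp_all add: Q0_def Q1_def)
    obtain \<Lambda> where \<Lambda>: "\<Lambda> \<in> borel_measurable (Q0 m)" "Q1 m = density (Q0 m) (\<lambda>y. exp (- \<Lambda> y))"
      "integrable (Q0 m) (\<lambda>y. (\<Lambda> y - (\<Sum>k\<in>?I. normal_kl s (s + l k)))\<^sup>2)"
      "(\<integral>y. (\<Lambda> y - (\<Sum>k\<in>?I. normal_kl s (s + l k)))\<^sup>2 \<partial>Q0 m) \<le> 1 / 2 * card ?I"
      by (rule gaussian_shift_llr[OF finite_site_square el eigenvalue_nonneg s prob sets char0 char1]) blast
    show ?thesis
    proof (intro exI conjI allI impI)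
      fix \<epsilon> c
      assume "\<forall>s w. \<bar>symbol s - symbol w\<bar> \<le> \<epsilon> + c * (2 - Re (wave (1, 0) (s - w)) - Re (wave (0, 1) (s - w)))"
      then show "\<bar>(\<Sum>k\<in>?I. normal_kl s (s + l k)) - n m * K\<bar> \<le> 1 / s * (\<epsilon> * n m + c * (2 * (2 * real m + 1)))"
        using kl_sum_bound[OF s, of \<epsilon> c] unfolding boundary_defect_site_square card K_def by blast
    qed (use \<Lambda> card in simp_all)
  qed
  then obtain \<Lambda> \<mu> where \<Lambda>: "\<And>m. \<Lambda> m \<in> borel_measurable (Q0 m)"
      "\<And>m. Q1 m = density (Q0 m) (\<lambda>y. exp (- \<Lambda> m y))"
      "\<And>m. integrable (Q0 m) (\<lambda>y. (\<Lambda> m y - \<mu> m)\<^sup>2)" "\<And>m. (\<integral>y. (\<Lambda> m y - \<mu> m)\<^sup>2 \<partial>Q0 m) \<le> 1 / 2 * n m"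
    and \<mu>: "\<And>m \<epsilon> c. (\<And>s w. \<bar>symbol s - symbol w\<bar> \<le> \<epsilon> + c * (2 - Re (wave (1, 0) (s - w)) - Re (wave (0, 1) (s - w)))) \<Longrightarrow>
        \<bar>\<mu> m - n m * K\<bar> \<le> 1 / s * (\<epsilon> * n m + c * (2 * (2 * real m + 1)))"
    by metis
  have n: "0 < n m" for m by (simp add: n_def)
  have n_lim: "filterlim n at_top sequentially"
    unfolding n_def by real_asymp
  have "(\<lambda>m. \<mu> m / n m) \<longlonglongrightarrow> K"
  proof (rule tendstoI)
    fix r :: real assume r: "0 < r"
    \<comment> \<open>With this choice the constant part of the modulus contributes
      \<open>r / 2\<close> after the factor \<open>1 / s\<close>. Then \<open>c\<close> is fixed,
      and the boundary term, of order \<open>1 / (2 * real m + 1)\<close>, falls below the other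
      half.\<close>
    have "0 < s * r / 2" using s r by simp
    then obtain c where c: "\<And>u w. \<bar>symbol u - symbol w\<bar> \<le>
        s * r / 2 + c * (2 - Re (wave (1, 0) (u - w)) - Re (wave (0, 1) (u - w)))"
      using symbol_modulus by blast
    have "(\<lambda>m. 1 / s * (c * (2 / (2 * real m + 1)))) \<longlonglongrightarrow> 0" by real_asymp
    then have "eventually (\<lambda>m. 1 / s * (c * (2 / (2 * real m + 1))) < r / 2) sequentially"
      by (rule order_tendstoD) (use r in simp)
    then show "eventually (\<lambda>m. dist (\<mu> m / n m) K < r) sequentially"
    proof eventually_elim
      case (elim m)
      have nm: "n m = (2 * real m + 1) * (2 * real m + 1)"
        by (simp add: n_def power2_eq_square algebra_simps)
      have "\<mu> m / n m - K = (\<mu> m - n m * K) / n m" using n[of m] by (simp add: field_simps)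
      then have "dist (\<mu> m / n m) K = \<bar>\<mu> m - n m * K\<bar> / n m"
        using n[of m] by (simp only: dist_real_def abs_divide abs_of_pos)
      also have "\<dots> \<le> 1 / s * (s * r / 2 * n m + c * (2 * (2 * real m + 1))) / n m"
        using \<mu>[of "s * r / 2" c m, OF c] n[of m] by (intro divide_right_mono) simp_all
      also have "\<dots> = r / 2 + 1 / s * (c * (2 / (2 * real m + 1)))"
      proof -
        have cancel: "1 / s * (s * r / 2 * (t * t) + c * (2 * t)) / (t * t) = r / 2 + 1 / s * (c * (2 / t))"
          if "0 < t" for t using that s by (simp add: field_simps)
        show ?thesis unfolding nm by (rule cancel) simp
      qed
      also have "\<dots> < r" using elim by simp
      finally show ?case .
    qed
  qed
  note \<mu>_lim = this
  have L_int: "integrable (Q0 m) (\<lambda>y. exp (- \<Lambda> m y))" for m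
  proof -
    have "(\<integral>\<^sup>+y. ennreal (exp (- \<Lambda> m y)) \<partial>Q0 m) = emeasure (Q1 m) (space (Q1 m))"
      unfolding \<Lambda>(2)[of m] using \<Lambda>(1)[of m] by (simp add: emeasure_density cong: nn_integral_cong)
    also have "\<dots> = 1" using prob(2) by (rule prob_space.emeasure_space_1)
    finally show ?thesis using \<Lambda>(1)[of m] by (intro integrableI_nonneg) simp_all
  qed
  have np: "neyman_pearson_detector M (site_square m) W ?Y \<alpha> \<phi> \<longleftrightarrow> optimal_test (Q0 m) (\<lambda>y. exp (- \<Lambda> m y)) \<alpha> \<phi>"
    for m \<alpha> \<phi>
    using \<Lambda>(2)[of m] unfolding Q1_def
    by (intro neyman_pearson_detector_iff_optimal_test obs Q0_def \<Lambda>(1))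
  have miss: "miss_prob M (site_square m) ?Y \<phi> = (\<integral>y. (1 - \<phi> y) * exp (- \<Lambda> m y) \<partial>Q0 m)"
    if "optimal_test (Q0 m) (\<lambda>y. exp (- \<Lambda> m y)) \<alpha> \<phi>" for m \<alpha> \<phi>
  proof (rule miss_prob_density[OF obs(2)])
    show sets: "sets (Q0 m) = sets (PiM (site_square m) (\<lambda>_. borel))" by (simp add: Q0_def)
    show "randomized_test (site_square m) \<phi>"
      using that by (simp add: optimal_test_def randomized_test_iff_test_on[OF sets])
  qed (use \<Lambda>(1,2)[of m] in \<open>simp_all add: Q1_def\<close>)
  have "4 * pi\<^sup>2 * car_spectral_density \<theta> w = symbol w" for w by (simp add: symbol_def)
  then have K1: "K = 1 / (4 * pi\<^sup>2) * (LINT w:freq_square|lborel.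
      1/2 * ln ((\<sigma>\<^sup>2 + 4 * pi\<^sup>2 * car_spectral_density \<theta> w) / \<sigma>\<^sup>2)
       + 1/2 * (\<sigma>\<^sup>2 / (\<sigma>\<^sup>2 + 4 * pi\<^sup>2 * car_spectral_density \<theta> w)) - 1/2)"
    unfolding K_def by (subst integral_torus_law) (simp_all add: normal_kl_def s_def)
  \<comment> \<open>The variances here carry the factor \<open>1 / (4 * pi\<^sup>2)\<close> of the
    spectral densities; \<open>normal_kl\<close> sees only their ratio, where it cancels.\<close>
  have kl: "kl_div (normal_law 0 (\<sigma>\<^sup>2 / (4 * pi\<^sup>2))) (normal_law 0 (\<sigma>\<^sup>2 / (4 * pi\<^sup>2) + car_spectral_density \<theta> w)) =
      normal_kl s (s + symbol w)" for w
  proof -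
    have f: "car_spectral_density \<theta> w = symbol w / (4 * pi\<^sup>2)" by (simp add: symbol_def)
    have "kl_div (normal_law 0 (\<sigma>\<^sup>2 / (4 * pi\<^sup>2))) (normal_law 0 (\<sigma>\<^sup>2 / (4 * pi\<^sup>2) + car_spectral_density \<theta> w)) =
        normal_kl (s / (4 * pi\<^sup>2)) ((s + symbol w) / (4 * pi\<^sup>2))"
      using s symbol_pos[of w] unfolding f s_def[symmetric] add_divide_distrib
      by (intro kl_div_normal_law) (simp_all add: add_pos_pos)
    also have "\<dots> = normal_kl s (s + symbol w)" by (simp add: normal_kl_def)
    finally show ?thesis .
  qed
  have K2: "K = 1 / (4 * pi\<^sup>2) * (LINT w:freq_square|lborel.
      kl_div (normal_law 0 (\<sigma>\<^sup>2 / (4 * pi\<^sup>2))) (normal_law 0 (\<sigma>\<^sup>2 / (4 * pi\<^sup>2) + car_spectral_density \<theta> w)))"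
    unfolding kl K_def by (subst integral_torus_law) simp_all
  show ?thesis
  \<comment> \<open>\<open>K\<close> is supplied before \<open>\<alpha>\<close> is chosen: it is
    built from the symbol and the noise variance alone.\<close>
  proof (intro exI[of _ K] conjI allI impI)
    fix \<alpha> :: real and m assume "0 < \<alpha> \<and> \<alpha> < 1"
    then show "\<exists>\<phi>. neyman_pearson_detector M (site_square m) W ?Y \<alpha> \<phi>"
      unfolding np by (intro neyman_pearson_lemma prob L_int) auto
  next
    fix \<alpha> :: real and \<delta> assume \<alpha>: "0 < \<alpha> \<and> \<alpha> < 1"
      and "\<forall>m. neyman_pearson_detector M (site_square m) W ?Y \<alpha> (\<delta> m)"
    then have opt: "optimal_test (Q0 m) (\<lambda>y. exp (- \<Lambda> m y)) \<alpha> (\<delta> m)" for m unfolding np by blast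
    have "(\<lambda>m. - (1 / n m) * ln (\<integral>y. (1 - \<delta> m y) * exp (- \<Lambda> m y) \<partial>Q0 m)) \<longlonglongrightarrow> K"
      using \<alpha> by (intro stein_exponent[OF prob(1) \<Lambda>(1) L_int n n_lim \<mu>_lim \<Lambda>(3,4) _ _ opt]) auto
    then show "(\<lambda>m. - (1 / real ((2 * m + 1)\<^sup>2)) * ln (miss_prob M (site_square m) ?Y (\<delta> m))) \<longlonglongrightarrow> K"
      unfolding miss[OF opt] n_def .
  qed (fact K1 K2)+
qed

end
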